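(* Let $\mu$ be the Gaussian measure $d\mu(x)=e^{-\pi|x|^2}\,dx$ on $\mathbb{R}^n$, and let $R_n:=\sqrt{\frac{n-1}{2\pi}}$. There exist $p_1>p_0>1$, with approximate values $p_0\approx 1.011871$ and $p_1\approx 1.049427$, such that (i) for every $p<p_0$ there exists an $\alpha>1$ (only depending on $p$) such that $$C_{\mu,p}\ \ge\ T_{\mu,p}(R,r)\ \ge\ \alpha^n$$ for some $0<r<R<R_n$ with $\lambda=\frac rR<\sqrt2-1$; (ii) for every $p>p_1$, given any choice $0<r<R\le R_n$, there exists an $\alpha<1$ (only depending on $p$) such that $$T_{\mu,p}(R,r)\ \le\ \sqrt{\pi}\,n\,\alpha^n .$$
   Context: Here $n$ is the dimension and $p\ge1$. All balls are Euclidean: $B(x,R)$ is the ball in $\mathbb{R}^n$ of center $x$ and radius $R$, and $B_R=B(0,R)$. For a Borel measure $\mu$ on $\mathbb{R}^n$ and $g\in L^1_{loc}(\mathbb{R}^n)$, the associated centered maximal function is $$M_\mu g(x)=\sup_{R>0}\frac{1}{\mu(B(x,R))}\int_{B(x,R)}|g(y)|\,d\mu(y).$$ $C_{\mu,p}$ denotes the best (smallest) constant $C$ in the strong $L^p(\mu)$ inequality $\|M_\mu g\|_{L^p(\mu)}\le C\|g\|_{L^p(\mu)}$ for all $g\in L^p(\mu)$, with $C_{\mu,p}=\infty$ if there is no finite such constant. For radii $R>r>0$ and a unit vector $\xi\in\mathbb{R}^n$ (arbitrary, by rotation invariance of $\mu$), write $\tilde B=B(R\xi,R+r)$ and $$T_{\mu,p}(R,r)=\frac{\mu(B_R)}{\mu(\tilde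 B)}\left(\frac{\mu(B_r)}{\mu(B_R)}\right)^{\frac{p-1}{p}} .$$
   Formalization: In (ii), α depends on p and on a bound δ<1 with r ≤ δR_n: with α depending only on p the claim fails for R=R_n, r→R_n, where T stays near or above 1/2 as n→∞. For λ<√2−1, α depends only on p. Part (i) is for n≥2, since R_1=0. *)

theory Defs
  imports "HOL-Analysis.Analysis"
begin

text \<open>
  The bounds below are uniform in the dimension, so the dimension has to be a variable \<open>n :: nat\<close>
  and not a type: \<open>\<real>\<^sup>n\<close> is the space of the product \<open>\<Pi>\<^sub>M i\<in>{..<n}. lborel\<close>, that is, the set of
  functions on \<open>{..<n}\<close>, extended by \<open>undefined\<close> outside \<open>{..<n}\<close>.
\<close>

definition lborel_dim :: "nat \<Rightarrow> (nat \<Rightarrow> real) measure" where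
  "lborel_dim n = (\<Pi>\<^sub>M i\<in>{..<n}. lborel)"

definition norm_dim :: "nat \<Rightarrow> (nat \<Rightarrow> real) \<Rightarrow> real" where
  "norm_dim n x = L2_set x {..<n}"

definition ball_dim :: "nat \<Rightarrow> (nat \<Rightarrow> real) \<Rightarrow> real \<Rightarrow> (nat \<Rightarrow> real) set" where
  "ball_dim n x R = {y \<in> space (lborel_dim n). norm_dim n (\<lambda>i. y i - x i) < R}"

definition zero_dim :: "nat \<Rightarrow> nat \<Rightarrow> real" where
  "zero_dim n = (\<lambda>i\<in>{..<n}. 0)"

definition scale_dim :: "nat \<Rightarrow> real \<Rightarrow> (nat \<Rightarrow> real) \<Rightarrow> nat \<Rightarrow> real" where
  "scale_dim n c x = (\<lambda>i\<in>{..<n}. c * x i)"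

definition unit_vectors :: "nat \<Rightarrow> (nat \<Rightarrow> real) set" where
  "unit_vectors n = {x \<in> space (lborel_dim n). norm_dim n x = 1}"

definition gauss_measure :: "nat \<Rightarrow> (nat \<Rightarrow> real) measure" where
  "gauss_measure n = density (lborel_dim n) (\<lambda>x. ennreal (exp (- pi * (norm_dim n x)\<^sup>2)))"

definition maximal_fun ::
  "nat \<Rightarrow> (nat \<Rightarrow> real) measure \<Rightarrow> ((nat \<Rightarrow> real) \<Rightarrow> real) \<Rightarrow> (nat \<Rightarrow> real) \<Rightarrow> ennreal" where
  "maximal_fun n M g x =
     (SUP R\<in>{0<..}. (\<integral>\<^sup>+y\<in>ball_dim n x R. ennreal \<bar>g y\<bar> \<partial>M) / emeasure M (ball_dim n x R))"

text \<open>Powers with a positive real exponent on \<open>[0, \<infinity>]\<close>.\<close>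

definition ennreal_powr :: "ennreal \<Rightarrow> real \<Rightarrow> ennreal" where
  "ennreal_powr a s = (if a = \<infinity> then \<infinity> else ennreal (enn2real a powr s))"

definition Lp_norm :: "'a measure \<Rightarrow> real \<Rightarrow> ('a \<Rightarrow> ennreal) \<Rightarrow> ennreal" where
  "Lp_norm M p f = ennreal_powr (\<integral>\<^sup>+x. ennreal_powr (f x) p \<partial>M) (1 / p)"

definition strong_type_const :: "nat \<Rightarrow> (nat \<Rightarrow> real) measure \<Rightarrow> real \<Rightarrow> real \<Rightarrow> bool" where
  "strong_type_const n M p C \<longleftrightarrow>
     (\<forall>g \<in> borel_measurable M. Lp_norm M p (\<lambda>x. ennreal \<bar>g x\<bar>) < \<infinity> \<longrightarrow>
        Lp_norm M p (maximal_fun n M g) \<le> ennreal C * Lp_norm M p (\<lambda>x. ennreal \<bar>g x\<bar>))"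

text \<open>The value is \<open>\<infinity> = Inf {}\<close> if there is no finite constant.\<close>

definition best_const :: "nat \<Rightarrow> (nat \<Rightarrow> real) measure \<Rightarrow> real \<Rightarrow> ennreal" where
  "best_const n M p = Inf {ennreal C | C. 0 \<le> C \<and> strong_type_const n M p C}"

definition T_ratio ::
  "nat \<Rightarrow> (nat \<Rightarrow> real) measure \<Rightarrow> real \<Rightarrow> (nat \<Rightarrow> real) \<Rightarrow> real \<Rightarrow> real \<Rightarrow> real" where
  "T_ratio n M p \<xi> R r =
     measure M (ball_dim n (zero_dim n) R) / measure M (ball_dim n (scale_dim n R \<xi>) (R + r)) *
     (measure M (ball_dim n (zero_dim n) r) / measure M (ball_dim n (zero_dim n) R)) powr ((p - 1) / p)"

text \<open>
  As \<open>n\<close> grows, the Gaussian measure of the centred ball of radius \<open>crit_radius n\<close> tends to \<open>1/2\<close>.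
  Hence \<open>T_ratio\<close> stays close to \<open>1/2\<close>, for every \<open>p\<close>, when \<open>R = crit_radius n\<close> and \<open>r\<close> is very
  close to \<open>R\<close>. An exponentially decaying bound that is uniform in \<open>n\<close>, \<open>R\<close> and \<open>r\<close> therefore
  needs \<open>r / crit_radius n\<close> to be bounded away from \<open>1\<close>.
\<close>

definition crit_radius :: "nat \<Rightarrow> real" where
  "crit_radius n = sqrt ((real n - 1) / (2 * pi))"

end

theory Submission
  imports Defs
begin

text \<open>
  Write \<open>S = 2 pi R^2 / n\<close> and \<open>l = r / R\<close>. Translating the centre of the shifted ball to the origin
  turns its Gaussian measure into the integral of a radial weight times \<open>exp (- 2 pi R (y . \<xi>))\<close>.

  Growth: rotate \<open>\<xi>\<close> to \<open>(1, ..., 1) / sqrt n\<close>. Averaging over coordinate signs gives a product of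
  hyperbolic cosines, bounded by \<open>exp (pi S |y|^2)\<close>, so the shifted ball compares with a centred ball
  without any polynomial loss. \<open>S = 2/5\<close> and \<open>l = 1/50\<close> suffice for every dimension. The maximal
  function of the indicator of the ball of radius \<open>r\<close> gives the bound by the best constant.

  Decay: the shifted ball contains the half ball \<open>{a \<xi> + y. y . \<xi> \<ge> 0, |y| < b}\<close> as soon as
  \<open>a \<le> R\<close> and \<open>b^2 + (R - a)^2 = (R + r)^2\<close>. The choice of \<open>a\<close> that removes \<open>S\<close> from the
  exponential rate leaves a function of \<open>l\<close> alone, which is negative for \<open>l < sqrt 2 - 1\<close>. For larger
  \<open>l\<close> take \<open>a = 0\<close>, so that \<open>b \<ge> R\<close>. Neither argument is at its limit at \<open>1.011871\<close> or \<open>1.049427\<close>,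
  so these two values serve as \<open>p0\<close> and \<open>p1\<close> as they are.
\<close>

section \<open>Lebesgue measure on a finite product of lines\<close>

text \<open>The diagonal direction gives every coordinate the same coefficient, so the
  hyperbolic-cosine bound is radial and merely weakens the Gaussian weight. Along an axis the same
  bound would load a single coordinate and leave nothing radial to rescale.

  For decay the prefactor is exactly \<open>sqrt pi * n\<close> in every dimension, so an asymptotic
  rate is not enough. There are two subexponential losses: comparing centred balls up to the
  critical radius costs \<open>exp (O (sqrt n))\<close>, and the factor
  \<open>exp (- 2 * pi * a * (y . \<xi>))\<close> on the half ball costs a multiple of
  \<open>sqrt n\<close>. Both carry explicit constants. They are paid from the exponential rate for
  large \<open>n\<close>, and from the prefactor alone for \<open>n \<le> 16\<close>, where the
  margin is thin.

  The parameter \<open>p\<close> enters only through the exponent \<open>(p - 1) / p\<close> of a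
  ratio that is at most \<open>1\<close>. This exponent is below \<open>0.012\<close> for
  \<open>1 \<le> p < 1.011871\<close> and above \<open>3 / 64\<close> for
  \<open>p > 1.049427\<close>. Each regime thus reduces to one fixed exponent, and the base of the
  final power is free of \<open>p\<close>.\<close>

abbreviation lebPi :: "'i set \<Rightarrow> ('i \<Rightarrow> real) measure" where
  "lebPi I \<equiv> \<Pi>\<^sub>M i\<in>I. lborel"

text \<open>Induction on the index set: Fubini peels off the coordinate \<open>k\<close> and the
  one-dimensional substitution rescales it. Such diagonal maps cover translations, dilations, sign
  changes and the shrinking of a single coordinate; rotations are built separately from
  shears.\<close>

lemma nn_integral_lebPi_affine:
  fixes c t :: "'i \<Rightarrow> real"
  assumes "finite I" "\<And>i. i \<in> I \<Longrightarrow> c i \<noteq> 0" "f \<in> borel_measurable (lebPi I)"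
  shows "(\<integral>\<^sup>+x. f x \<partial>lebPi I) = ennreal (\<Prod>i\<in>I. \<bar>c i\<bar>) * (\<integral>\<^sup>+x. f (\<lambda>i\<in>I. t i + c i * x i) \<partial>lebPi I)"
  using assms
proof (induction I arbitrary: f rule: finite_induct)
  case empty
  have "(\<lambda>i\<in>{}. t i + c i * x i) = (\<lambda>i. undefined)" for x by auto
  then show ?case by (simp add: PiM_empty nn_integral_count_space_finite)
next
  case (insert k I)
  interpret product_sigma_finite "\<lambda>_::'i. lborel :: real measure" by standard
  note meas[measurable] = insert.prems(2)
  let ?A = "\<lambda>I x. (\<lambda>i\<in>I. t i + c i * x i)"
  have A: "?A J \<in> measurable (lebPi J) (lebPi J)" for J by measurable
  note [measurable] = A
  have [measurable]: "(\<lambda>(x, y). f (x(k := y))) \<in> borel_measurable (lebPi I \<Otimes>\<^sub>M lborel)"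
    using measurable_compose[OF measurable_add_dim meas] by (simp add: case_prod_beta')
  have in1[measurable]: "(\<lambda>x. \<integral>\<^sup>+y. f (x(k := y)) \<partial>lborel) \<in> borel_measurable (lebPi I)"
    by (rule lborel.borel_measurable_nn_integral) measurable
  have up: "?A (insert k I) (x(k := y)) = (?A I x)(k := t k + c k * y)" if "x \<in> space (lebPi I)" for x y
    using insert.hyps that by (auto simp: fun_eq_iff)
  have "(\<integral>\<^sup>+x. f x \<partial>lebPi (insert k I)) = (\<integral>\<^sup>+x. (\<integral>\<^sup>+y. f (x(k := y)) \<partial>lborel) \<partial>lebPi I)"
    by (rule product_nn_integral_insert) (use insert in auto)
  also have "\<dots> = ennreal (\<Prod>i\<in>I. \<bar>c i\<bar>) * (\<integral>\<^sup>+x. (\<integral>\<^sup>+y. f ((?A I x)(k := y)) \<partial>lborel) \<partial>lebPi I)"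
    by (rule insert.IH[OF _ in1]) (use insert in auto)
  also have "(\<integral>\<^sup>+x. (\<integral>\<^sup>+y. f ((?A I x)(k := y)) \<partial>lborel) \<partial>lebPi I)
     = (\<integral>\<^sup>+x. ennreal \<bar>c k\<bar> * (\<integral>\<^sup>+y. f ((?A I x)(k := t k + c k * y)) \<partial>lborel) \<partial>lebPi I)"
  proof (rule nn_integral_cong)
    fix x :: "'i \<Rightarrow> real" assume x[measurable]: "x \<in> space (lebPi I)"
    have [measurable]: "?A I x \<in> space (lebPi I)" by (auto simp: space_PiM)
    show "(\<integral>\<^sup>+y. f ((?A I x)(k := y)) \<partial>lborel) = ennreal \<bar>c k\<bar> * (\<integral>\<^sup>+y. f ((?A I x)(k := t k + c k * y)) \<partial>lborel)"
    proof (rule nn_integral_real_affine)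
      have "(\<lambda>y. (?A I x)(k := y)) \<in> measurable lborel (lebPi (insert k I))"
        by (rule measurable_component_update) (use insert.hyps in \<open>auto simp: space_PiM\<close>)
      from measurable_compose[OF this meas]
      show "(\<lambda>y. f ((?A I x)(k := y))) \<in> borel_measurable borel" by simp
    qed (use insert.prems in auto)
  qed
  also have "\<dots> = ennreal \<bar>c k\<bar> * (\<integral>\<^sup>+x. (\<integral>\<^sup>+y. f ((?A I x)(k := t k + c k * y)) \<partial>lborel) \<partial>lebPi I)"
  proof (rule nn_integral_cmult)
    have "(\<lambda>(x, y). f ((?A I x)(k := t k + c k * y))) \<in> borel_measurable (lebPi I \<Otimes>\<^sub>M lborel)"
      unfolding case_prod_beta'
      by (rule measurable_compose[OF _ meas], rule measurable_fun_upd) auto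
    then show "(\<lambda>x. \<integral>\<^sup>+y. f ((?A I x)(k := t k + c k * y)) \<partial>lborel) \<in> borel_measurable (lebPi I)"
      by (rule lborel.borel_measurable_nn_integral)
  qed
  also have "(\<integral>\<^sup>+x. (\<integral>\<^sup>+y. f ((?A I x)(k := t k + c k * y)) \<partial>lborel) \<partial>lebPi I)
    = (\<integral>\<^sup>+x. (\<integral>\<^sup>+y. f (?A (insert k I) (x(k := y))) \<partial>lborel) \<partial>lebPi I)"
    by (intro nn_integral_cong) (simp only: up)
  also have "\<dots> = (\<integral>\<^sup>+x. f (?A (insert k I) x) \<partial>lebPi (insert k I))"
    by (rule product_nn_integral_insert[symmetric]) (use insert in auto)
  finally have "(\<integral>\<^sup>+x. f x \<partial>lebPi (insert k I)) = ennreal (\<Prod>i\<in>I. \<bar>c i\<bar>) *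
      (ennreal \<bar>c k\<bar> * (\<integral>\<^sup>+x. f (?A (insert k I) x) \<partial>lebPi (insert k I)))" .
  moreover have "ennreal (\<Prod>i\<in>insert k I. \<bar>c i\<bar>) = ennreal (\<Prod>i\<in>I. \<bar>c i\<bar>) * ennreal \<bar>c k\<bar>"
    using insert.hyps by (simp add: ennreal_mult[symmetric] prod_nonneg mult.commute)
  ultimately show ?case by (simp only: mult.assoc)
qed

text \<open>With coordinate \<open>i\<close> integrated innermost, \<open>c * x j\<close> is a
  constant and the shear is a translation of a line.\<close>

lemma nn_integral_lebPi_shear:
  fixes c :: real
  assumes I: "finite I" "i \<in> I" "j \<in> I" "i \<noteq> j" and f[measurable]: "f \<in> borel_measurable (lebPi I)"
  shows "(\<integral>\<^sup>+x. f (x(i := x i + c * x j)) \<partial>lebPi I) = (\<integral>\<^sup>+x. f x \<partial>lebPi I)"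
proof -
  interpret product_sigma_finite "\<lambda>_. lborel :: real measure" by standard
  define K where "K = I - {i}"
  have K: "finite K" "i \<notin> K" "I = insert i K" "j \<in> K" using I by (auto simp: K_def)
  have S: "(\<lambda>x. x(i := x i + c * x j)) \<in> measurable (lebPi I) (lebPi I)"
    by (rule measurable_fun_upd[where J = I]) (use I in auto)
  have "(\<integral>\<^sup>+x. f (x(i := x i + c * x j)) \<partial>lebPi I)
      = (\<integral>\<^sup>+x. (\<integral>\<^sup>+y. f (x(i := y + c * x j)) \<partial>lborel) \<partial>lebPi K)"
    using K measurable_compose[OF S f] I unfolding K(3)
    by (subst product_nn_integral_insert) auto
  also have "\<dots> = (\<integral>\<^sup>+x. (\<integral>\<^sup>+y. f (x(i := y)) \<partial>lborel) \<partial>lebPi K)"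
  proof (rule nn_integral_cong)
    fix x assume x: "x \<in> space (lebPi K)"
    have "(\<lambda>y. x(i := y)) \<in> measurable lborel (lebPi I)"
      unfolding K(3) by (rule measurable_component_update) (use K x in auto)
    from measurable_compose[OF this f]
    have "(\<lambda>y. f (x(i := y))) \<in> borel_measurable borel" by simp
    from nn_integral_real_affine[OF this, of 1 "c * x j"]
    show "(\<integral>\<^sup>+y. f (x(i := y + c * x j)) \<partial>lborel) = (\<integral>\<^sup>+y. f (x(i := y)) \<partial>lborel)"
      by (simp add: add.commute)
  qed
  also have "\<dots> = (\<integral>\<^sup>+x. f x \<partial>lebPi I)"
    using K f unfolding K(3) by (subst product_nn_integral_insert) auto
  finally show ?thesis .
qed

text \<open>A plane rotation is a product of three shears, each of which preserves the measure. The
  factorisation divides by \<open>s\<close>, which excludes the angles \<open>0\<close> and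
  \<open>pi\<close>.\<close>

lemma nn_integral_lebPi_rotation:
  fixes c s :: real
  assumes I: "finite I" "i \<in> I" "j \<in> I" "i \<noteq> j" and f: "f \<in> borel_measurable (lebPi I)"
    and cs: "c\<^sup>2 + s\<^sup>2 = 1" "s \<noteq> 0"
  shows "(\<integral>\<^sup>+x. f (x(i := c * x i + s * x j, j := c * x j - s * x i)) \<partial>lebPi I) = (\<integral>\<^sup>+x. f x \<partial>lebPi I)"
proof -
  \<comment> \<open>\<open>u\<close> is the tangent of half the rotation angle.\<close>
  define u where "u = (1 - c) / s"
  have u: "u * s = 1 - c" "u * (1 + c) = s"
    using cs by (auto simp: u_def field_simps power2_eq_square)
  define A where "A = (\<lambda>x :: 'a \<Rightarrow> real. x(i := x i + u * x j))"
  define B where "B = (\<lambda>x :: 'a \<Rightarrow> real. x(j := x j + (- s) * x i))"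
  have m: "A \<in> measurable (lebPi I) (lebPi I)" "B \<in> measurable (lebPi I) (lebPi I)"
    unfolding A_def B_def by (rule measurable_fun_upd[where J = I]; use I in auto)+
  have "A (B (A x)) = x(i := c * x i + s * x j, j := c * x j - s * x i)" for x
  proof -
    have "x i + u * x j + u * (x j + - s * (x i + u * x j)) = (1 - u * s) * x i + (u * (1 + (1 - u * s))) * x j"
      by (simp add: algebra_simps)
    moreover have "x j + - s * (x i + u * x j) = (1 - u * s) * x j - s * x i"
      by (simp add: algebra_simps)
    ultimately show ?thesis using I by (auto simp: A_def B_def fun_eq_iff u)
  qed
  then have "(\<integral>\<^sup>+x. f (x(i := c * x i + s * x j, j := c * x j - s * x i)) \<partial>lebPi I)
     = (\<integral>\<^sup>+x. f (A (B (A x))) \<partial>lebPi I)" by simp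
  also have "\<dots> = (\<integral>\<^sup>+x. f (A (B x)) \<partial>lebPi I)"
    unfolding A_def[THEN fun_cong]
    by (rule nn_integral_lebPi_shear)
       (use I in \<open>auto intro!: measurable_compose[OF m(2)] measurable_compose[OF m(1), unfolded A_def] f\<close>)
  also have "\<dots> = (\<integral>\<^sup>+x. f (A x) \<partial>lebPi I)"
    unfolding B_def
    by (rule nn_integral_lebPi_shear) (use I in \<open>auto intro!: measurable_compose[OF m(1)] f\<close>)
  also have "\<dots> = (\<integral>\<^sup>+x. f x \<partial>lebPi I)"
    unfolding A_def by (rule nn_integral_lebPi_shear) (use I f in auto)
  finally show ?thesis .
qed

section \<open>Norm and inner product\<close>

definition dot_dim :: "nat \<Rightarrow> (nat \<Rightarrow> real) \<Rightarrow> (nat \<Rightarrow> real) \<Rightarrow> real" where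
  "dot_dim n x y = (\<Sum>i<n. x i * y i)"

lemma norm_dim_nonneg [simp]: "norm_dim n x \<ge> 0"
  by (simp add: norm_dim_def L2_set_nonneg)

lemma norm_dim_sq: "(norm_dim n x)\<^sup>2 = (\<Sum>i<n. (x i)\<^sup>2)"
  by (simp add: norm_dim_def L2_set_def sum_nonneg)

lemma norm_dim_eqI: "(norm_dim n x)\<^sup>2 = (norm_dim n y)\<^sup>2 \<Longrightarrow> norm_dim n x = norm_dim n y"
  by (simp add: power2_eq_iff_nonneg)

lemma norm_dim_less_iff: "R > 0 \<Longrightarrow> norm_dim n x < R \<longleftrightarrow> (norm_dim n x)\<^sup>2 < R\<^sup>2"
  by (meson norm_dim_nonneg power2_less_imp_less power_strict_mono less_imp_le pos2)

lemma norm_dim_cong: "(\<And>i. i < n \<Longrightarrow> x i = y i) \<Longrightarrow> norm_dim n x = norm_dim n y"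
  by (rule norm_dim_eqI) (simp add: norm_dim_sq)

lemma norm_dim_add_scale_sq:
  "(norm_dim n (\<lambda>i. y i + c * x i))\<^sup>2 = (norm_dim n y)\<^sup>2 + 2 * c * dot_dim n x y + c\<^sup>2 * (norm_dim n x)\<^sup>2"
  by (simp add: norm_dim_sq dot_dim_def power2_sum sum.distrib sum_distrib_left algebra_simps)

lemma norm_dim_scale: "norm_dim n (\<lambda>i. c * x i) = \<bar>c\<bar> * norm_dim n x"
  by (rule power2_eq_imp_eq)
     (simp_all add: power_mult_distrib norm_dim_sq sum_distrib_left)

lemma norm_dim_triangle: "norm_dim n (\<lambda>i. x i + y i) \<le> norm_dim n x + norm_dim n y"
  unfolding norm_dim_def by (rule L2_set_triangle_ineq)

lemma space_lborel_dim: "space (lborel_dim n) = extensional {..<n}"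
  by (simp add: lborel_dim_def space_PiM PiE_def)

lemma measurable_component_lborel_dim [measurable]:
  "i < n \<Longrightarrow> (\<lambda>x. x i) \<in> borel_measurable (lborel_dim n)"
  using measurable_component_singleton[of i "{..<n}" "\<lambda>_. lborel :: real measure"] by (simp add: lborel_dim_def)

lemma measurable_norm_dim [measurable]:
  assumes [measurable]: "\<And>i. i < n \<Longrightarrow> (\<lambda>x. f x i) \<in> borel_measurable M"
  shows "(\<lambda>x. norm_dim n (f x)) \<in> borel_measurable M"
  unfolding norm_dim_def L2_set_def by measurable

lemma measurable_dot_dim [measurable]:
  assumes [measurable]: "\<And>i. i < n \<Longrightarrow> (\<lambda>x. f x i) \<in> borel_measurable M"
  shows "(\<lambda>x. dot_dim n z (f x)) \<in> borel_measurable M"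
  unfolding dot_dim_def by measurable

lemma sets_ball_dim [measurable]: "ball_dim n x R \<in> sets (lborel_dim n)"
  unfolding ball_dim_def by measurable

lemma dot_dim_axis: "0 < n \<Longrightarrow> (\<And>i. 0 < i \<Longrightarrow> i < n \<Longrightarrow> x i = 0) \<Longrightarrow> dot_dim n x y = x 0 * y 0"
  unfolding dot_dim_def by (subst sum.remove[of _ 0]) auto

section \<open>Rotation invariance of radial integrals\<close>

lemma sum_two:
  fixes n :: nat
  assumes "i < n" "j < n" "i \<noteq> j"
  shows "(\<Sum>k<n. f k) = f i + f j + (\<Sum>k\<in>{..<n} - {i, j}. f k :: real)"
proof -
  have "(\<Sum>k<n. f k) = f i + (\<Sum>k\<in>{..<n} - {i}. f k)"
    using assms by (subst sum.remove[of _ i]) auto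
  also have "(\<Sum>k\<in>{..<n} - {i}. f k) = f j + (\<Sum>k\<in>{..<n} - {i} - {j}. f k)"
    using assms by (subst sum.remove[of _ j]) auto
  finally show ?thesis by (simp add: Diff_insert2[symmetric] insert_commute)
qed

text \<open>Induction on an index \<open>m\<close> beyond which \<open>z\<close> vanishes. Each step
  rotates the plane of the coordinates \<open>m\<close> and \<open>Suc m\<close> so that
  \<open>z\<close> loses its component \<open>Suc m\<close>, while norms and inner products are
  kept. In the end \<open>z\<close> lies on the first axis, and a reflection removes its
  sign.\<close>

lemma nn_integral_radial_dot_aux:
  assumes "m < n" and F: "F \<in> borel_measurable (borel \<Otimes>\<^sub>M borel)"
    and "\<And>i. m < i \<Longrightarrow> i < n \<Longrightarrow> z i = 0"
  shows "(\<integral>\<^sup>+y. F (norm_dim n y, dot_dim n z y) \<partial>lborel_dim n)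
       = (\<integral>\<^sup>+y. F (norm_dim n y, norm_dim n z * y 0) \<partial>lborel_dim n)"
  using assms(1,3)
proof (induction m arbitrary: z)
  case 0
  note F[measurable]
  have dz: "dot_dim n z y = z 0 * y 0" for y using 0 by (intro dot_dim_axis) auto
  have "(norm_dim n z)\<^sup>2 = dot_dim n z z" unfolding norm_dim_sq by (simp add: dot_dim_def power2_eq_square)
  also have "\<dots> = (z 0)\<^sup>2" by (simp add: dz power2_eq_square)
  finally have "(norm_dim n z)\<^sup>2 = \<bar>z 0\<bar>\<^sup>2" by simp
  then have nz: "norm_dim n z = \<bar>z 0\<bar>" by (rule power2_eq_imp_eq) simp_all
  show ?case
  proof (cases "z 0 \<ge> 0")
    case True
    then show ?thesis by (simp add: dz nz)
  next
    case False
    define c :: "nat \<Rightarrow> real" where "c = (\<lambda>i. if i = 0 then - 1 else 1)"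
    have c1: "(\<Prod>i<n. \<bar>c i\<bar>) = 1" by (rule prod.neutral) (simp add: c_def)
    have nn: "norm_dim n (\<lambda>i\<in>{..<n}. 0 + c i * x i) = norm_dim n x" for x
      by (rule norm_dim_eqI, unfold norm_dim_sq, rule sum.cong) (auto simp: c_def)
    have "(\<integral>\<^sup>+y. F (norm_dim n y, dot_dim n z y) \<partial>lborel_dim n)
       = ennreal (\<Prod>i<n. \<bar>c i\<bar>) * (\<integral>\<^sup>+y. F (norm_dim n (\<lambda>i\<in>{..<n}. 0 + c i * y i), dot_dim n z (\<lambda>i\<in>{..<n}. 0 + c i * y i)) \<partial>lborel_dim n)"
      unfolding lborel_dim_def
      by (rule nn_integral_lebPi_affine, unfold lborel_dim_def[symmetric]) (auto simp: c_def)
    also have "\<dots> = (\<integral>\<^sup>+y. F (norm_dim n y, norm_dim n z * y 0) \<partial>lborel_dim n)"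
      unfolding c1 nn using False 0 by (simp add: dz nz c_def)
    finally show ?thesis .
  qed
next
  case (Suc m)
  note F[measurable]
  show ?case
  proof (cases "z (Suc m) = 0")
    case True
    have "z i = 0" if "m < i" "i < n" for i
      using True Suc.prems(2)[of i] that by (cases "i = Suc m") auto
    with Suc show ?thesis by auto
  next
    case False
    define \<rho> where "\<rho> = sqrt ((z m)\<^sup>2 + (z (Suc m))\<^sup>2)"
    have \<rho>: "\<rho> > 0" "\<rho>\<^sup>2 = (z m)\<^sup>2 + (z (Suc m))\<^sup>2"
      using False by (auto simp: \<rho>_def sum_power2_gt_zero_iff)
    define c s where "c = z m / \<rho>" and "s = z (Suc m) / \<rho>"
    have cs: "c\<^sup>2 + s\<^sup>2 = 1" "s \<noteq> 0"
      using \<rho> False by (auto simp: c_def s_def power_divide add_divide_distrib[symmetric])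
    \<comment> \<open>\<open>z'\<close> is the image of \<open>z\<close> under the rotation
      \<open>G\<close>: the length \<open>\<rho>\<close> of the pair \<open>(z m, z (Suc m))\<close>
      is collected in coordinate \<open>m\<close>.\<close>
    define z' where "z' = z(m := \<rho>, Suc m := 0)"
    define G where "G = (\<lambda>y :: nat \<Rightarrow> real. y(m := c * y m + s * y (Suc m), Suc m := c * y (Suc m) - s * y m))"
    note two = sum_two[of m n "Suc m"]
    have nG: "norm_dim n (G y) = norm_dim n y" for y
    proof (rule norm_dim_eqI)
      have "(c * y m + s * y (Suc m))\<^sup>2 + (c * y (Suc m) - s * y m)\<^sup>2 = (c\<^sup>2 + s\<^sup>2) * ((y m)\<^sup>2 + (y (Suc m))\<^sup>2)"
        by (simp add: power2_eq_square algebra_simps)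
      then show "(norm_dim n (G y))\<^sup>2 = (norm_dim n y)\<^sup>2"
        using Suc.prems(1) by (simp add: norm_dim_sq two G_def cs)
    qed
    have dG: "dot_dim n z' (G y) = dot_dim n z y" for y
      using Suc.prems(1) \<rho> by (simp add: dot_dim_def two G_def z'_def c_def s_def field_simps)
    have nz: "norm_dim n z' = norm_dim n z"
      by (rule norm_dim_eqI) (use Suc.prems(1) \<rho> in \<open>simp add: norm_dim_sq two z'_def\<close>)
    have "(\<integral>\<^sup>+y. F (norm_dim n y, dot_dim n z y) \<partial>lborel_dim n)
        = (\<integral>\<^sup>+y. F (norm_dim n (G y), dot_dim n z' (G y)) \<partial>lborel_dim n)"
      by (simp only: nG dG)
    also have "\<dots> = (\<integral>\<^sup>+y. F (norm_dim n y, dot_dim n z' y) \<partial>lborel_dim n)"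
      unfolding G_def lborel_dim_def
      by (rule nn_integral_lebPi_rotation[where f = "\<lambda>y. F (norm_dim n y, dot_dim n z' y)"],
          unfold lborel_dim_def[symmetric]) (use Suc.prems(1) cs in auto)
    also have "\<dots> = (\<integral>\<^sup>+y. F (norm_dim n y, norm_dim n z' * y 0) \<partial>lborel_dim n)"
    proof (rule Suc.IH)
      show "z' i = 0" if "m < i" "i < n" for i
        using Suc.prems(2)[of i] that by (cases "i = Suc m") (auto simp: z'_def)
    qed (use Suc.prems in auto)
    finally show ?thesis by (simp only: nz)
  qed
qed

text \<open>Both sides reduce to the first axis. The free choice of the vector serves the upper
  bound for shifted balls (diagonal direction), the lower bound (first axis) and the independence of
  the measure from the direction.\<close>

lemma nn_integral_radial_dot:
  assumes "0 < n" "norm_dim n z = norm_dim n z'" "F \<in> borel_measurable (borel \<Otimes>\<^sub>M borel)"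
  shows "(\<integral>\<^sup>+y. F (norm_dim n y, dot_dim n z y) \<partial>lborel_dim n)
       = (\<integral>\<^sup>+y. F (norm_dim n y, dot_dim n z' y) \<partial>lborel_dim n)"
  using nn_integral_radial_dot_aux[of "n - 1" n F z] nn_integral_radial_dot_aux[of "n - 1" n F z'] assms
  by simp

lemma sets_gauss_measure [simp, measurable_cong]: "sets (gauss_measure n) = sets (lborel_dim n)"
  by (simp add: gauss_measure_def)

lemma emeasure_gauss:
  assumes [measurable]: "A \<in> sets (lborel_dim n)"
  shows "emeasure (gauss_measure n) A = (\<integral>\<^sup>+y. ennreal (exp (- pi * (norm_dim n y)\<^sup>2)) * indicator A y \<partial>lborel_dim n)"
  unfolding gauss_measure_def by (rule emeasure_density) measurable

section \<open>Integrals over shifted balls\<close>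

text \<open>\<open>cosh x * exp (- x^2 / 2)\<close> is nonincreasing for \<open>x \<ge> 0\<close>,
  because \<open>sinh y \<le> y * cosh y\<close> there; evenness does the rest.\<close>

lemma cosh_le_exp_half_square: "exp x + exp (- x) \<le> 2 * exp (x\<^sup>2 / 2 :: real)"
proof -
  have main: "cosh x \<le> exp (x\<^sup>2 / 2)" if "x \<ge> 0" for x :: real
  proof -
    have s: "sinh y \<le> y * cosh y" if "y \<ge> 0" for y :: real
    proof -
      have "\<exists>D. ((\<lambda>y. y * cosh y - sinh y) has_real_derivative D) (at y) \<and> D \<ge> 0" if "0 \<le> y" for y :: real
        by (rule exI[of _ "y * sinh y"]) (use that in \<open>auto intro!: derivative_eq_intros\<close>)
      from DERIV_nonneg_imp_nondecreasing[OF \<open>y \<ge> 0\<close> this] show ?thesis by simp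
    qed
    have "\<exists>D. ((\<lambda>y. cosh y * exp (- (y\<^sup>2 / 2))) has_real_derivative D) (at y) \<and> D \<le> 0" if "0 \<le> y" for y :: real
      by (rule exI[of _ "(sinh y - y * cosh y) * exp (- (y\<^sup>2 / 2))"])
         (use s[OF that] in \<open>auto intro!: derivative_eq_intros mult_nonpos_nonneg simp: algebra_simps\<close>)
    from DERIV_nonpos_imp_nonincreasing[OF \<open>x \<ge> 0\<close> this]
    have "cosh x * exp (- (x\<^sup>2 / 2)) \<le> 1" by simp
    then show ?thesis by (simp add: exp_minus field_simps)
  qed
  have "cosh x \<le> exp (x\<^sup>2 / 2)"
    using main[of x] main[of "- x"] by (cases "x \<ge> 0") auto
  then show ?thesis by (simp add: cosh_field_def)
qed

lemma nn_integral_lborel_dim_affine: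
  assumes "\<And>i. i < n \<Longrightarrow> c i \<noteq> 0" "f \<in> borel_measurable (lborel_dim n)"
  shows "(\<integral>\<^sup>+x. f x \<partial>lborel_dim n)
    = ennreal (\<Prod>i<n. \<bar>c i\<bar>) * (\<integral>\<^sup>+x. f (\<lambda>i\<in>{..<n}. t i + c i * x i) \<partial>lborel_dim n)"
  using nn_integral_lebPi_affine[of "{..<n}" c f t] assms by (simp add: lborel_dim_def)

lemma nn_integral_lborel_dim_scale:
  assumes "k > 0" and [measurable]: "G \<in> borel_measurable borel"
  shows "(\<integral>\<^sup>+x. G (norm_dim n x) \<partial>lborel_dim n) = ennreal (k ^ n) * (\<integral>\<^sup>+x. G (k * norm_dim n x) \<partial>lborel_dim n)"
proof -
  have "norm_dim n (\<lambda>i\<in>{..<n}. 0 + k * x i) = k * norm_dim n x" for x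
    using norm_dim_scale[of n k x] assms(1) by (simp cong: norm_dim_cong)
  moreover have "(\<integral>\<^sup>+x. G (norm_dim n x) \<partial>lborel_dim n)
    = ennreal (\<Prod>i<n. \<bar>k\<bar>) * (\<integral>\<^sup>+x. G (norm_dim n (\<lambda>i\<in>{..<n}. 0 + k * x i)) \<partial>lborel_dim n)"
    by (rule nn_integral_lborel_dim_affine) (use assms(1) in auto)
  ultimately show ?thesis using assms(1) by simp
qed

lemma nn_integral_lborel_dim_flip:
  assumes "k < n" "f \<in> borel_measurable (lborel_dim n)"
  shows "(\<integral>\<^sup>+x. f (x(k := - x k)) \<partial>lborel_dim n) = (\<integral>\<^sup>+x. f x \<partial>lborel_dim n)"
proof -
  define c :: "nat \<Rightarrow> real" where "c = (\<lambda>i. if i = k then - 1 else 1)"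
  have "(\<integral>\<^sup>+x. f x \<partial>lborel_dim n)
    = ennreal (\<Prod>i<n. \<bar>c i\<bar>) * (\<integral>\<^sup>+x. f (\<lambda>i\<in>{..<n}. 0 + c i * x i) \<partial>lborel_dim n)"
    by (rule nn_integral_lborel_dim_affine) (use assms in \<open>auto simp: c_def\<close>)
  also have "(\<Prod>i<n. \<bar>c i\<bar>) = 1" by (rule prod.neutral) (simp add: c_def)
  also have "(\<integral>\<^sup>+x. f (\<lambda>i\<in>{..<n}. 0 + c i * x i) \<partial>lborel_dim n) = (\<integral>\<^sup>+x. f (x(k := - x k)) \<partial>lborel_dim n)"
  proof (rule nn_integral_cong)
    fix x assume "x \<in> space (lborel_dim n)"
    then have "(\<lambda>i\<in>{..<n}. 0 + c i * x i) = x(k := - x k)"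
      using assms(1) by (auto simp: space_lborel_dim extensional_def c_def fun_eq_iff)
    then show "f (\<lambda>i\<in>{..<n}. 0 + c i * x i) = f (x(k := - x k))" by simp
  qed
  finally show ?thesis by simp
qed

lemma norm_dim_flip: "norm_dim n (y(k := - y k)) = norm_dim n y"
  by (rule norm_dim_eqI, unfold norm_dim_sq, rule sum.cong) auto

lemma measurable_flip [measurable]:
  "k < n \<Longrightarrow> (\<lambda>x. x(k := - x k)) \<in> measurable (lborel_dim n) (lborel_dim n)"
  unfolding lborel_dim_def
  by (rule measurable_fun_upd[where J = "{..<n}"]) (auto simp flip: lborel_dim_def)

lemma ennreal_add_self_le_cancel: "x + x \<le> y + y \<Longrightarrow> x \<le> (y :: ennreal)"
  by (metis add_strict_mono not_less)

text \<open>Averaging over the sign of each coordinate replaces \<open>exp (c * y i)\<close> by \<open>cosh (c * y i)\<close>.\<close>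

lemma nn_integral_exp_sum_le:
  assumes W[measurable]: "W \<in> borel_measurable borel"
  shows "(\<integral>\<^sup>+y. W (norm_dim n y) * ennreal (exp (\<Sum>i<n. c * y i)) \<partial>lborel_dim n)
       \<le> (\<integral>\<^sup>+y. W (norm_dim n y) * ennreal (exp (c\<^sup>2 / 2 * (norm_dim n y)\<^sup>2)) \<partial>lborel_dim n)"
proof -
  have "(\<integral>\<^sup>+y. W (norm_dim n y) * ennreal (exp (\<Sum>i<n. c * y i)) \<partial>lborel_dim n)
     \<le> (\<integral>\<^sup>+y. W (norm_dim n y) * ennreal (exp ((\<Sum>i\<in>K. (c * y i)\<^sup>2 / 2) + (\<Sum>i\<in>{..<n} - K. c * y i))) \<partial>lborel_dim n)"
    if "finite K" "K \<subseteq> {..<n}" for K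
    using that
  proof (induction K rule: finite_induct)
    case empty
    then show ?case by simp
  next
    case (insert k K)
    then have k: "k < n" and KK: "\<And>i. i \<in> K \<Longrightarrow> i < n" by auto
    \<comment> \<open>\<open>e\<close> is the exponent without the \<open>k\<close>-th term, so
      \<open>h\<close> is even in that coordinate and the flip only changes the sign of
      \<open>c * y k\<close>.\<close>
    define e where "e = (\<lambda>y. (\<Sum>i\<in>K. (c * y i)\<^sup>2 / 2) + (\<Sum>i\<in>{..<n} - insert k K. c * y i))"
    define h where "h = (\<lambda>y. W (norm_dim n y) * ennreal (exp (e y)))"
    have e[measurable]: "e \<in> borel_measurable (lborel_dim n)"
      unfolding e_def using KK by measurable
    have h[measurable]: "h \<in> borel_measurable (lborel_dim n)"
      unfolding h_def by measurable
    note [measurable] = measurable_component_lborel_dim[OF k]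
    have ef: "e (y(k := - y k)) = e y" for y
      unfolding e_def by (intro arg_cong2[where f = "(+)"] sum.cong) (use insert in auto)
    have hf: "h (y(k := - y k)) = h y" for y
      by (simp add: h_def ef norm_dim_flip)
    have "(\<integral>\<^sup>+y. h y * ennreal (exp (c * y k)) \<partial>lborel_dim n)
        = (\<integral>\<^sup>+y. h (y(k := - y k)) * ennreal (exp (c * (y(k := - y k)) k)) \<partial>lborel_dim n)"
      by (rule nn_integral_lborel_dim_flip[symmetric, OF k]) measurable
    also have "\<dots> = (\<integral>\<^sup>+y. h y * ennreal (exp (- (c * y k))) \<partial>lborel_dim n)"
      by (simp only: hf) simp
    finally have fl: "(\<integral>\<^sup>+y. h y * ennreal (exp (c * y k)) \<partial>lborel_dim n)
        = (\<integral>\<^sup>+y. h y * ennreal (exp (- (c * y k))) \<partial>lborel_dim n)" .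
    have "(\<integral>\<^sup>+y. h y * ennreal (exp (c * y k)) \<partial>lborel_dim n) + (\<integral>\<^sup>+y. h y * ennreal (exp (c * y k)) \<partial>lborel_dim n)
        = (\<integral>\<^sup>+y. h y * ennreal (exp (c * y k)) + h y * ennreal (exp (- (c * y k))) \<partial>lborel_dim n)"
      by (subst (2) fl) (rule nn_integral_add[symmetric]; measurable)
    also have "\<dots> \<le> (\<integral>\<^sup>+y. h y * ennreal (exp ((c * y k)\<^sup>2 / 2)) + h y * ennreal (exp ((c * y k)\<^sup>2 / 2)) \<partial>lborel_dim n)"
    proof (rule nn_integral_mono)
      fix y
      have "ennreal (exp (c * y k)) + ennreal (exp (- (c * y k))) \<le> ennreal (exp ((c * y k)\<^sup>2 / 2)) + ennreal (exp ((c * y k)\<^sup>2 / 2))"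
        using cosh_le_exp_half_square[of "c * y k"] by (simp flip: ennreal_plus)
      then show "h y * ennreal (exp (c * y k)) + h y * ennreal (exp (- (c * y k)))
          \<le> h y * ennreal (exp ((c * y k)\<^sup>2 / 2)) + h y * ennreal (exp ((c * y k)\<^sup>2 / 2))"
        by (simp only: distrib_left[symmetric]) (rule mult_left_mono, auto)
    qed
    also have "\<dots> = (\<integral>\<^sup>+y. h y * ennreal (exp ((c * y k)\<^sup>2 / 2)) \<partial>lborel_dim n) + (\<integral>\<^sup>+y. h y * ennreal (exp ((c * y k)\<^sup>2 / 2)) \<partial>lborel_dim n)"
      by (rule nn_integral_add; measurable)
    \<comment> \<open>Doubling both sides stands in for the average over the two signs and avoids a
      division in \<open>ennreal\<close>.\<close>
    finally have le: "(\<integral>\<^sup>+y. h y * ennreal (exp (c * y k)) \<partial>lborel_dim n)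
      \<le> (\<integral>\<^sup>+y. h y * ennreal (exp ((c * y k)\<^sup>2 / 2)) \<partial>lborel_dim n)"
      by (rule ennreal_add_self_le_cancel)
    have 1: "(\<Sum>i\<in>K. (c * y i)\<^sup>2 / 2) + (\<Sum>i\<in>{..<n} - K. c * y i) = e y + c * y k" for y
    proof -
      have "(\<Sum>i\<in>{..<n} - K. c * y i) = c * y k + (\<Sum>i\<in>{..<n} - K - {k}. c * y i)"
        by (rule sum.remove) (use insert k in auto)
      also have "{..<n} - K - {k} = {..<n} - insert k K" by auto
      finally show ?thesis unfolding e_def by linarith
    qed
    have 2: "(\<Sum>i\<in>insert k K. (c * y i)\<^sup>2 / 2) + (\<Sum>i\<in>{..<n} - insert k K. c * y i) = e y + (c * y k)\<^sup>2 / 2" for y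
      using insert.hyps by (simp add: e_def)
    show ?case
      using insert.IH insert.prems le unfolding 1 2 h_def
      by (simp add: exp_add ennreal_mult mult.assoc)
  qed
  from this[of "{..<n}"] have main: "(\<integral>\<^sup>+y. W (norm_dim n y) * ennreal (exp (\<Sum>i<n. c * y i)) \<partial>lborel_dim n)
     \<le> (\<integral>\<^sup>+y. W (norm_dim n y) * ennreal (exp (\<Sum>i<n. (c * y i)\<^sup>2 / 2)) \<partial>lborel_dim n)" by simp
  have "(\<Sum>i<n. (c * y i)\<^sup>2 / 2) = c\<^sup>2 / 2 * (norm_dim n y)\<^sup>2" for y
    by (simp add: norm_dim_sq sum_distrib_left power_mult_distrib)
  with main show ?thesis by (simp only:)
qed

section \<open>Balls as integrals of a weight in norm and inner product\<close>

lemma emeasure_gauss_ball: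
  "emeasure (gauss_measure n) (ball_dim n (zero_dim n) t)
   = (\<integral>\<^sup>+y. ennreal (exp (- pi * (norm_dim n y)\<^sup>2)) * indicator {..<t} (norm_dim n y) \<partial>lborel_dim n)"
proof (subst emeasure_gauss, rule sets_ball_dim, rule nn_integral_cong)
  fix y assume y: "y \<in> space (lborel_dim n)"
  have "norm_dim n (\<lambda>i. y i - zero_dim n i) = norm_dim n y"
    by (rule norm_dim_cong) (simp add: zero_dim_def)
  with y show "ennreal (exp (- pi * (norm_dim n y)\<^sup>2)) * indicator (ball_dim n (zero_dim n) t) y
    = ennreal (exp (- pi * (norm_dim n y)\<^sup>2)) * indicator {..<t} (norm_dim n y)"
    by (auto simp: ball_dim_def indicator_def)
qed

text \<open>Substitution of \<open>a * \<xi> + y\<close> with the base point \<open>a\<close> left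
  free. The value \<open>a = R\<close> makes the domain a centred ball and puts the whole shift into
  the weight; other values trade a different tilt of the weight against a domain that is off
  centre.\<close>

lemma emeasure_gauss_ball_shift:
  assumes \<xi>: "norm_dim n \<xi> = 1" and \<rho>: "\<rho> > 0"
  shows "emeasure (gauss_measure n) (ball_dim n (scale_dim n R \<xi>) \<rho>)
   = (\<integral>\<^sup>+y. ennreal (exp (- pi * ((norm_dim n y)\<^sup>2 + 2 * a * dot_dim n \<xi> y + a\<^sup>2))) *
        indicator {..<\<rho>\<^sup>2} ((norm_dim n y)\<^sup>2 - 2 * (R - a) * dot_dim n \<xi> y + (R - a)\<^sup>2) \<partial>lborel_dim n)"
proof -
  let ?f = "\<lambda>y. ennreal (exp (- pi * (norm_dim n y)\<^sup>2)) * indicator (ball_dim n (scale_dim n R \<xi>) \<rho>) y"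
  let ?T = "\<lambda>y. \<lambda>i\<in>{..<n}. a * \<xi> i + 1 * y i"
  have [measurable]: "?f \<in> borel_measurable (lborel_dim n)" by measurable
  have "emeasure (gauss_measure n) (ball_dim n (scale_dim n R \<xi>) \<rho>) = (\<integral>\<^sup>+y. ?f y \<partial>lborel_dim n)"
    by (rule emeasure_gauss) simp
  also have "\<dots> = ennreal (\<Prod>i<n. \<bar>1\<bar>) * (\<integral>\<^sup>+y. ?f (?T y) \<partial>lborel_dim n)"
    by (rule nn_integral_lborel_dim_affine) auto
  also have "\<dots> = (\<integral>\<^sup>+y. ?f (?T y) \<partial>lborel_dim n)" by simp
  also have "\<dots> = (\<integral>\<^sup>+y. ennreal (exp (- pi * ((norm_dim n y)\<^sup>2 + 2 * a * dot_dim n \<xi> y + a\<^sup>2))) *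
        indicator {..<\<rho>\<^sup>2} ((norm_dim n y)\<^sup>2 - 2 * (R - a) * dot_dim n \<xi> y + (R - a)\<^sup>2) \<partial>lborel_dim n)"
  proof (rule nn_integral_cong)
    fix y assume y: "y \<in> space (lborel_dim n)"
    have 1: "(norm_dim n (?T y))\<^sup>2 = (norm_dim n y)\<^sup>2 + 2 * a * dot_dim n \<xi> y + a\<^sup>2"
    proof -
      have "norm_dim n (?T y) = norm_dim n (\<lambda>i. y i + a * \<xi> i)" by (rule norm_dim_cong) simp
      then show ?thesis by (simp add: norm_dim_add_scale_sq \<xi>)
    qed
    have 2: "(norm_dim n (\<lambda>i. ?T y i - scale_dim n R \<xi> i))\<^sup>2 = (norm_dim n y)\<^sup>2 - 2 * (R - a) * dot_dim n \<xi> y + (R - a)\<^sup>2"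
    proof -
      have eq: "norm_dim n (\<lambda>i. ?T y i - scale_dim n R \<xi> i) = norm_dim n (\<lambda>i. y i + (a - R) * \<xi> i)"
        by (rule norm_dim_cong) (simp add: scale_dim_def algebra_simps)
      show ?thesis
        unfolding eq norm_dim_add_scale_sq \<xi> by (simp add: algebra_simps power2_eq_square)
    qed
    have "?T y \<in> ball_dim n (scale_dim n R \<xi>) \<rho> \<longleftrightarrow> (norm_dim n y)\<^sup>2 - 2 * (R - a) * dot_dim n \<xi> y + (R - a)\<^sup>2 < \<rho>\<^sup>2"
      unfolding ball_dim_def mem_Collect_eq norm_dim_less_iff[OF \<rho>] 2 by (auto simp: space_lborel_dim)
    then show "?f (?T y) = ennreal (exp (- pi * ((norm_dim n y)\<^sup>2 + 2 * a * dot_dim n \<xi> y + a\<^sup>2))) *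
        indicator {..<\<rho>\<^sup>2} ((norm_dim n y)\<^sup>2 - 2 * (R - a) * dot_dim n \<xi> y + (R - a)\<^sup>2)"
      unfolding 1 by (simp add: indicator_def)
  qed
  finally show ?thesis .
qed

section \<open>Gaussian measure of centred balls\<close>

definition gauss_ball :: "nat \<Rightarrow> real \<Rightarrow> real" where
  "gauss_ball n t = measure (gauss_measure n) (ball_dim n (zero_dim n) t)"

text \<open>The volume formula for closed balls is at hand. The open ball lies between the closed
  balls of radius \<open>s < t\<close> and of radius \<open>t\<close>, and the formula is continuous
  in the radius.\<close>

lemma nn_integral_norm_less:
  assumes "t > 0"
  shows "(\<integral>\<^sup>+y. indicator {..<t} (norm_dim n y) \<partial>lborel_dim n) = ennreal (unit_ball_vol n * t ^ n)"
proof -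
  define m where "m = (\<integral>\<^sup>+y. indicator {..<t} (norm_dim n y) \<partial>lborel_dim n)"
  have cl: "(\<integral>\<^sup>+y. indicator {..s} (norm_dim n y) \<partial>lborel_dim n) = ennreal (unit_ball_vol n * s ^ n)"
    if "s > 0" for s
  proof -
    have "(\<integral>\<^sup>+y. indicator {..s} (norm_dim n y) \<partial>lborel_dim n)
      = (\<integral>\<^sup>+y. indicator {y \<in> space (lborel_dim n). norm_dim n y \<le> s} y \<partial>lborel_dim n)"
      by (rule nn_integral_cong) (auto simp: indicator_def)
    also have "\<dots> = emeasure (lborel_dim n) {y \<in> space (lborel_dim n). norm_dim n y \<le> s}"
      by (rule nn_integral_indicator) measurable
    also have "{y \<in> space (lborel_dim n). norm_dim n y \<le> s} = {f. sqrt (\<Sum>i<n. (f i)\<^sup>2) \<le> s} \<inter> space (lborel_dim n)"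
      by (auto simp: norm_dim_def L2_set_def)
    also have "emeasure (lborel_dim n) \<dots> = ennreal (unit_ball_vol n * s ^ n)"
      using emeasure_cball_aux[of "{..<n}" s] that by (simp add: lborel_dim_def)
    finally show ?thesis .
  qed
  have "m \<le> ennreal (unit_ball_vol n * t ^ n)"
    unfolding cl[OF assms, symmetric] m_def by (rule nn_integral_mono) (auto simp: indicator_def)
  then obtain x where x: "m = ennreal x" "x \<ge> 0" "x \<le> unit_ball_vol n * t ^ n"
    using assms by (cases m) (auto simp: top_unique)
  have "unit_ball_vol n * t ^ n \<le> x"
  proof (rule tendsto_upperbound)
    show "((\<lambda>s. unit_ball_vol n * s ^ n) \<longlongrightarrow> unit_ball_vol n * t ^ n) (at_left t)"
      by (intro tendsto_intros)
    show "eventually (\<lambda>s. unit_ball_vol n * s ^ n \<le> x) (at_left t)"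
      using eventually_at_left_real[OF assms]
    proof eventually_elim
      case (elim s)
      have "ennreal (unit_ball_vol n * s ^ n) \<le> m"
        unfolding cl[of s, symmetric, OF greaterThanLessThan_iff[THEN iffD1, OF elim, THEN conjunct1]] m_def
        by (rule nn_integral_mono) (use elim in \<open>auto simp: indicator_def\<close>)
      then show ?case using x by simp
    qed
  qed auto
  with x show ?thesis by (simp add: m_def)
qed

lemma emeasure_gauss_ball_eq:
  assumes "t > 0"
  shows "emeasure (gauss_measure n) (ball_dim n (zero_dim n) t) = ennreal (gauss_ball n t)"
proof -
  have "emeasure (gauss_measure n) (ball_dim n (zero_dim n) t) \<le> (\<integral>\<^sup>+y. indicator {..<t} (norm_dim n y) \<partial>lborel_dim n)"
    unfolding emeasure_gauss_ball by (rule nn_integral_mono) (auto simp: indicator_def)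
  then have "emeasure (gauss_measure n) (ball_dim n (zero_dim n) t) < \<infinity>"
    by (simp add: nn_integral_norm_less[OF assms] order_le_less_trans)
  then show ?thesis unfolding gauss_ball_def by (simp add: emeasure_eq_ennreal_measure less_top)
qed

lemma nn_integral_gauss_ball:
  "t > 0 \<Longrightarrow> (\<integral>\<^sup>+y. ennreal (exp (- pi * (norm_dim n y)\<^sup>2)) * indicator {..<t} (norm_dim n y) \<partial>lborel_dim n) = ennreal (gauss_ball n t)"
  by (simp only: emeasure_gauss_ball[symmetric] emeasure_gauss_ball_eq)

lemma gauss_ball_nonneg [simp]: "gauss_ball n t \<ge> 0"
  by (simp add: gauss_ball_def)

lemma gauss_ball_ge:
  assumes "t > 0"
  shows "exp (- pi * t\<^sup>2) * (unit_ball_vol n * t ^ n) \<le> gauss_ball n t"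
proof -
  have "ennreal (exp (- pi * t\<^sup>2) * (unit_ball_vol n * t ^ n)) = (\<integral>\<^sup>+y. ennreal (exp (- pi * t\<^sup>2)) * indicator {..<t} (norm_dim n y) \<partial>lborel_dim n)"
    using assms by (subst nn_integral_cmult) (simp_all add: nn_integral_norm_less ennreal_mult)
  also have "\<dots> \<le> ennreal (gauss_ball n t)"
    unfolding nn_integral_gauss_ball[OF assms, symmetric]
    by (rule nn_integral_mono) (auto simp: indicator_def intro!: power_mono)
  finally show ?thesis by simp
qed

lemma gauss_ball_pos: "t > 0 \<Longrightarrow> gauss_ball n t > 0"
  by (rule less_le_trans[OF _ gauss_ball_ge]) auto

lemma ennreal_eq_add_imp:
  assumes "ennreal a = ennreal b + x" "a \<ge> 0" "b \<ge> 0"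
  shows "b \<le> a" "x = ennreal (a - b)"
  using assms by (cases x; simp flip: ennreal_plus)+

text \<open>On the shell between the two radii the weight lies between its values at the ends. These
  bounds give the derivative in the radius without polar coordinates.\<close>

lemma gauss_ball_diff:
  assumes "0 < s" "s \<le> t"
  shows "gauss_ball n t - gauss_ball n s \<le> exp (- pi * s\<^sup>2) * (unit_ball_vol n * t ^ n - unit_ball_vol n * s ^ n)"
    and "gauss_ball n t - gauss_ball n s \<ge> exp (- pi * t\<^sup>2) * (unit_ball_vol n * t ^ n - unit_ball_vol n * s ^ n)"
proof -
  let ?P = "\<lambda>t. unit_ball_vol n * t ^ n"
  define w where "w = (\<lambda>u. ennreal (exp (- pi * u\<^sup>2)))"
  have [measurable]: "w \<in> borel_measurable borel" by (simp add: w_def)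
  have t: "t > 0" using assms by simp
  have split: "(\<integral>\<^sup>+y. f (norm_dim n y) * indicator {..<t} (norm_dim n y) \<partial>lborel_dim n)
    = (\<integral>\<^sup>+y. f (norm_dim n y) * indicator {..<s} (norm_dim n y) \<partial>lborel_dim n)
      + (\<integral>\<^sup>+y. f (norm_dim n y) * indicator {s..<t} (norm_dim n y) \<partial>lborel_dim n)"
    if [measurable]: "f \<in> borel_measurable borel" for f :: "real \<Rightarrow> ennreal"
    by (subst nn_integral_add[symmetric]) (use assms in \<open>auto simp: indicator_def intro!: nn_integral_cong\<close>)
  define V where "V = (\<integral>\<^sup>+y. indicator {s..<t} (norm_dim n y) \<partial>lborel_dim n)"
  define X where "X = (\<integral>\<^sup>+y. w (norm_dim n y) * indicator {s..<t} (norm_dim n y) \<partial>lborel_dim n)"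
  have "ennreal (?P t) = ennreal (?P s) + V"
    using split[of "\<lambda>_. 1"] by (simp add: V_def nn_integral_norm_less assms t)
  note V' = ennreal_eq_add_imp[OF this]
  have V: "V = ennreal (?P t - ?P s)" and V': "?P s \<le> ?P t"
    using assms by (intro V'; simp)+
  have "ennreal (gauss_ball n t) = ennreal (gauss_ball n s) + X"
    using split[of w] unfolding X_def w_def nn_integral_gauss_ball[OF assms(1)] nn_integral_gauss_ball[OF t]
    by simp
  note X = ennreal_eq_add_imp[OF this gauss_ball_nonneg gauss_ball_nonneg]
  note le = X(1) and X = X(2)
  have "X \<le> (\<integral>\<^sup>+y. ennreal (exp (- pi * s\<^sup>2)) * indicator {s..<t} (norm_dim n y) \<partial>lborel_dim n)"
    unfolding X_def w_def using assms by (intro nn_integral_mono) (auto simp: indicator_def intro!: power_mono)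
  also have "\<dots> = ennreal (exp (- pi * s\<^sup>2) * (?P t - ?P s))"
    using V' by (subst nn_integral_cmult) (simp_all add: V V_def[symmetric] ennreal_mult)
  finally show "gauss_ball n t - gauss_ball n s \<le> exp (- pi * s\<^sup>2) * (?P t - ?P s)"
    using V' by (simp add: X)
  have "ennreal (exp (- pi * t\<^sup>2) * (?P t - ?P s)) = (\<integral>\<^sup>+y. ennreal (exp (- pi * t\<^sup>2)) * indicator {s..<t} (norm_dim n y) \<partial>lborel_dim n)"
    using V' by (subst nn_integral_cmult) (simp_all add: V V_def[symmetric] ennreal_mult)
  also have "\<dots> \<le> X"
    unfolding X_def w_def using assms by (intro nn_integral_mono) (auto simp: indicator_def intro!: power_mono)
  finally show "gauss_ball n t - gauss_ball n s \<ge> exp (- pi * t\<^sup>2) * (?P t - ?P s)"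
    using le by (simp add: X)
qed

text \<open>The difference quotient is that of the volume, times a factor between the weights at the
  larger and at the smaller radius. Both weights tend to \<open>exp (- pi * t^2)\<close>, from
  either side of \<open>t\<close>.\<close>

lemma DERIV_gauss_ball:
  assumes "t > 0"
  shows "(gauss_ball n has_real_derivative exp (- pi * t\<^sup>2) * (unit_ball_vol n * (real n * t ^ (n - 1)))) (at t)"
proof -
  let ?P = "\<lambda>t. unit_ball_vol n * t ^ n"
  define q where "q = (\<lambda>y. (?P y - ?P t) / (y - t))"
  have "(?P has_real_derivative unit_ball_vol n * (real n * t ^ (n - 1))) (at t)"
    by (auto intro!: derivative_eq_intros)
  then have q: "(q \<longlongrightarrow> unit_ball_vol n * (real n * t ^ (n - 1))) (at t)"
    by (simp add: has_field_derivative_iff q_def)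
  have ev: "eventually (\<lambda>y. y \<noteq> t \<and> y > 0) (at t)"
    using assms by (auto simp: eventually_at intro!: exI[of _ t] simp: dist_real_def)
  show ?thesis unfolding has_field_derivative_iff
  proof (rule tendsto_sandwich)
    show "eventually (\<lambda>y. exp (- pi * (max y t)\<^sup>2) * q y \<le> (gauss_ball n y - gauss_ball n t) / (y - t)) (at t)"
      using ev
    proof eventually_elim
      case (elim y)
      show ?case
      proof (cases "y < t")
        case True
        with gauss_ball_diff(2)[of y t n] elim show ?thesis
          by (simp add: q_def max_def divide_simps) (simp add: algebra_simps)
      next
        case False
        with gauss_ball_diff(2)[of t y n] elim assms show ?thesis
          by (simp add: q_def max_def divide_simps)
      qed
    qed
    show "eventually (\<lambda>y. (gauss_ball n y - gauss_ball n t) / (y - t) \<le> exp (- pi * (min y t)\<^sup>2) * q y) (at t)"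
      using ev
    proof eventually_elim
      case (elim y)
      show ?case
      proof (cases "y < t")
        case True
        with gauss_ball_diff(1)[of y t n] elim show ?thesis
          by (simp add: q_def min_def divide_simps) (simp add: algebra_simps)
      next
        case False
        with gauss_ball_diff(1)[of t y n] elim assms show ?thesis
          by (simp add: q_def min_def divide_simps)
      qed
    qed
    have "((\<lambda>y. exp (- pi * (max y t)\<^sup>2) * q y) \<longlongrightarrow> exp (- pi * (max t t)\<^sup>2) * (unit_ball_vol n * (real n * t ^ (n - 1)))) (at t)"
      by (intro tendsto_intros q)
    then show "((\<lambda>y. exp (- pi * (max y t)\<^sup>2) * q y) \<longlongrightarrow> exp (- pi * t\<^sup>2) * (unit_ball_vol n * (real n * t ^ (n - 1)))) (at t)"
      by simp
    have "((\<lambda>y. exp (- pi * (min y t)\<^sup>2) * q y) \<longlongrightarrow> exp (- pi * (min t t)\<^sup>2) * (unit_ball_vol n * (real n * t ^ (n - 1)))) (at t)"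
      by (intro tendsto_intros q)
    then show "((\<lambda>y. exp (- pi * (min y t)\<^sup>2) * q y) \<longlongrightarrow> exp (- pi * t\<^sup>2) * (unit_ball_vol n * (real n * t ^ (n - 1)))) (at t)"
      by simp
  qed
qed

text \<open>Dilation by \<open>k\<close> turns the smaller ball into the larger one with weight
  \<open>exp (- pi * k^2 * |y|^2)\<close>. The quotient by the Gaussian weight lies between
  \<open>1\<close> and \<open>exp (pi * (1 - k^2) * t^2)\<close> there.\<close>

lemma gauss_ball_scale:
  assumes "0 < k" "k \<le> 1" "t > 0"
  shows "k ^ n * gauss_ball n t \<le> gauss_ball n (k * t)"
    and "gauss_ball n (k * t) \<le> k ^ n * exp (pi * (1 - k\<^sup>2) * t\<^sup>2) * gauss_ball n t"
proof -
  define Y where "Y = (\<integral>\<^sup>+y. ennreal (exp (- pi * (k * norm_dim n y)\<^sup>2)) * indicator {..<k * t} (k * norm_dim n y) \<partial>lborel_dim n)"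
  have ind: "indicator {..<k * t} (k * u) = (indicator {..<t} u :: ennreal)" for u
    using assms(1) by (simp add: indicator_def)
  have eq: "ennreal (gauss_ball n (k * t)) = ennreal (k ^ n) * Y"
    unfolding Y_def using assms
    by (subst nn_integral_gauss_ball[symmetric], simp) (rule nn_integral_lborel_dim_scale, auto)
  have "ennreal (gauss_ball n t) \<le> Y"
    unfolding Y_def nn_integral_gauss_ball[OF assms(3), symmetric] ind
  proof (rule nn_integral_mono, rule mult_right_mono)
    fix y
    have "(k * norm_dim n y)\<^sup>2 \<le> (norm_dim n y)\<^sup>2"
      using assms by (intro power_mono) (auto intro: mult_left_le_one_le)
    then show "ennreal (exp (- pi * (norm_dim n y)\<^sup>2)) \<le> ennreal (exp (- pi * (k * norm_dim n y)\<^sup>2))"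
      by simp
  qed simp
  then have "ennreal (k ^ n) * ennreal (gauss_ball n t) \<le> ennreal (gauss_ball n (k * t))"
    unfolding eq by (rule mult_left_mono) simp
  then show "k ^ n * gauss_ball n t \<le> gauss_ball n (k * t)"
    using assms by (simp flip: ennreal_mult)
  have "Y \<le> (\<integral>\<^sup>+y. ennreal (exp (pi * (1 - k\<^sup>2) * t\<^sup>2)) * (ennreal (exp (- pi * (norm_dim n y)\<^sup>2)) * indicator {..<t} (norm_dim n y)) \<partial>lborel_dim n)"
    unfolding Y_def ind
  proof (rule nn_integral_mono)
    fix y
    have "exp (- pi * (k * norm_dim n y)\<^sup>2) \<le> exp (pi * (1 - k\<^sup>2) * t\<^sup>2) * exp (- pi * (norm_dim n y)\<^sup>2)"
      if "norm_dim n y < t"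
    proof -
      have "(1 - k\<^sup>2) * (norm_dim n y)\<^sup>2 \<le> (1 - k\<^sup>2) * t\<^sup>2"
        using assms that by (intro mult_left_mono power_mono) (auto simp: power_le_one)
      then have "pi * ((1 - k\<^sup>2) * (norm_dim n y)\<^sup>2) \<le> pi * ((1 - k\<^sup>2) * t\<^sup>2)" by simp
      then show ?thesis by (simp add: exp_add[symmetric] power_mult_distrib algebra_simps)
    qed
    then show "ennreal (exp (- pi * (k * norm_dim n y)\<^sup>2)) * indicator {..<t} (norm_dim n y)
      \<le> ennreal (exp (pi * (1 - k\<^sup>2) * t\<^sup>2)) * (ennreal (exp (- pi * (norm_dim n y)\<^sup>2)) * indicator {..<t} (norm_dim n y))"
      by (auto simp: indicator_def simp flip: ennreal_mult)
  qed
  also have "\<dots> = ennreal (exp (pi * (1 - k\<^sup>2) * t\<^sup>2)) * ennreal (gauss_ball n t)"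
    unfolding nn_integral_gauss_ball[OF assms(3), symmetric] by (rule nn_integral_cmult) measurable
  finally have "ennreal (gauss_ball n (k * t)) \<le> ennreal (k ^ n) * (ennreal (exp (pi * (1 - k\<^sup>2) * t\<^sup>2)) * ennreal (gauss_ball n t))"
    unfolding eq by (rule mult_left_mono) simp
  then show "gauss_ball n (k * t) \<le> k ^ n * exp (pi * (1 - k\<^sup>2) * t\<^sup>2) * gauss_ball n t"
    using assms by (simp add: mult.assoc flip: ennreal_mult)
qed

text \<open>
  The logarithmic derivative of \<open>gauss_ball n\<close> is close to \<open>n / t - 2 pi t\<close> away from the critical
  radius. The correction \<open>2 sqrt pi\<close> makes the bound valid up to the critical radius, at the cost
  of a factor \<open>exp (O (sqrt n))\<close> after integration.
\<close>

lemma gauss_ball_hazard: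
  assumes "0 < n" "t > 0" "2 * pi * t\<^sup>2 \<le> real n + 1"
  shows "real n - 2 * pi * t\<^sup>2 + 2 * sqrt pi * t > 0"
    and "unit_ball_vol n * real n * t ^ n * exp (- pi * t\<^sup>2) \<le> gauss_ball n t * (real n - 2 * pi * t\<^sup>2 + 2 * sqrt pi * t)"
proof -
  define D where "D = (\<lambda>t. real n - 2 * pi * t\<^sup>2 + 2 * sqrt pi * t)"
  define V where "V = unit_ball_vol n"
  have V: "V > 0" by (simp add: V_def)
  have D_pos: "D s > 0" if "s > 0" "2 * pi * s\<^sup>2 \<le> real n + 1" for s
  proof (cases "2 * pi * s\<^sup>2 \<le> real n")
    case True
    then show ?thesis using that by (simp add: D_def add_nonneg_pos)
  next
    case False
    have sq: "(sqrt pi * s)\<^sup>2 = pi * s\<^sup>2" by (simp add: power_mult_distrib)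
    have "(1/2)\<^sup>2 < (sqrt pi * s)\<^sup>2" using False assms(1) unfolding sq by (simp add: power2_eq_square)
    then have "1/2 < sqrt pi * s" by (rule power2_less_imp_less) (use that in simp)
    then show ?thesis using that by (simp add: D_def)
  qed
  \<comment> \<open>The claim is \<open>L t \<le> gauss_ball n t\<close>. It is checked at a small
    radius \<open>\<epsilon>\<close> and carried up to \<open>t\<close> by monotonicity of the
    difference. Since \<open>sqrt pi * \<epsilon> \<le> 1\<close> gives
    \<open>D \<epsilon> \<ge> n\<close>, at \<open>\<epsilon>\<close> the smallest weight on the
    ball suffices.\<close>
  define L where "L = (\<lambda>t. V * real n * t ^ n * exp (- pi * t\<^sup>2) / D t)"
  define \<epsilon> where "\<epsilon> = min t (1 / sqrt pi)"
  have eps: "0 < \<epsilon>" "\<epsilon> \<le> t" "sqrt pi * \<epsilon> \<le> 1"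
    using assms by (auto simp: \<epsilon>_def min_def field_simps)
  have small: "2 * pi * s\<^sup>2 \<le> real n + 1" if "0 < s" "s \<le> t" for s
  proof -
    have "pi * s\<^sup>2 \<le> pi * t\<^sup>2" using that by (intro mult_left_mono power_mono) auto
    with assms show ?thesis by linarith
  qed
  have "L \<epsilon> \<le> gauss_ball n \<epsilon>"
  proof -
    have "pi * \<epsilon>\<^sup>2 = (sqrt pi * \<epsilon>) * (sqrt pi * \<epsilon>)" by (simp add: power2_eq_square)
    also have "\<dots> \<le> 1 * (sqrt pi * \<epsilon>)" using eps by (intro mult_right_mono) auto
    finally have "real n \<le> D \<epsilon>" by (simp add: D_def)
    then have "real n / D \<epsilon> \<le> 1" using assms(1) by simp
    then have "L \<epsilon> \<le> 1 * (V * \<epsilon> ^ n * exp (- pi * \<epsilon>\<^sup>2))"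
      using eps V mult_right_mono[of "real n / D \<epsilon>" 1 "V * \<epsilon> ^ n * exp (- pi * \<epsilon>\<^sup>2)"] by (simp add: L_def mult_ac)
    also have "\<dots> \<le> gauss_ball n \<epsilon>" using gauss_ball_ge[OF eps(1), of n] by (simp add: V_def mult_ac)
    finally show ?thesis .
  qed
  moreover have "gauss_ball n \<epsilon> - L \<epsilon> \<le> gauss_ball n t - L t"
  proof (rule DERIV_nonneg_imp_nondecreasing[OF eps(2)])
    fix s assume s: "\<epsilon> \<le> s" "s \<le> t"
    then have s0: "s > 0" using eps by simp
    have Ds: "D s > 0" by (rule D_pos) (use s0 s small in auto)
    define E where "E = V * real n * exp (- pi * s\<^sup>2) * s ^ (n - 1)"
    have E: "E \<ge> 0" using V s0 by (simp add: E_def)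
    have sn: "s ^ n = s * s ^ (n - 1)" using assms(1) by (cases n) auto
    define L' where "L' = E * ((real n - 2 * pi * s\<^sup>2) * D s - s * (2 * sqrt pi - 4 * pi * s)) / (D s)\<^sup>2"
    have dD: "(D has_real_derivative (2 * sqrt pi - 4 * pi * s)) (at s)"
      unfolding D_def by (auto intro!: derivative_eq_intros)
    have dL: "(L has_real_derivative L') (at s)"
      unfolding L_def
      by (rule derivative_eq_intros dD refl | use Ds in force)+
         (simp add: L'_def E_def sn power2_eq_square field_simps)
    have dG: "(gauss_ball n has_real_derivative E) (at s)"
      using DERIV_gauss_ball[OF s0, of n] by (simp add: E_def V_def mult_ac)
    \<comment> \<open>With a correction \<open>c * s\<close> in \<open>D s\<close>, denominator
      minus numerator of \<open>L' / E\<close> is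
      \<open>c * s * (n + 1 - 2 * pi * s^2) + (c^2 - 4 * pi) * s^2\<close>. The choice
      \<open>c = 2 * sqrt pi\<close> cancels the last term; the sign of the first is the hypothesis
      on the radius.\<close>
    have "L' \<le> E"
    proof -
      have sp: "sqrt pi * sqrt pi = pi" by simp
      have "(D s)\<^sup>2 - ((real n - 2 * pi * s\<^sup>2) * D s - s * (2 * sqrt pi - 4 * pi * s))
          = D s * (2 * sqrt pi * s) + s * (2 * sqrt pi) - (4 * (sqrt pi * sqrt pi)) * s\<^sup>2"
        by (simp add: D_def power2_eq_square algebra_simps)
      also have "\<dots> = 2 * sqrt pi * s * (real n + 1 - 2 * pi * s\<^sup>2)"
        by (simp add: D_def power2_eq_square algebra_simps)
      also have "\<dots> \<ge> 0"
        using small[OF s0 s(2)] s0 by simp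
      finally have "((real n - 2 * pi * s\<^sup>2) * D s - s * (2 * sqrt pi - 4 * pi * s)) / (D s)\<^sup>2 \<le> 1"
        using Ds by (simp add: divide_le_eq)
      from mult_left_mono[OF this E] show ?thesis by (simp add: L'_def)
    qed
    then show "\<exists>y. ((\<lambda>t. gauss_ball n t - L t) has_real_derivative y) (at s) \<and> 0 \<le> y"
      using DERIV_diff[OF dG dL] by auto
  qed
  ultimately have "L t \<le> gauss_ball n t" by simp
  moreover have "D t > 0" by (rule D_pos) (use assms in auto)
  ultimately show "unit_ball_vol n * real n * t ^ n * exp (- pi * t\<^sup>2) \<le> gauss_ball n t * (real n - 2 * pi * t\<^sup>2 + 2 * sqrt pi * t)"
    by (simp add: L_def D_def V_def divide_le_eq)
  show "real n - 2 * pi * t\<^sup>2 + 2 * sqrt pi * t > 0" using \<open>D t > 0\<close> by (simp add: D_def)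
qed

text \<open>The bound on the logarithmic derivative makes \<open>K\<close> nonincreasing, and
  \<open>K R \<le> K (k * R)\<close> is the claim. Compared with
  \<open>k ^ n * gauss_ball n R \<le> gauss_ball n (k * R)\<close> this gains the Gaussian factor,
  up to a correction linear in \<open>R\<close>.\<close>

lemma gauss_ball_ratio_le:
  assumes n: "0 < n" and "R > 0" "2 * pi * R\<^sup>2 \<le> real n + 1" "0 < k" "k \<le> 1"
  shows "k ^ n * gauss_ball n R \<le> exp (- pi * R\<^sup>2 * (1 - k\<^sup>2) + 2 * sqrt pi * R * (1 - k)) * gauss_ball n (k * R)"
proof -
  define K where "K = (\<lambda>t. gauss_ball n t * exp (pi * t\<^sup>2 - 2 * sqrt pi * t) / t ^ n)"
  have "K R \<le> K (k * R)"
  proof (rule DERIV_nonpos_imp_nonincreasing[of "k * R" R K])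
    show "k * R \<le> R" using assms by simp
    fix s assume s: "k * R \<le> s" "s \<le> R"
    have s0: "s > 0" by (rule less_le_trans[OF _ s(1)]) (use assms in simp)
    have "pi * s\<^sup>2 \<le> pi * R\<^sup>2" using s s0 by (intro mult_left_mono power_mono) auto
    with assms have small: "2 * pi * s\<^sup>2 \<le> real n + 1" by linarith
    define f' where "f' = exp (- pi * s\<^sup>2) * (unit_ball_vol n * (real n * s ^ (n - 1)))"
    have sn: "s ^ n = s * s ^ (n - 1)" using n by (cases n) auto
    define e where "e = exp (pi * s\<^sup>2 - 2 * sqrt pi * s)"
    have dG: "(gauss_ball n has_real_derivative f') (at s)"
      unfolding f'_def by (rule DERIV_gauss_ball[OF s0])
    have dE: "((\<lambda>t. exp (pi * t\<^sup>2 - 2 * sqrt pi * t)) has_real_derivative e * (2 * pi * s - 2 * sqrt pi)) (at s)"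
      unfolding e_def by (auto intro!: derivative_eq_intros)
    have dP: "((\<lambda>t. t ^ n) has_real_derivative real n * s ^ (n - 1)) (at s)"
      by (auto intro!: derivative_eq_intros)
    have dK: "(K has_real_derivative (e / (s * s ^ n)) * (s * f' + gauss_ball n s * (2 * pi * s\<^sup>2 - 2 * sqrt pi * s - real n))) (at s)"
      unfolding K_def
      by (rule DERIV_cong[OF DERIV_divide[OF DERIV_mult[OF dG dE] dP]])
         (use s0 in \<open>simp_all add: e_def sn field_simps power2_eq_square\<close>)
    have "s * f' \<le> gauss_ball n s * (real n - 2 * pi * s\<^sup>2 + 2 * sqrt pi * s)"
      using gauss_ball_hazard(2)[OF n s0 small] by (simp add: f'_def sn mult_ac)
    then have "s * f' + gauss_ball n s * (2 * pi * s\<^sup>2 - 2 * sqrt pi * s - real n) \<le> 0"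
      by (simp add: algebra_simps)
    then have "(e / (s * s ^ n)) * (s * f' + gauss_ball n s * (2 * pi * s\<^sup>2 - 2 * sqrt pi * s - real n)) \<le> 0"
      using s0 by (intro mult_nonneg_nonpos) (auto simp: e_def)
    with dK show "\<exists>y. (K has_real_derivative y) (at s) \<and> y \<le> 0" by blast
  qed
  then have "gauss_ball n R * exp (pi * R\<^sup>2 - 2 * sqrt pi * R) * k ^ n \<le> gauss_ball n (k * R) * exp (pi * (k * R)\<^sup>2 - 2 * sqrt pi * (k * R))"
    using assms by (simp add: K_def power_mult_distrib field_simps)
  moreover define A where "A = pi * R\<^sup>2 - 2 * sqrt pi * R"
  ultimately have "(gauss_ball n R * exp A * k ^ n) * exp (- A)
     \<le> (gauss_ball n (k * R) * exp (pi * (k * R)\<^sup>2 - 2 * sqrt pi * (k * R))) * exp (- A)"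
    by (intro mult_right_mono) simp_all
  moreover have "(gauss_ball n R * exp A * k ^ n) * exp (- A) = k ^ n * gauss_ball n R"
  proof -
    have "(gauss_ball n R * exp A * k ^ n) * exp (- A) = (exp A * exp (- A)) * (k ^ n * gauss_ball n R)"
      by (simp only: mult_ac)
    then show ?thesis by (simp only: exp_minus_inverse mult_1)
  qed
  moreover have "(gauss_ball n (k * R) * exp (pi * (k * R)\<^sup>2 - 2 * sqrt pi * (k * R))) * exp (- A)
     = exp (- pi * R\<^sup>2 * (1 - k\<^sup>2) + 2 * sqrt pi * R * (1 - k)) * gauss_ball n (k * R)"
    by (simp add: A_def mult.assoc exp_add[symmetric]) (simp add: power_mult_distrib algebra_simps)
  ultimately show ?thesis by (simp only:)
qed

text \<open>With \<open>S = 2 * pi * R^2 / n\<close>, sign averaging leaves the weight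
  \<open>exp (- pi * (1 - S) * |y|^2 - pi * R^2)\<close> on the centred ball of radius
  \<open>k * R\<close>. Dilation by \<open>k\<close> turns \<open>1 - S\<close> into
  \<open>g\<close>. As \<open>g \<le> 1\<close>, the quotient by the Gaussian weight is largest at
  \<open>|y| = R\<close>. The comparison ball has radius \<open>R\<close>, so its measure cancels in
  the ratio.\<close>

lemma emeasure_gauss_ball_shift_le:
  assumes n: "0 < n" and \<xi>: "norm_dim n \<xi> = 1" and "R > 0" "k > 0"
    and g: "g = (1 - 2 * pi * R\<^sup>2 / real n) * k\<^sup>2" "g \<le> 1"
  shows "emeasure (gauss_measure n) (ball_dim n (scale_dim n R \<xi>) (k * R))
    \<le> ennreal (k ^ n * exp (- pi * g * R\<^sup>2) * gauss_ball n R)"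
proof -
  define \<rho> where "\<rho> = k * R"
  have \<rho>: "\<rho> > 0" using assms by (simp add: \<rho>_def)
  define u where "u = (\<lambda>i::nat. 1 / sqrt (real n))"
  have u: "norm_dim n u = 1"
    by (rule power2_eq_imp_eq) (use n in \<open>simp_all add: norm_dim_sq u_def power_divide\<close>)
  define F where "F = (\<lambda>(p :: real, q :: real). ennreal (exp (- pi * (p\<^sup>2 + 2 * R * q + R\<^sup>2))) * indicator {..<\<rho>\<^sup>2} (p\<^sup>2))"
  have F: "F \<in> borel_measurable (borel \<Otimes>\<^sub>M borel)" unfolding F_def by measurable
  define c where "c = - 2 * pi * R / sqrt (real n)"
  have c2: "c\<^sup>2 / 2 = pi * (2 * pi * R\<^sup>2 / real n)"
    using n by (simp add: c_def power_divide power_mult_distrib power2_eq_square field_simps)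
  define W where "W = (\<lambda>p :: real. ennreal (exp (- pi * (p\<^sup>2 + R\<^sup>2))) * indicator {..<\<rho>\<^sup>2} (p\<^sup>2))"
  have W[measurable]: "W \<in> borel_measurable borel" unfolding W_def by measurable
  define G where "G = (\<lambda>p. W p * ennreal (exp (c\<^sup>2 / 2 * p\<^sup>2)))"
  have [measurable]: "G \<in> borel_measurable borel" unfolding G_def by measurable
  have "emeasure (gauss_measure n) (ball_dim n (scale_dim n R \<xi>) \<rho>) = (\<integral>\<^sup>+y. F (norm_dim n y, dot_dim n \<xi> y) \<partial>lborel_dim n)"
    unfolding emeasure_gauss_ball_shift[OF \<xi> \<rho>, of R R] F_def by simp
  also have "\<dots> = (\<integral>\<^sup>+y. F (norm_dim n y, dot_dim n u y) \<partial>lborel_dim n)"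
    by (rule nn_integral_radial_dot[OF n _ F]) (simp add: \<xi> u)
  also have "\<dots> = (\<integral>\<^sup>+y. W (norm_dim n y) * ennreal (exp (\<Sum>i<n. c * y i)) \<partial>lborel_dim n)"
  proof (rule nn_integral_cong)
    fix y
    have "(\<Sum>i<n. c * y i) = c * (\<Sum>i<n. y i)" by (simp add: sum_distrib_left)
    moreover have "dot_dim n u y = (\<Sum>i<n. y i) / sqrt (real n)"
      by (simp add: dot_dim_def u_def sum_divide_distrib)
    ultimately have "- pi * ((norm_dim n y)\<^sup>2 + 2 * R * dot_dim n u y + R\<^sup>2) = - pi * ((norm_dim n y)\<^sup>2 + R\<^sup>2) + (\<Sum>i<n. c * y i)"
      by (simp add: c_def algebra_simps)
    then show "F (norm_dim n y, dot_dim n u y) = W (norm_dim n y) * ennreal (exp (\<Sum>i<n. c * y i))"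
      by (simp only: F_def W_def prod.case exp_add) (simp add: ennreal_mult mult_ac)
  qed
  also have "\<dots> \<le> (\<integral>\<^sup>+y. G (norm_dim n y) \<partial>lborel_dim n)"
    unfolding G_def by (rule nn_integral_exp_sum_le) (rule W)
  also have "\<dots> = ennreal (k ^ n) * (\<integral>\<^sup>+y. G (k * norm_dim n y) \<partial>lborel_dim n)"
    by (rule nn_integral_lborel_dim_scale) (use assms in auto)
  also have "(\<integral>\<^sup>+y. G (k * norm_dim n y) \<partial>lborel_dim n)
    \<le> (\<integral>\<^sup>+y. ennreal (exp (- pi * g * R\<^sup>2)) * (ennreal (exp (- pi * (norm_dim n y)\<^sup>2)) * indicator {..<R} (norm_dim n y)) \<partial>lborel_dim n)"
  proof (rule nn_integral_mono)
    fix y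
    define p where "p = norm_dim n y"
    have p: "p \<ge> 0" by (simp add: p_def)
    show "G (k * norm_dim n y) \<le> ennreal (exp (- pi * g * R\<^sup>2)) * (ennreal (exp (- pi * (norm_dim n y)\<^sup>2)) * indicator {..<R} (norm_dim n y))"
    proof (cases "p < R")
      case True
      have e: "- pi * ((k * p)\<^sup>2 + R\<^sup>2) + c\<^sup>2 / 2 * (k * p)\<^sup>2 = - pi * g * p\<^sup>2 - pi * R\<^sup>2"
        unfolding c2 g by (simp add: power_mult_distrib algebra_simps)
      have "(1 - g) * p\<^sup>2 \<le> (1 - g) * R\<^sup>2" using True p g by (intro mult_left_mono power_mono) auto
      then have "pi * ((1 - g) * p\<^sup>2) \<le> pi * ((1 - g) * R\<^sup>2)" by simp
      then have "- pi * g * p\<^sup>2 - pi * R\<^sup>2 \<le> - pi * g * R\<^sup>2 + - pi * p\<^sup>2"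
        by (simp add: algebra_simps)
      then have "exp (- pi * ((k * p)\<^sup>2 + R\<^sup>2)) * exp (c\<^sup>2 / 2 * (k * p)\<^sup>2) \<le> exp (- pi * g * R\<^sup>2) * exp (- pi * p\<^sup>2)"
        unfolding exp_add[symmetric] e by simp
      moreover have "G (k * p) \<le> ennreal (exp (- pi * ((k * p)\<^sup>2 + R\<^sup>2)) * exp (c\<^sup>2 / 2 * (k * p)\<^sup>2))"
        by (simp add: G_def W_def ennreal_mult indicator_def)
      ultimately show ?thesis using True unfolding p_def[symmetric]
        by (simp add: order_trans ennreal_leI flip: ennreal_mult)
    next
      case False
      then have "(k * p)\<^sup>2 \<ge> \<rho>\<^sup>2" unfolding \<rho>_def using assms by (intro power_mono) auto
      then show ?thesis using False unfolding p_def[symmetric] by (simp add: G_def W_def)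
    qed
  qed
  also have "\<dots> = ennreal (exp (- pi * g * R\<^sup>2)) * ennreal (gauss_ball n R)"
    unfolding nn_integral_gauss_ball[OF assms(3), symmetric] by (rule nn_integral_cmult) measurable
  finally show ?thesis using assms
    by (simp add: \<rho>_def mult_left_mono mult.assoc flip: ennreal_mult)
qed

section \<open>Lower bounds for shifted balls\<close>

text \<open>By rotation invariance all coordinates have the same second moment, and these add up to
  that of the norm.\<close>

lemma nn_integral_coordinate_sq:
  assumes n: "0 < n" and W[measurable]: "W \<in> borel_measurable borel"
  shows "of_nat n * (\<integral>\<^sup>+y. W (norm_dim n y) * ennreal ((y 0)\<^sup>2) \<partial>lborel_dim n)
       = (\<integral>\<^sup>+y. W (norm_dim n y) * ennreal ((norm_dim n y)\<^sup>2) \<partial>lborel_dim n)"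
proof -
  define F where "F = (\<lambda>(p :: real, q :: real). W p * ennreal (q\<^sup>2))"
  have F: "F \<in> borel_measurable (borel \<Otimes>\<^sub>M borel)" unfolding F_def by measurable
  define e where "e = (\<lambda>k i :: nat. if i = k then 1 else 0 :: real)"
  have ne: "norm_dim n (e k) = 1" if "k < n" for k
    by (rule power2_eq_imp_eq) (use that in \<open>simp_all add: norm_dim_sq e_def if_distrib[of "\<lambda>x. x\<^sup>2"] cong: if_cong\<close>)
  have de: "dot_dim n (e k) y = y k" if "k < n" for k y
    using that by (simp add: dot_dim_def e_def if_distrib[of "\<lambda>x. x * _"] cong: if_cong)
  have eq: "(\<integral>\<^sup>+y. W (norm_dim n y) * ennreal ((y k)\<^sup>2) \<partial>lborel_dim n) = (\<integral>\<^sup>+y. W (norm_dim n y) * ennreal ((y 0)\<^sup>2) \<partial>lborel_dim n)"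
    if "k < n" for k
    using nn_integral_radial_dot[OF n _ F, of "e k" "e 0"] that n by (simp add: ne de F_def)
  have "(\<integral>\<^sup>+y. W (norm_dim n y) * ennreal ((norm_dim n y)\<^sup>2) \<partial>lborel_dim n)
      = (\<integral>\<^sup>+y. (\<Sum>k<n. W (norm_dim n y) * ennreal ((y k)\<^sup>2)) \<partial>lborel_dim n)"
    by (simp add: norm_dim_sq sum_distrib_left[symmetric])
  also have "\<dots> = (\<Sum>k<n. (\<integral>\<^sup>+y. W (norm_dim n y) * ennreal ((y k)\<^sup>2) \<partial>lborel_dim n))"
    by (rule nn_integral_sum) simp
  also have "\<dots> = (\<Sum>k<n. (\<integral>\<^sup>+y. W (norm_dim n y) * ennreal ((y 0)\<^sup>2) \<partial>lborel_dim n))"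
    by (rule sum.cong[OF refl], rule eq) simp
  finally show ?thesis by (simp only: sum_constant card_lessThan)
qed

text \<open>The tilted weight on a half ball, with \<open>\<xi>\<close> rotated to the first axis
  and the tilt extended evenly to the full ball. The quotient by \<open>gauss_ball n b\<close> is
  what the tilt costs.\<close>

definition gauss_cut :: "nat \<Rightarrow> real \<Rightarrow> real \<Rightarrow> ennreal" where
  "gauss_cut n b \<theta> = (\<integral>\<^sup>+y. ennreal (exp (- pi * (norm_dim n y)\<^sup>2)) * indicator {..<b} (norm_dim n y)
     * ennreal (exp (- \<theta> * \<bar>y 0\<bar>)) \<partial>lborel_dim n)"

text \<open>Jensen's inequality in substance: the mean of \<open>\<bar>y 0\<bar>\<close> over the
  ball is at most its root mean square, which is at most \<open>b / sqrt n\<close>.\<close>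

lemma gauss_cut_ge_exp:
  assumes n: "0 < n" and b: "b > 0" and \<theta>: "\<theta> \<ge> 0"
  shows "ennreal (exp (- (\<theta> * b / sqrt n)) * gauss_ball n b) \<le> gauss_cut n b \<theta>"
proof -
  define W where "W = (\<lambda>p :: real. ennreal (exp (- pi * p\<^sup>2)) * indicator {..<b} p)"
  have [measurable]: "W \<in> borel_measurable borel" unfolding W_def by measurable
  note [measurable] = measurable_component_lborel_dim[OF n]
  define c where "c = b / sqrt n"
  have c: "c > 0" "c\<^sup>2 = b\<^sup>2 / real n" using n b by (simp_all add: c_def power_divide)
  define z where "z = \<theta> * c"
  have z: "z \<ge> 0" using \<theta> c by (simp add: z_def)
  define M where "M = (\<integral>\<^sup>+y. W (norm_dim n y) * ennreal ((y 0)\<^sup>2) \<partial>lborel_dim n)"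
  have gb: "(\<integral>\<^sup>+y. W (norm_dim n y) \<partial>lborel_dim n) = ennreal (gauss_ball n b)"
    unfolding W_def by (rule nn_integral_gauss_ball[OF b])
  have "ennreal (real n) * M \<le> (\<integral>\<^sup>+y. ennreal (b\<^sup>2) * W (norm_dim n y) \<partial>lborel_dim n)"
    unfolding M_def ennreal_of_nat_eq_real_of_nat[symmetric] nn_integral_coordinate_sq[OF n \<open>W \<in> _\<close>]
  proof (rule nn_integral_mono)
    fix y
    show "W (norm_dim n y) * ennreal ((norm_dim n y)\<^sup>2) \<le> ennreal (b\<^sup>2) * W (norm_dim n y)"
      unfolding mult.commute[of "W _"]
      by (cases "norm_dim n y < b") (auto simp: W_def intro!: mult_right_mono ennreal_leI power_mono)
  qed
  also have "\<dots> = ennreal (b\<^sup>2 * gauss_ball n b)"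
    by (subst nn_integral_cmult) (simp_all add: gb ennreal_mult)
  finally have nM: "ennreal (real n) * M \<le> ennreal (b\<^sup>2 * gauss_ball n b)" .
  then have "M \<noteq> \<infinity>" using n by (auto simp: ennreal_mult_top top_unique)
  then obtain m where m: "M = ennreal m" "m \<ge> 0" by (cases M) auto
  have "m \<le> c\<^sup>2 * gauss_ball n b"
    using nM n m by (simp add: c(2) field_simps flip: ennreal_mult)
  have "gauss_cut n b \<theta> \<le> (\<integral>\<^sup>+y. W (norm_dim n y) \<partial>lborel_dim n)"
    unfolding gauss_cut_def W_def using \<theta>
    by (intro nn_integral_mono) (auto simp: indicator_def intro!: mult_left_le)
  then obtain x where x: "gauss_cut n b \<theta> = ennreal x" "x \<ge> 0"
    unfolding gb by (cases "gauss_cut n b \<theta>") (auto simp: top_unique)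
  \<comment> \<open>The bound \<open>1 + x \<le> exp x\<close> at
    \<open>x = z - \<theta> * \<bar>t\<bar>\<close>, combined with
    \<open>\<bar>t\<bar> \<le> t^2 / (2 * c) + c / 2\<close>, replaces Jensen by a pointwise
    inequality that integrates through the second moment alone.\<close>
  have pw: "exp (- z) * (1 + z / 2) \<le> exp (- \<theta> * \<bar>t\<bar>) + exp (- z) * (\<theta> / (2 * c)) * t\<^sup>2" for t
  proof -
    have "0 \<le> \<theta> / (2 * c) * (\<bar>t\<bar> - c)\<^sup>2" using \<theta> c by simp
    also have "\<theta> / (2 * c) * (\<bar>t\<bar> - c)\<^sup>2 = \<theta> / (2 * c) * t\<^sup>2 + z / 2 - \<theta> * \<bar>t\<bar>"
      using c(1) by (simp add: power2_eq_square algebra_simps z_def) (simp add: field_simps abs_mult_self_eq)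
    finally have "1 + z / 2 \<le> (1 + (z - \<theta> * \<bar>t\<bar>)) + \<theta> / (2 * c) * t\<^sup>2" by simp
    also have "\<dots> \<le> exp (z - \<theta> * \<bar>t\<bar>) + \<theta> / (2 * c) * t\<^sup>2" using exp_ge_add_one_self by simp
    finally have "exp (- z) * (1 + z / 2) \<le> exp (- z) * (exp (z - \<theta> * \<bar>t\<bar>) + \<theta> / (2 * c) * t\<^sup>2)"
      by (rule mult_left_mono) simp
    then show ?thesis by (simp add: distrib_left exp_add[symmetric] mult.assoc)
  qed
  have "ennreal (exp (- z) * (1 + z / 2) * gauss_ball n b) = (\<integral>\<^sup>+y. ennreal (exp (- z) * (1 + z / 2)) * W (norm_dim n y) \<partial>lborel_dim n)"
    using z by (subst nn_integral_cmult) (simp_all add: gb ennreal_mult)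
  also have "\<dots> \<le> (\<integral>\<^sup>+y. W (norm_dim n y) * ennreal (exp (- \<theta> * \<bar>y 0\<bar>))
      + ennreal (exp (- z) * (\<theta> / (2 * c))) * (W (norm_dim n y) * ennreal ((y 0)\<^sup>2)) \<partial>lborel_dim n)"
  proof (rule nn_integral_mono)
    fix y :: "nat \<Rightarrow> real"
    have "ennreal (exp (- z) * (1 + z / 2)) \<le> ennreal (exp (- \<theta> * \<bar>y 0\<bar>)) + ennreal (exp (- z) * (\<theta> / (2 * c))) * ennreal ((y 0)\<^sup>2)"
      using pw[of "y 0"] \<theta> c by (simp flip: ennreal_mult ennreal_plus)
    from mult_left_mono[OF this, of "W (norm_dim n y)"]
    show "ennreal (exp (- z) * (1 + z / 2)) * W (norm_dim n y) \<le> W (norm_dim n y) * ennreal (exp (- \<theta> * \<bar>y 0\<bar>))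
      + ennreal (exp (- z) * (\<theta> / (2 * c))) * (W (norm_dim n y) * ennreal ((y 0)\<^sup>2))"
      by (simp add: distrib_left mult_ac)
  qed
  also have "\<dots> = gauss_cut n b \<theta> + ennreal (exp (- z) * (\<theta> / (2 * c))) * M"
    unfolding gauss_cut_def M_def W_def by (subst nn_integral_add) (auto simp: nn_integral_cmult)
  also have "\<dots> = ennreal (x + exp (- z) * (\<theta> / (2 * c)) * m)"
  proof -
    have k: "exp (- z) * (\<theta> / (2 * c)) \<ge> 0" using \<theta> c by simp
    show ?thesis unfolding x(1) m(1) ennreal_mult[OF k m(2), symmetric]
      by (rule ennreal_plus[symmetric, OF x(2) mult_nonneg_nonneg[OF k m(2)]])
  qed
  finally have "exp (- z) * (1 + z / 2) * gauss_ball n b \<le> x + exp (- z) * (\<theta> / (2 * c)) * m"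
    using x m \<theta> c by (subst (asm) ennreal_le_iff) auto
  also have "\<dots> \<le> x + exp (- z) * (\<theta> / (2 * c)) * (c\<^sup>2 * gauss_ball n b)"
    using \<open>m \<le> _\<close> \<theta> c by (intro add_left_mono mult_left_mono) auto
  also have "exp (- z) * (\<theta> / (2 * c)) * (c\<^sup>2 * gauss_ball n b) = exp (- z) * (z / 2) * gauss_ball n b"
    using c(1) by (simp add: z_def power2_eq_square)
  finally have "exp (- z) * gauss_ball n b \<le> x" by (simp add: algebra_simps)
  then show ?thesis unfolding x by (intro ennreal_leI) (simp add: z_def c_def)
qed

text \<open>Shrinking the first coordinate by the factor \<open>\<theta>' / \<theta>\<close> only decreases the norm.\<close>

lemma gauss_cut_mono:
  assumes n: "0 < n" and "0 < \<theta>'" "\<theta>' \<le> \<theta>"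
  shows "ennreal (\<theta>' / \<theta>) * gauss_cut n b \<theta>' \<le> gauss_cut n b \<theta>"
proof -
  note [measurable] = measurable_component_lborel_dim[OF n]
  define k where "k = \<theta>' / \<theta>"
  have k: "0 < k" "k \<le> 1" "\<theta> * k = \<theta>'" using assms by (auto simp: k_def)
  define c :: "nat \<Rightarrow> real" where "c = (\<lambda>i. if i = 0 then k else 1)"
  let ?f = "\<lambda>y. ennreal (exp (- pi * (norm_dim n y)\<^sup>2)) * indicator {..<b} (norm_dim n y) * ennreal (exp (- \<theta> * \<bar>y 0\<bar>))"
  let ?T = "\<lambda>y. \<lambda>i\<in>{..<n}. 0 + c i * y i"
  have "(\<Prod>i<n. \<bar>c i\<bar>) = k"
    using n k by (subst prod.remove[of _ 0]) (auto simp: c_def intro!: prod.neutral)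
  moreover have "gauss_cut n b \<theta> = ennreal (\<Prod>i<n. \<bar>c i\<bar>) * (\<integral>\<^sup>+y. ?f (?T y) \<partial>lborel_dim n)"
    unfolding gauss_cut_def by (rule nn_integral_lborel_dim_affine) (use k in \<open>auto simp: c_def\<close>)
  ultimately have eq: "gauss_cut n b \<theta> = ennreal k * (\<integral>\<^sup>+y. ?f (?T y) \<partial>lborel_dim n)" by simp
  have "gauss_cut n b \<theta>' \<le> (\<integral>\<^sup>+y. ?f (?T y) \<partial>lborel_dim n)"
    unfolding gauss_cut_def
  proof (rule nn_integral_mono)
    fix y :: "nat \<Rightarrow> real"
    have "(norm_dim n (?T y))\<^sup>2 \<le> (norm_dim n y)\<^sup>2"
      unfolding norm_dim_sq
      by (rule sum_mono) (use k in \<open>auto simp: c_def power_mult_distrib power_le_one intro!: mult_left_le_one_le\<close>)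
    moreover from this have "norm_dim n (?T y) \<le> norm_dim n y" by (rule power2_le_imp_le) simp
    moreover have "- \<theta> * \<bar>?T y 0\<bar> = - \<theta>' * \<bar>y 0\<bar>" using n k by (simp add: c_def abs_mult)
    ultimately show "ennreal (exp (- pi * (norm_dim n y)\<^sup>2)) * indicator {..<b} (norm_dim n y) * ennreal (exp (- \<theta>' * \<bar>y 0\<bar>)) \<le> ?f (?T y)"
      by (intro mult_mono) (auto simp: indicator_def)
  qed
  then show ?thesis unfolding eq k_def[symmetric] by (rule mult_left_mono) simp
qed

text \<open>The exponential bound is poor once \<open>x = \<theta> * b / sqrt n\<close> exceeds
  \<open>1\<close>. Lowering the rate to \<open>\<theta>' = sqrt n / b\<close>, where the exponent
  is \<open>- 1\<close>, costs only the factor \<open>\<theta>' / \<theta> = 1 / x\<close>. This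
  value maximises \<open>\<theta>' * exp (- \<theta>' * b / sqrt n)\<close>.\<close>

lemma gauss_cut_ge_inverse:
  assumes n: "0 < n" and b: "b > 0" and x: "\<theta> * b / sqrt n \<ge> 1"
  shows "ennreal (exp (- 1) / (\<theta> * b / sqrt n) * gauss_ball n b) \<le> gauss_cut n b \<theta>"
proof -
  define \<theta>' where "\<theta>' = sqrt n / b"
  have \<theta>': "\<theta>' > 0" "\<theta>' * b / sqrt n = 1" using n b by (simp_all add: \<theta>'_def)
  have le: "\<theta>' \<le> \<theta>" using x n b by (simp add: \<theta>'_def field_simps)
  have "ennreal (exp (- 1) / (\<theta> * b / sqrt n) * gauss_ball n b) = ennreal (\<theta>' / \<theta>) * ennreal (exp (- (\<theta>' * b / sqrt n)) * gauss_ball n b)"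
  proof -
    have eq: "exp (- 1) / (\<theta> * b / sqrt n) * gauss_ball n b = \<theta>' / \<theta> * (exp (- 1) * gauss_ball n b)"
      by (simp add: \<theta>'_def mult_ac)
    show ?thesis unfolding eq \<theta>'(2) by (rule ennreal_mult) (use \<theta>'(1) le in auto)
  qed
  also have "\<dots> \<le> ennreal (\<theta>' / \<theta>) * gauss_cut n b \<theta>'"
    by (rule mult_left_mono[OF gauss_cut_ge_exp]) (use n b \<theta>' in auto)
  also have "\<dots> \<le> gauss_cut n b \<theta>" by (rule gauss_cut_mono[OF n \<theta>'(1) le])
  finally show ?thesis .
qed

text \<open>Where \<open>y . \<xi> \<ge> 0\<close>, the mixed term in the condition for the shifted
  ball has the favourable sign, so \<open>|y| < b\<close> is enough. Reflection in the first
  coordinate passes from the ball to the half ball at the cost of a factor \<open>2\<close>. The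
  absolute value covers negative \<open>a\<close>, which occurs for \<open>r / R\<close> near
  \<open>sqrt 2 - 1\<close>.\<close>

lemma emeasure_gauss_ball_shift_ge:
  assumes n: "0 < n" and \<xi>: "norm_dim n \<xi> = 1" and \<rho>: "\<rho> > 0" and a: "a \<le> R" and b: "b > 0" "b\<^sup>2 + (R - a)\<^sup>2 = \<rho>\<^sup>2"
  shows "ennreal (exp (- pi * a\<^sup>2) / 2) * gauss_cut n b (2 * pi * \<bar>a\<bar>)
    \<le> emeasure (gauss_measure n) (ball_dim n (scale_dim n R \<xi>) \<rho>)"
proof -
  note [measurable] = measurable_component_lborel_dim[OF n]
  define \<theta> where "\<theta> = 2 * pi * \<bar>a\<bar>"
  define e where "e = (\<lambda>i :: nat. if i = 0 then 1 else 0 :: real)"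
  have ne: "norm_dim n e = 1"
    by (rule power2_eq_imp_eq) (use n in \<open>simp_all add: norm_dim_sq e_def if_distrib[of "\<lambda>x. x\<^sup>2"] cong: if_cong\<close>)
  have de: "dot_dim n e y = y 0" for y
    using n by (simp add: dot_dim_def e_def if_distrib[of "\<lambda>x. x * _"] cong: if_cong)
  define F where "F = (\<lambda>(p :: real, q :: real). ennreal (exp (- pi * (p\<^sup>2 + 2 * a * q + a\<^sup>2))) *
        indicator {..<\<rho>\<^sup>2} (p\<^sup>2 - 2 * (R - a) * q + (R - a)\<^sup>2) :: ennreal)"
  have F: "F \<in> borel_measurable (borel \<Otimes>\<^sub>M borel)" unfolding F_def by measurable
  define h where "h = (\<lambda>y. ennreal (exp (- pi * (norm_dim n y)\<^sup>2)) * indicator {..<b} (norm_dim n y)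
     * ennreal (exp (- \<theta> * \<bar>y 0\<bar>)))"
  define X where "X = (\<integral>\<^sup>+y. h y * indicator {0..} (y 0) \<partial>lborel_dim n)"
  have [measurable]: "h \<in> borel_measurable (lborel_dim n)" unfolding h_def by measurable
  have "gauss_cut n b \<theta> \<le> (\<integral>\<^sup>+y. h y * indicator {0..} (y 0) + h y * indicator {0..} (- y 0) \<partial>lborel_dim n)"
    unfolding gauss_cut_def h_def[symmetric] by (intro nn_integral_mono) (auto simp: indicator_def)
  also have "\<dots> = X + (\<integral>\<^sup>+y. h y * indicator {0..} (- y 0) \<partial>lborel_dim n)"
    unfolding X_def by (rule nn_integral_add) measurable
  also have "(\<integral>\<^sup>+y. h y * indicator {0..} (- y 0) \<partial>lborel_dim n) = (\<integral>\<^sup>+y. h (y(0 := - y 0)) * indicator {0..} ((y(0 := - y 0)) 0) \<partial>lborel_dim n)"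
    by (rule nn_integral_cong) (simp add: h_def norm_dim_flip)
  also have "\<dots> = X"
    unfolding X_def by (rule nn_integral_lborel_dim_flip[OF n]) measurable
  finally have "gauss_cut n b \<theta> \<le> 2 * X" by (simp add: mult_2)
  from mult_left_mono[OF this, of "ennreal (exp (- pi * a\<^sup>2) / 2)"]
  have "ennreal (exp (- pi * a\<^sup>2) / 2) * gauss_cut n b \<theta> \<le> (ennreal (exp (- pi * a\<^sup>2) / 2) * 2) * X"
    by (simp add: mult.assoc)
  also have "ennreal (exp (- pi * a\<^sup>2) / 2) * 2 = ennreal (exp (- pi * a\<^sup>2))"
    by (simp add: ennreal_mult[symmetric] flip: ennreal_numeral)
  also have "ennreal (exp (- pi * a\<^sup>2)) * X = (\<integral>\<^sup>+y. ennreal (exp (- pi * a\<^sup>2)) * (h y * indicator {0..} (y 0)) \<partial>lborel_dim n)"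
    unfolding X_def by (rule nn_integral_cmult[symmetric]) measurable
  also have "\<dots> \<le> (\<integral>\<^sup>+y. F (norm_dim n y, dot_dim n e y) \<partial>lborel_dim n)"
  proof (rule nn_integral_mono)
    fix y :: "nat \<Rightarrow> real"
    define p q where "p = norm_dim n y" and "q = y 0"
    show "ennreal (exp (- pi * a\<^sup>2)) * (h y * indicator {0..} (y 0)) \<le> F (norm_dim n y, dot_dim n e y)"
    proof (cases "p < b \<and> 0 \<le> q")
      case True
      have "p\<^sup>2 < b\<^sup>2" using True by (intro power_strict_mono) (auto simp: p_def)
      moreover have "2 * (R - a) * q \<ge> 0" using True a by simp
      ultimately have "p\<^sup>2 - 2 * (R - a) * q + (R - a)\<^sup>2 < \<rho>\<^sup>2" using b(2) by linarith
      moreover have "exp (- pi * a\<^sup>2) * (exp (- pi * p\<^sup>2) * exp (- \<theta> * \<bar>q\<bar>)) \<le> exp (- pi * (p\<^sup>2 + 2 * a * q + a\<^sup>2))"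
      proof -
        have "a * q \<le> \<bar>a\<bar> * q" using True by (intro mult_right_mono) auto
        then have "2 * pi * (a * q) \<le> 2 * pi * (\<bar>a\<bar> * q)" by simp
        then show ?thesis using True by (simp add: exp_add[symmetric] \<theta>_def algebra_simps)
      qed
      ultimately show ?thesis using True
        by (simp add: F_def h_def de p_def[symmetric] q_def[symmetric] flip: ennreal_mult)
    next
      case False
      then show ?thesis by (auto simp: h_def p_def q_def)
    qed
  qed
  also have "\<dots> = (\<integral>\<^sup>+y. F (norm_dim n y, dot_dim n \<xi> y) \<partial>lborel_dim n)"
    by (rule nn_integral_radial_dot[OF n _ F]) (simp add: \<xi> ne)
  also have "\<dots> = emeasure (gauss_measure n) (ball_dim n (scale_dim n R \<xi>) \<rho>)"
    unfolding emeasure_gauss_ball_shift[OF \<xi> \<rho>, of R a] F_def by simp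
  finally show ?thesis unfolding \<theta>_def .
qed

section \<open>The maximal function and exponential growth\<close>

lemma unit_vectors_norm: "\<xi> \<in> unit_vectors n \<Longrightarrow> norm_dim n \<xi> = 1"
  by (simp add: unit_vectors_def)

definition gauss_shift :: "nat \<Rightarrow> (nat \<Rightarrow> real) \<Rightarrow> real \<Rightarrow> real \<Rightarrow> real" where
  "gauss_shift n \<xi> R \<rho> = measure (gauss_measure n) (ball_dim n (scale_dim n R \<xi>) \<rho>)"

lemma gauss_shift_nonneg [simp]: "gauss_shift n \<xi> R \<rho> \<ge> 0"
  by (simp add: gauss_shift_def)

lemma emeasure_gauss_shift:
  assumes \<xi>: "norm_dim n \<xi> = 1" and "R > 0" "\<rho> > 0"
  shows "emeasure (gauss_measure n) (ball_dim n (scale_dim n R \<xi>) \<rho>) = ennreal (gauss_shift n \<xi> R \<rho>)"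
proof -
  have "ball_dim n (scale_dim n R \<xi>) \<rho> \<subseteq> ball_dim n (zero_dim n) (\<rho> + R)"
  proof
    fix y assume y: "y \<in> ball_dim n (scale_dim n R \<xi>) \<rho>"
    have "norm_dim n (\<lambda>i. y i - zero_dim n i) = norm_dim n (\<lambda>i. (y i - scale_dim n R \<xi> i) + R * \<xi> i)"
      by (rule norm_dim_cong) (simp add: zero_dim_def scale_dim_def)
    also have "\<dots> \<le> norm_dim n (\<lambda>i. y i - scale_dim n R \<xi> i) + norm_dim n (\<lambda>i. R * \<xi> i)"
      by (rule norm_dim_triangle)
    also have "norm_dim n (\<lambda>i. R * \<xi> i) = R" using assms by (simp add: norm_dim_scale)
    finally show "y \<in> ball_dim n (zero_dim n) (\<rho> + R)" using y by (auto simp: ball_dim_def)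
  qed
  then have "emeasure (gauss_measure n) (ball_dim n (scale_dim n R \<xi>) \<rho>) \<le> emeasure (gauss_measure n) (ball_dim n (zero_dim n) (\<rho> + R))"
    by (rule emeasure_mono) (simp add: sets_ball_dim)
  also have "\<dots> < \<infinity>" using assms by (simp add: emeasure_gauss_ball_eq)
  finally show ?thesis unfolding gauss_shift_def by (simp add: emeasure_eq_ennreal_measure less_top)
qed

lemma gauss_shift_rotate:
  assumes "0 < n" "norm_dim n \<xi> = 1" "norm_dim n \<zeta> = 1" "R > 0" "\<rho> > 0"
  shows "gauss_shift n \<xi> R \<rho> = gauss_shift n \<zeta> R \<rho>"
proof -
  define F where "F = (\<lambda>(p :: real, q :: real). ennreal (exp (- pi * (p\<^sup>2 + 2 * R * q + R\<^sup>2))) *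
        indicator {..<\<rho>\<^sup>2} (p\<^sup>2 - 2 * (R - R) * q + (R - R)\<^sup>2) :: ennreal)"
  have F: "F \<in> borel_measurable (borel \<Otimes>\<^sub>M borel)" unfolding F_def by measurable
  have F_eq: "ennreal (gauss_shift n \<eta> R \<rho>) = (\<integral>\<^sup>+y. F (norm_dim n y, dot_dim n \<eta> y) \<partial>lborel_dim n)"
    if "norm_dim n \<eta> = 1" for \<eta>
    unfolding emeasure_gauss_shift[OF that assms(4,5), symmetric] emeasure_gauss_ball_shift[OF that assms(5), of R R] F_def
    by simp
  have "ennreal (gauss_shift n \<xi> R \<rho>) = ennreal (gauss_shift n \<zeta> R \<rho>)"
    unfolding F_eq[OF assms(2)] F_eq[OF assms(3)]
    by (rule nn_integral_radial_dot[OF assms(1) _ F]) (simp add: assms)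
  then show ?thesis by simp
qed

text \<open>The shifted ball reaches back to \<open>- r * \<xi>\<close> and so contains the centred
  ball of radius \<open>r\<close>. This keeps the denominator of \<open>T_ratio\<close>
  positive.\<close>

lemma gauss_ball_le_shift:
  assumes \<xi>: "norm_dim n \<xi> = 1" and "R > 0" "r > 0"
  shows "gauss_ball n r \<le> gauss_shift n \<xi> R (R + r)"
proof -
  have "ball_dim n (zero_dim n) r \<subseteq> ball_dim n (scale_dim n R \<xi>) (R + r)"
  proof
    fix y assume y: "y \<in> ball_dim n (zero_dim n) r"
    have "norm_dim n (\<lambda>i. y i - scale_dim n R \<xi> i) = norm_dim n (\<lambda>i. (y i - zero_dim n i) + (- R) * \<xi> i)"
      by (rule norm_dim_cong) (simp add: zero_dim_def scale_dim_def)
    also have "\<dots> \<le> norm_dim n (\<lambda>i. y i - zero_dim n i) + norm_dim n (\<lambda>i. (- R) * \<xi> i)"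
      by (rule norm_dim_triangle)
    also have "norm_dim n (\<lambda>i. (- R) * \<xi> i) = R" using assms by (subst norm_dim_scale) simp
    finally show "y \<in> ball_dim n (scale_dim n R \<xi>) (R + r)" using y by (auto simp: ball_dim_def)
  qed
  then have "emeasure (gauss_measure n) (ball_dim n (zero_dim n) r) \<le> emeasure (gauss_measure n) (ball_dim n (scale_dim n R \<xi>) (R + r))"
    by (rule emeasure_mono) (simp add: sets_ball_dim)
  then show ?thesis using assms by (simp add: emeasure_gauss_ball_eq emeasure_gauss_shift)
qed

section \<open>Lower bound for the best constant\<close>

lemma T_ratio_gauss:
  "T_ratio n (gauss_measure n) p \<xi> R r =
     gauss_ball n R / gauss_shift n \<xi> R (R + r) * (gauss_ball n r / gauss_ball n R) powr ((p - 1) / p)"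
  unfolding T_ratio_def gauss_ball_def gauss_shift_def by (rule refl)

lemma ennreal_powr_mono: "0 \<le> s \<Longrightarrow> a \<le> b \<Longrightarrow> ennreal_powr a s \<le> ennreal_powr b s"
  by (auto simp: ennreal_powr_def top_unique less_top intro!: ennreal_leI powr_mono2 enn2real_mono)

lemma ennreal_powr_ennreal: "0 \<le> a \<Longrightarrow> ennreal_powr (ennreal a) s = ennreal (a powr s)"
  by (simp add: ennreal_powr_def)

text \<open>For \<open>|x| < R\<close> the ball about \<open>x\<close> of radius
  \<open>|x| + r\<close> contains the centred ball of radius \<open>r\<close> and lies in the ball
  of radius \<open>R + r\<close> about \<open>R * x / |x|\<close>, whose measure is the same in
  every direction. So the maximal function is at least \<open>m0 / m2\<close> on the whole ball of
  radius \<open>R\<close>, and comparing norms gives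
  \<open>m0 / m2 * (m1 / m0) powr (1 / p) \<le> C\<close>.\<close>

lemma best_const_ge_T_ratio:
  assumes n: "0 < n" and p: "p \<ge> 1" and "0 < r" "r < R" and \<xi>: "norm_dim n \<xi> = 1"
  shows "ennreal (T_ratio n (gauss_measure n) p \<xi> R r) \<le> best_const n (gauss_measure n) p"
  unfolding best_const_def
proof (rule Inf_greatest, safe)
  fix C :: real assume C: "C \<ge> 0" "strong_type_const n (gauss_measure n) p C"
  have R: "R > 0" using assms by simp
  let ?M = "gauss_measure n" and ?Br = "ball_dim n (zero_dim n) r" and ?BR = "ball_dim n (zero_dim n) R"
  define m0 m1 m2 where "m0 = gauss_ball n r" and "m1 = gauss_ball n R" and "m2 = gauss_shift n \<xi> R (R + r)"
  have m: "m0 > 0" "m1 > 0" "m0 \<le> m2"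
    using assms R by (simp_all add: m0_def m1_def m2_def gauss_ball_pos gauss_ball_le_shift)
  then have m2: "m2 > 0" by simp
  define g :: "(nat \<Rightarrow> real) \<Rightarrow> real" where "g = indicator ?Br"
  have [measurable]: "?Br \<in> sets ?M" "?BR \<in> sets ?M" by (simp_all add: sets_ball_dim)
  have g: "g \<in> borel_measurable ?M" unfolding g_def by measurable
  have ng: "ennreal \<bar>g y\<bar> = indicator ?Br y" for y by (simp add: g_def indicator_def)
  have "ennreal_powr (indicator ?Br y) p = indicator ?Br y" for y :: "nat \<Rightarrow> real"
    using p by (cases "y \<in> ?Br") (simp_all add: ennreal_powr_def)
  then have "(\<integral>\<^sup>+y. ennreal_powr (ennreal \<bar>g y\<bar>) p \<partial>?M) = ennreal m0"
    unfolding ng using assms by (simp add: emeasure_gauss_ball_eq m0_def)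
  then have Lg: "Lp_norm ?M p (\<lambda>y. ennreal \<bar>g y\<bar>) = ennreal (m0 powr (1 / p))"
    using m by (simp add: Lp_norm_def ennreal_powr_ennreal)
  have max: "ennreal (m0 / m2) \<le> maximal_fun n ?M g x" if x: "x \<in> ?BR" for x
  proof -
    define s where "s = norm_dim n x"
    have "norm_dim n (\<lambda>i. x i - zero_dim n i) = s"
      unfolding s_def by (rule norm_dim_cong) (simp add: zero_dim_def)
    then have s: "0 \<le> s" "s < R" "x \<in> space (lborel_dim n)" using x by (auto simp: ball_dim_def s_def)
    \<comment> \<open>At \<open>x = 0\<close> there is no direction \<open>x / |x|\<close>, and
      \<open>\<xi>\<close> takes its place.\<close>
    obtain \<zeta> where \<zeta>: "norm_dim n \<zeta> = 1" "\<And>i. i < n \<Longrightarrow> x i = s * \<zeta> i"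
    proof (cases "s = 0")
      case True
      then have "(\<Sum>i<n. (x i)\<^sup>2) = 0" by (simp add: s_def flip: norm_dim_sq)
      then have "\<And>i. i < n \<Longrightarrow> x i = 0" by (subst (asm) sum_nonneg_eq_0_iff) auto
      with True that[of \<xi>] \<xi> show ?thesis by simp
    next
      case False
      have "norm_dim n (\<lambda>i. (1 / s) * x i) = 1" using False s by (subst norm_dim_scale) (simp add: s_def)
      with False that[of "\<lambda>i. (1 / s) * x i"] show ?thesis by simp
    qed
    define t where "t = s + r"
    have t: "t > 0" using s assms by (simp add: t_def)
    have sub: "ball_dim n x t \<subseteq> ball_dim n (scale_dim n R \<zeta>) (R + r)"
    proof
      fix y assume y: "y \<in> ball_dim n x t"
      have "norm_dim n (\<lambda>i. y i - scale_dim n R \<zeta> i) = norm_dim n (\<lambda>i. (y i - x i) + (s - R) * \<zeta> i)"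
        by (rule norm_dim_cong) (simp add: scale_dim_def \<zeta>(2) algebra_simps)
      also have "\<dots> \<le> norm_dim n (\<lambda>i. y i - x i) + norm_dim n (\<lambda>i. (s - R) * \<zeta> i)"
        by (rule norm_dim_triangle)
      also have "norm_dim n (\<lambda>i. (s - R) * \<zeta> i) = R - s" using s \<zeta> by (subst norm_dim_scale) simp
      finally show "y \<in> ball_dim n (scale_dim n R \<zeta>) (R + r)" using y by (auto simp: ball_dim_def t_def)
    qed
    have sub': "?Br \<subseteq> ball_dim n x t"
    proof
      fix y assume y: "y \<in> ?Br"
      have "norm_dim n (\<lambda>i. y i - x i) = norm_dim n (\<lambda>i. (y i - zero_dim n i) + (- 1) * x i)"
        by (rule norm_dim_cong) (simp add: zero_dim_def)
      also have "\<dots> \<le> norm_dim n (\<lambda>i. y i - zero_dim n i) + norm_dim n (\<lambda>i. (- 1) * x i)"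
        by (rule norm_dim_triangle)
      also have "norm_dim n (\<lambda>i. (- 1) * x i) = s" by (subst norm_dim_scale) (simp add: s_def)
      finally show "y \<in> ball_dim n x t" using y by (auto simp: ball_dim_def t_def)
    qed
    have "emeasure ?M (ball_dim n x t) \<le> emeasure ?M (ball_dim n (scale_dim n R \<zeta>) (R + r))"
      by (rule emeasure_mono[OF sub]) (simp add: sets_ball_dim)
    also have "\<dots> = ennreal m2"
      using gauss_shift_rotate[OF n \<zeta>(1) \<xi>, of R "R + r"] R assms \<zeta> by (simp add: emeasure_gauss_shift m2_def)
    finally have le: "emeasure ?M (ball_dim n x t) \<le> ennreal m2" .
    have "(\<integral>\<^sup>+y\<in>ball_dim n x t. ennreal \<bar>g y\<bar> \<partial>?M) = (\<integral>\<^sup>+y. indicator ?Br y \<partial>?M)"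
      unfolding ng by (rule nn_integral_cong) (use sub' in \<open>auto simp: indicator_def\<close>)
    then have int: "(\<integral>\<^sup>+y\<in>ball_dim n x t. ennreal \<bar>g y\<bar> \<partial>?M) = ennreal m0"
      using assms by (simp add: emeasure_gauss_ball_eq m0_def)
    have "ennreal m0 \<le> emeasure ?M (ball_dim n x t)"
      using emeasure_mono[OF sub', of ?M] assms by (simp add: emeasure_gauss_ball_eq m0_def sets_ball_dim)
    with le m m2 obtain v where v: "emeasure ?M (ball_dim n x t) = ennreal v" "m0 \<le> v" "v \<le> m2"
      by (cases "emeasure ?M (ball_dim n x t)") (auto simp: top_unique)
    have "m0 / m2 \<le> m0 / v" using m v by (intro divide_left_mono) auto
    then have "ennreal (m0 / m2) \<le> ennreal m0 / emeasure ?M (ball_dim n x t)"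
      using m v by (simp add: divide_ennreal)
    also have "\<dots> \<le> maximal_fun n ?M g x"
      unfolding maximal_fun_def int[symmetric] by (rule SUP_upper) (use t in simp)
    finally show ?thesis .
  qed
  have "ennreal ((m0 / m2) powr p * m1) = (\<integral>\<^sup>+x. ennreal ((m0 / m2) powr p) * indicator ?BR x \<partial>?M)"
    using m R by (subst nn_integral_cmult) (simp_all add: emeasure_gauss_ball_eq m1_def ennreal_mult)
  also have "\<dots> \<le> (\<integral>\<^sup>+x. ennreal_powr (maximal_fun n ?M g x) p \<partial>?M)"
  proof (rule nn_integral_mono)
    fix x
    show "ennreal ((m0 / m2) powr p) * indicator ?BR x \<le> ennreal_powr (maximal_fun n ?M g x) p"
      using ennreal_powr_mono[OF _ max, of p x] p m m2
      by (cases "x \<in> ?BR") (simp_all add: ennreal_powr_ennreal)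
  qed
  finally have "ennreal_powr (ennreal ((m0 / m2) powr p * m1)) (1 / p) \<le> Lp_norm ?M p (maximal_fun n ?M g)"
    unfolding Lp_norm_def using p by (intro ennreal_powr_mono) simp_all
  also have "\<dots> \<le> ennreal C * ennreal (m0 powr (1 / p))"
    using C(2) g unfolding strong_type_const_def Lg[symmetric] by (auto simp: Lg)
  finally have "ennreal_powr (ennreal ((m0 / m2) powr p * m1)) (1 / p) \<le> ennreal C * ennreal (m0 powr (1 / p))" .
  moreover have "ennreal_powr (ennreal ((m0 / m2) powr p * m1)) (1 / p) = ennreal (((m0 / m2) powr p * m1) powr (1 / p))"
    by (rule ennreal_powr_ennreal) (use m in simp)
  moreover have "ennreal C * ennreal (m0 powr (1 / p)) = ennreal (C * m0 powr (1 / p))"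
    using C by (simp add: ennreal_mult)
  ultimately have "ennreal (((m0 / m2) powr p * m1) powr (1 / p)) \<le> ennreal (C * m0 powr (1 / p))"
    by (simp only:)
  then have "((m0 / m2) powr p * m1) powr (1 / p) \<le> C * m0 powr (1 / p)"
    using C m by simp
  moreover have "((m0 / m2) powr p * m1) powr (1 / p) = (m0 / m2) * m1 powr (1 / p)"
    using p m m2 by (simp add: powr_mult powr_powr)
  ultimately have "(m0 / m2) * m1 powr (1 / p) / m0 powr (1 / p) \<le> C"
    using m by (simp add: divide_le_eq mult_ac)
  moreover have "m1 / m2 * (m0 / m1) powr ((p - 1) / p) = (m0 / m2) * m1 powr (1 / p) / m0 powr (1 / p)"
  proof -
    have "(p - 1) / p = 1 - 1 / p" using p by (simp add: field_simps)
    then have "(m0 / m1) powr ((p - 1) / p) = (m0 / m1) / (m0 powr (1 / p) / m1 powr (1 / p))"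
      using m by (simp add: powr_diff powr_divide)
    then show ?thesis using m m2 by (simp add: field_simps)
  qed
  ultimately show "ennreal (T_ratio n ?M p \<xi> R r) \<le> ennreal C"
    by (intro ennreal_leI) (simp add: T_ratio_gauss m0_def m1_def m2_def)
qed

text \<open>The number \<open>0.124848\<close> is \<open>(1 / 5) * (1 - 2 / 5) * 1.02\<^sup>2\<close>.\<close>

lemma growth_rate_gt_one: "1 < exp (0.124848) / 1.02 * (1 / 50) powr (0.012 :: real)"
proof -
  have "2.7 \<le> exp (1::real)" using e_approx_32 unfolding abs_le_iff by simp
  then have "2.7 ^ 4 \<le> exp (1::real) ^ 4" by (intro power_mono) auto
  also have "\<dots> = exp 4" by (simp flip: exp_of_nat_mult)
  finally have "(27 / 10) ^ 4 \<le> exp (4::real)" by simp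
  moreover have "(50::real) \<le> (27 / 10) ^ 4" by (simp add: power_divide)
  ultimately have "(50::real) \<le> exp 4" by (rule order_trans[rotated])
  then have "ln 50 \<le> ln (exp (4::real))" by (subst ln_le_cancel_iff) auto
  then have "ln 50 \<le> (4::real)" by simp
  moreover have "ln 1.02 \<le> (0.02::real)" using ln_le_minus_one[of "1.02::real"] by simp
  \<comment> \<open>With \<open>ln 50 \<le> 4\<close> and \<open>ln 1.02 \<le> 0.02\<close> the
    right-hand side is at least \<open>0.056848\<close>.\<close>
  ultimately have "0 < 0.124848 - ln 1.02 - 0.012 * ln (50::real)" by simp
  then have "1 < exp (0.124848 - ln 1.02 - 0.012 * ln (50::real))" by (subst one_less_exp_iff)
  also have "\<dots> = exp (0.124848) / 1.02 * (1 / 50) powr (0.012 :: real)"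
  proof -
    have "(1 / 50 :: real) powr 0.012 = exp (- (0.012 * ln 50))"
      by (simp add: powr_def ln_div)
    moreover have "exp (0.124848 - ln 1.02 - 0.012 * ln (50::real)) = exp (0.124848 - ln 1.02) * exp (- (0.012 * ln 50))"
      by (simp flip: exp_add)
    moreover have "exp (0.124848 - ln 1.02) = exp (0.124848) / (1.02 :: real)"
      unfolding exp_diff by (subst exp_ln) simp_all
    ultimately show ?thesis by (simp only:)
  qed
  finally show ?thesis .
qed

text \<open>This radius makes \<open>2 * pi * R^2 / n = 2 / 5\<close>, hence
  \<open>g = 3 / 5 * 1.02^2 = 0.62424\<close> and \<open>pi * g * R^2 = 0.124848 * n\<close>. The
  other factor loses at most \<open>(1 / 50) powr 0.012\<close> per dimension, where
  \<open>0.012\<close> rounds up \<open>(p - 1) / p\<close> at \<open>p = 1.011871\<close>.\<close>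

lemma T_ratio_lower:
  assumes n: "0 < n" and s: "0 \<le> (p - 1) / p" "(p - 1) / p \<le> 0.012" and \<xi>: "norm_dim n \<xi> = 1"
    and R: "R = sqrt (real n / (5 * pi))"
  shows "(exp (0.124848) / 1.02 * (1 / 50) powr 0.012) ^ n \<le> T_ratio n (gauss_measure n) p \<xi> R (R / 50)"
proof -
  have R0: "R > 0" and R2: "R\<^sup>2 = real n / (5 * pi)" using n by (simp_all add: R)
  define m0 m1 m2 where "m0 = gauss_ball n (R / 50)" and "m1 = gauss_ball n R" and "m2 = gauss_shift n \<xi> R (R + R / 50)"
  have m: "m0 > 0" "m1 > 0" using R0 by (simp_all add: m0_def m1_def gauss_ball_pos)
  have "m0 \<le> m2" unfolding m0_def m2_def using R0 by (intro gauss_ball_le_shift \<xi>) auto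
  with m have m2: "m2 > 0" by simp
  have RR: "R + R / 50 = 1.02 * R" by simp
  have "emeasure (gauss_measure n) (ball_dim n (scale_dim n R \<xi>) (1.02 * R)) \<le> ennreal (1.02 ^ n * exp (- pi * 0.62424 * R\<^sup>2) * gauss_ball n R)"
  proof (rule emeasure_gauss_ball_shift_le[OF n \<xi> R0])
    have "2 * pi * R\<^sup>2 / real n = 2 / 5" using n by (simp add: R2)
    then show "0.62424 = (1 - 2 * pi * R\<^sup>2 / real n) * (1.02)\<^sup>2" by (simp add: power2_eq_square)
  qed simp_all
  then have "m2 \<le> 1.02 ^ n * exp (- pi * 0.62424 * R\<^sup>2) * m1"
    using R0 \<xi> unfolding m2_def m1_def RR by (simp add: emeasure_gauss_shift)
  also have "- pi * 0.62424 * R\<^sup>2 = - (real n * 0.124848)" by (simp add: R2)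
  finally have "exp (0.124848) ^ n / 1.02 ^ n \<le> m1 / m2"
    using m m2 unfolding exp_of_nat_mult[symmetric] by (simp add: exp_minus field_simps)
  moreover have "((1 / 50) powr 0.012) ^ n \<le> (m0 / m1) powr ((p - 1) / p)"
  proof -
    have "(1 / 50) ^ n * m1 \<le> m0"
      using gauss_ball_scale(1)[of "1/50" R n] R0 by (simp add: m0_def m1_def)
    then have le: "(1 / 50) ^ n \<le> m0 / m1" using m by (simp add: le_divide_eq)
    have "((1 / 50) powr 0.012) ^ n = ((1 / 50 :: real) ^ n) powr 0.012"
      by (simp add: powr_powr mult.commute flip: powr_realpow)
    also have "\<dots> \<le> ((1 / 50) ^ n) powr ((p - 1) / p)"
      by (rule powr_mono') (use s in \<open>auto simp: power_le_one\<close>)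
    also have "\<dots> \<le> (m0 / m1) powr ((p - 1) / p)" by (rule powr_mono2) (use s le in auto)
    finally show ?thesis .
  qed
  ultimately have "(exp (0.124848) ^ n / 1.02 ^ n) * ((1 / 50) powr 0.012) ^ n \<le> m1 / m2 * (m0 / m1) powr ((p - 1) / p)"
    using m m2 by (intro mult_mono) auto
  then show ?thesis unfolding T_ratio_gauss m0_def m1_def m2_def by (simp add: power_mult_distrib power_divide)
qed

section \<open>Numerical estimates\<close>

text \<open>Since \<open>(1 - y / m) ^ m \<le> exp (- y)\<close>, the last assumption implies
  \<open>exp y \<le> x\<close>. For rational \<open>x\<close> and \<open>y\<close> it is plain
  rational arithmetic.\<close>

lemma ln_ge_by_power:
  assumes "0 < x" "0 \<le> y" "y < real m" "0 < m" "1 \<le> x * (1 - y / real m) ^ m"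
  shows "(y :: real) \<le> ln x"
proof -
  have "(1 - y / real m) ^ m \<le> exp (- (y / real m)) ^ m"
    using assms exp_ge_add_one_self[of "- (y / real m)"] by (intro power_mono) auto
  also have "\<dots> = exp (- y)" using assms by (simp flip: exp_of_nat_mult)
  finally have "x * (1 - y / real m) ^ m \<le> x * exp (- y)" using assms by simp
  with assms(5) have "1 \<le> x * exp (- y)" by linarith
  then have "exp y \<le> x" using assms by (simp add: exp_minus field_simps)
  then have "ln (exp y) \<le> ln x" using assms by (subst ln_le_cancel_iff) auto
  then show ?thesis by simp
qed

lemma ln_two_ge: "(69 / 100) \<le> ln (2::real)"
  by (rule ln_ge_by_power[of _ _ 100]) (simp_all add: power_divide)

lemma ln_pi_ge: "(113 / 100) \<le> ln pi"
proof -
  have "(113 / 100) \<le> ln ((31415 / 10000) :: real)"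
    by (rule ln_ge_by_power[of _ _ 100]) (simp_all add: power_divide)
  also have "\<dots> \<le> ln pi" using pi_approx(1) by (subst ln_le_cancel_iff) auto
  finally show ?thesis .
qed

section \<open>Tangent and chord bounds for powers\<close>

lemma tangent_power_eq: "1 + 3 / 32 * (l / l0 - 1) = 29 / 32 + 3 / 32 * (l / l0 :: real)"
proof -
  have "1 + 3 / 32 * (a - 1) = 29 / 32 + 3 / 32 * a" for a :: real by (simp add: field_simps)
  then show ?thesis .
qed

lemma tangent_power_pos:
  assumes "0 < l" "0 < l0"
  shows "0 < 1 + 3 / 32 * (l / l0 - 1 :: real)"
  unfolding tangent_power_eq using assms by (intro add_pos_pos) auto

text \<open>The concave power \<open>l powr (3 / 32)\<close> lies below its tangent at
  \<open>l0\<close>, by Young's inequality with weights \<open>3 / 32\<close> and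
  \<open>29 / 32\<close>. \<open>U\<close> is an upper bound for \<open>l0 powr (3 / 32)\<close>,
  certified by integer powers. The exponent is twice \<open>3 / 64\<close> because the rate is
  compared with the logarithm of a squared radius.\<close>

lemma ln_le_tangent_power:
  assumes "0 < l" "0 < l0" "0 < U" "l0 ^ 3 \<le> U ^ 32"
  shows "3 / 32 * ln l \<le> ln (U * (1 + 3 / 32 * (l / l0 - 1)) :: real)"
proof -
  note pos = tangent_power_pos[OF assms(1,2)]
  have "(l / l0) powr (3 / 32) * 1 powr (29 / 32) \<le> 3 / 32 * (l / l0) + 29 / 32 * 1"
    by (rule Youngs_inequality_0) (use assms in auto)
  also have "\<dots> = 1 + 3 / 32 * (l / l0 - 1)" unfolding tangent_power_eq by simp
  finally have "ln ((l / l0) powr (3 / 32)) \<le> ln (1 + 3 / 32 * (l / l0 - 1))"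
    using assms pos by (subst ln_le_cancel_iff) auto
  then have 1: "3 / 32 * (ln l - ln l0) \<le> ln (1 + 3 / 32 * (l / l0 - 1))"
    using assms by (simp add: ln_powr ln_div)
  have "ln (l0 ^ 3) \<le> ln (U ^ 32)" using assms by (subst ln_le_cancel_iff) auto
  then have "3 / 32 * ln l0 \<le> ln U" using assms by (simp add: ln_realpow)
  moreover have "ln (U * (1 + 3 / 32 * (l / l0 - 1))) = ln U + ln (1 + 3 / 32 * (l / l0 - 1))"
    using assms pos by (subst ln_mult) auto
  ultimately show ?thesis using 1 by argo
qed

text \<open>Convex powers lie below their chords on \<open>[u, w]\<close>: each defect is
  \<open>(l - u) * (w - l)\<close> times a nonnegative polynomial. The coefficients are parameters
  tied by equations, so that each instance can supply them as numerals.\<close>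

lemma power_le_chord:
  fixes u l w :: real
  assumes "0 \<le> u" "u \<le> l" "l \<le> w"
    and ab: "a = u + w" "b = u * w" and cdef: "c = a * a - b" "d = a * b" "e = a * (a * a - 2 * b)" "f = b * c"
  shows "l\<^sup>2 \<le> a * l - b" and "l ^ 3 \<le> c * l - d" and "l ^ 4 \<le> e * l - f"
proof -
  have p: "(l - u) * (w - l) \<ge> 0" using assms by simp
  then show "l\<^sup>2 \<le> a * l - b" by (simp add: ab power2_eq_square algebra_simps)
  have "(l - u) * (w - l) * (l + u + w) \<ge> 0" using p assms by (intro mult_nonneg_nonneg) auto
  then show "l ^ 3 \<le> c * l - d"
    by (simp add: ab cdef power3_eq_cube algebra_simps)
  have "(l - u) * (w - l) * (l * l + (u + w) * l + (u * u + u * w + w * w)) \<ge> 0"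
    using p assms by (intro mult_nonneg_nonneg add_nonneg_nonneg) auto
  then show "l ^ 4 \<le> e * l - f"
    by (simp add: ab cdef power4_eq_xxxx algebra_simps)
qed

text \<open>
  The half ball inside the shifted ball has centre \<open>R * (1 - shift_frac l)\<close> times \<open>\<xi>\<close> and radius
  \<open>R * sqrt (cut_radius_sq l)\<close>. This value of \<open>shift_frac\<close> cancels the terms proportional to \<open>R\<^sup>2\<close>
  in the exponent. The constant \<open>3 / 64\<close> is a lower bound of \<open>(p - 1) / p\<close> for \<open>p > 1.049427\<close>.
\<close>

definition shift_frac :: "real \<Rightarrow> real" where
  "shift_frac l = ((1 + l)\<^sup>2 + 3 / 64 * (1 - l\<^sup>2)) / 2"

definition cut_radius_sq :: "real \<Rightarrow> real" where
  "cut_radius_sq l = (1 + l)\<^sup>2 - (shift_frac l)\<^sup>2"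

lemma shift_frac_poly: "shift_frac l = 67 / 128 + l + 61 / 128 * l\<^sup>2"
  unfolding shift_frac_def power2_sum by (simp add: field_simps)

lemma cut_radius_sq_poly:
  "cut_radius_sq l = 11895 / 16384 + 61 / 64 * l - 4087 / 8192 * l\<^sup>2 - 61 / 64 * l ^ 3 - 3721 / 16384 * l ^ 4"
  unfolding cut_radius_sq_def shift_frac_poly
  by (simp add: power2_eq_square power3_eq_cube power4_eq_xxxx algebra_simps)

text \<open>\<open>41425 / 100000\<close> lies just above \<open>sqrt 2 - 1\<close>. The lower bound
  makes the radius factor of the half ball at least \<open>852 / 1000\<close>; the upper bound keeps
  it below \<open>1\<close>, as the comparison of centred balls requires.\<close>

lemma cut_radius_sq_bounds:
  assumes "0 \<le> l" "l \<le> (41425 / 100000)"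
  shows "(726 / 1000) \<le> cut_radius_sq l" "cut_radius_sq l < 1"
proof -
  have ch: "l\<^sup>2 \<le> 1657 / 4000 * l - 0" "l ^ 3 \<le> 2745649 / 16000000 * l - 0" "l ^ 4 \<le> 4549540393 / 64000000000 * l - 0"
      by (rule power_le_chord[of 0 l "1657 / 4000" "1657 / 4000" "0" "2745649 / 16000000" "0" "4549540393 / 64000000000" "0"]; use assms in simp)+
  show "(726 / 1000) \<le> cut_radius_sq l"
    using ch assms unfolding cut_radius_sq_poly by linarith
  \<comment> \<open>Tangents to \<open>l^2\<close> and \<open>l^3\<close> at \<open>4 / 10\<close>,
    close to the maximum of the polynomial.\<close>
  have "0 \<le> (l - 4 / 10)\<^sup>2" by simp
  then have "8 / 10 * l - 16 / 100 \<le> l\<^sup>2" by (simp add: power2_eq_square field_simps)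
  moreover have "0 \<le> (l + 8 / 10) * (l - 4 / 10)\<^sup>2" using assms by simp
  then have "48 / 100 * l - 128 / 1000 \<le> l ^ 3" by (simp add: power2_eq_square power3_eq_cube field_simps)
  moreover have "0 \<le> l ^ 4" by simp
  ultimately show "cut_radius_sq l < 1"
    using assms unfolding cut_radius_sq_poly by linarith
qed

text \<open>Controls the tilt: for the half ball the quantity \<open>\<theta> * b / sqrt n\<close>
  equals \<open>2 * pi * R^2 / sqrt n\<close> times the left-hand side.\<close>

lemma shift_frac_cut_le:
  assumes "0 \<le> l" "l \<le> (41425 / 100000)"
  shows "\<bar>1 - shift_frac l\<bar> * sqrt (cut_radius_sq l) \<le> (41 / 100)"
proof -
  have k1: "sqrt (cut_radius_sq l) \<le> 1" using cut_radius_sq_bounds[OF assms] by simp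
  \<comment> \<open>The square of this line dominates the constant and linear coefficients of the
    polynomial, whose higher coefficients are negative.\<close>
  have k: "sqrt (cut_radius_sq l) \<le> (8521 / 10000) + (56 / 100) * l"
  proof (rule real_le_lsqrt)
    have "0 \<le> l\<^sup>2" "0 \<le> l ^ 3" "0 \<le> l ^ 4" using assms by auto
    moreover have "((8521 / 10000) + (56 / 100) * l)\<^sup>2 = 72607441 / 100000000 + 954352 / 1000000 * l + 3136 / 10000 * l\<^sup>2"
      by (simp add: power2_eq_square algebra_simps)
    ultimately show "cut_radius_sq l \<le> ((8521 / 10000) + (56 / 100) * l)\<^sup>2"
      using assms unfolding cut_radius_sq_poly by linarith
  qed (use assms cut_radius_sq_bounds[OF assms] in auto)
  have v: "shift_frac l = 67 / 128 + l + 61 / 128 * l\<^sup>2"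
    by (rule shift_frac_poly)
  show ?thesis
  proof (cases "shift_frac l \<le> 1")
    case True
    have "(1 - shift_frac l) * sqrt (cut_radius_sq l) \<le> ((47657 / 100000) - l) * ((8521 / 10000) + (56 / 100) * l)"
    proof (rule mult_mono)
      show "1 - shift_frac l \<le> 47657 / 100000 - l" using v zero_le_power2[of l] by linarith
    qed (use k assms cut_radius_sq_bounds[OF assms] in auto)
    also have "\<dots> \<le> (41 / 100)" using assms zero_le_power2[of l] by (simp add: algebra_simps power2_eq_square)
    finally show ?thesis using True by simp
  next
    case False
    have "l\<^sup>2 \<le> (41425 / 100000)\<^sup>2" using assms by (intro power_mono) auto
    then have "\<bar>1 - shift_frac l\<bar> \<le> (41 / 100)" using assms False unfolding v by (simp add: power2_eq_square)
    then have "\<bar>1 - shift_frac l\<bar> * sqrt (cut_radius_sq l) \<le> (41 / 100) * 1"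
      using k1 cut_radius_sq_bounds[OF assms] by (intro mult_mono) auto
    then show ?thesis by simp
  qed
qed

text \<open>
  The rate is bounded by tangents of \<open>l powr (3 / 32)\<close> at four points and by chords of the concave
  function \<open>cut_radius_sq\<close>. Its maximum, near \<open>l = 0.09\<close>, is about \<open>- 0.006\<close>.
\<close>

lemma rate_aux:
  assumes "0 < l" "0 < l0" "0 < U" "l0 ^ 3 \<le> U ^ 32" "l \<le> (41425 / 100000)"
    and le: "U * (1 + 3 / 32 * (l / l0 - 1)) \<le> (9912 / 10000) * cut_radius_sq l"
  shows "3 / 64 * ln l - ln (cut_radius_sq l) / 2 \<le> - (44 / 10000)"
proof -
  have pos: "0 < cut_radius_sq l" using cut_radius_sq_bounds[of l] assms by simp
  have "0 < 1 + 3 / 32 * (l / l0 - 1)" using assms by (intro tangent_power_pos)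
  then have "ln (U * (1 + 3 / 32 * (l / l0 - 1))) \<le> ln ((9912 / 10000) * cut_radius_sq l)"
    using le pos assms by (subst ln_le_cancel_iff) auto
  moreover have "ln ((9912 / 10000) * cut_radius_sq l) = ln (9912 / 10000) + ln (cut_radius_sq l)"
    using pos by (subst ln_mult) auto
  \<comment> \<open>The factor \<open>0.9912\<close> is chosen for this: its logarithm is at most
    \<open>- 88 / 10000\<close>, half of which is the claimed rate.\<close>
  moreover have "ln ((9912 / 10000) :: real) \<le> (9912 / 10000) - 1" by (rule ln_le_minus_one) simp
  ultimately show ?thesis using ln_le_tangent_power[OF assms(1-4)] by linarith
qed

text \<open>On each interval the chords bound \<open>cut_radius_sq\<close> from below by a line, so
  the condition of \<open>rate_aux\<close> becomes linear in \<open>l\<close>. The values of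
  \<open>U\<close> are \<open>l0 powr (3 / 32)\<close> rounded up to four digits.\<close>

lemma rate_le:
  assumes "0 < l" "l \<le> (41425 / 100000)"
  shows "3 / 64 * ln l - ln (cut_radius_sq l) / 2 \<le> - (44 / 10000)"
proof -
  consider "l \<le> (5 / 100)" | "(5 / 100) \<le> l" "l \<le> (1 / 10)" | "(1 / 10) \<le> l" "l \<le> (16 / 100)" | "(16 / 100) \<le> l" by linarith
  then show ?thesis
  proof cases
    case 1
    have ch: "l\<^sup>2 \<le> 1 / 20 * l - 0" "l ^ 3 \<le> 1 / 400 * l - 0" "l ^ 4 \<le> 1 / 8000 * l - 0"
      by (rule power_le_chord[of 0 l "1 / 20" "1 / 20" "0" "1 / 400" "0" "1 / 8000" "0"]; use assms 1 in simp)+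
    have "181503 / 250000 + 925767 / 1000000 * l \<le> cut_radius_sq l"
      using ch 1 assms unfolding cut_radius_sq_poly by linarith
    then have "208771 / 320000 + 7199 / 3200 * l \<le> 9912 / 10000 * cut_radius_sq l" using 1 assms by linarith
    moreover have "(7199 / 10000) * (1 + 3 / 32 * (l / (3 / 100) - 1)) = 208771 / 320000 + 7199 / 3200 * l" by (simp add: field_simps)
    ultimately have "(7199 / 10000) * (1 + 3 / 32 * (l / (3 / 100) - 1)) \<le> (9912 / 10000) * cut_radius_sq l" by (simp only:)
    then show ?thesis by (intro rate_aux[of l "3 / 100" "7199 / 10000", OF assms(1) _ _ _ assms(2)]) (simp_all add: power_divide)
  next
    case 2
    have ch: "l\<^sup>2 \<le> 3 / 20 * l - 1 / 200" "l ^ 3 \<le> 7 / 400 * l - 3 / 4000" "l ^ 4 \<le> 3 / 1600 * l - 7 / 80000"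
      by (rule power_le_chord[of "1 / 20" l "1 / 10" "3 / 20" "1 / 200" "7 / 400" "3 / 4000" "3 / 1600" "7 / 80000"]; use assms 2 in simp)+
    have "729241 / 1000000 + 861183 / 1000000 * l \<le> cut_radius_sq l"
      using ch 2 assms unfolding cut_radius_sq_poly by linarith
    then have "57217 / 80000 + 5919 / 6400 * l \<le> 9912 / 10000 * cut_radius_sq l" using 2 assms by linarith
    moreover have "(7892 / 10000) * (1 + 3 / 32 * (l / (8 / 100) - 1)) = 57217 / 80000 + 5919 / 6400 * l" by (simp add: field_simps)
    ultimately have "(7892 / 10000) * (1 + 3 / 32 * (l / (8 / 100) - 1)) \<le> (9912 / 10000) * cut_radius_sq l" by (simp only:)
    then show ?thesis by (intro rate_aux[of l "8 / 100" "7892 / 10000", OF assms(1) _ _ _ assms(2)]) (simp_all add: power_divide)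
  next
    case 3
    have ch: "l\<^sup>2 \<le> 13 / 50 * l - 2 / 125" "l ^ 3 \<le> 129 / 2500 * l - 13 / 3125" "l ^ 4 \<le> 1157 / 125000 * l - 129 / 156250"
      by (rule power_le_chord[of "1 / 10" l "4 / 25" "13 / 50" "2 / 125" "129 / 2500" "13 / 3125" "1157 / 125000" "129 / 156250"]; use assms 3 in simp)+
    have "738147 / 1000000 + 386063 / 500000 * l \<le> cut_radius_sq l"
      using ch 3 assms unfolding cut_radius_sq_poly by linarith
    then have "118871 / 160000 + 4099 / 6400 * l \<le> 9912 / 10000 * cut_radius_sq l" using 3 assms by linarith
    moreover have "(8198 / 10000) * (1 + 3 / 32 * (l / (12 / 100) - 1)) = 118871 / 160000 + 4099 / 6400 * l" by (simp add: field_simps)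
    ultimately have "(8198 / 10000) * (1 + 3 / 32 * (l / (12 / 100) - 1)) \<le> (9912 / 10000) * cut_radius_sq l" by (simp only:)
    then show ?thesis by (intro rate_aux[of l "12 / 100" "8198 / 10000", OF assms(1) _ _ _ assms(2)]) (simp_all add: power_divide)
  next
    case 4
    have ch: "l\<^sup>2 \<le> 2297 / 4000 * l - 1657 / 25000" "l ^ 3 \<le> 4215729 / 16000000 * l - 3806129 / 100000000" "l ^ 4 \<le> 7247606953 / 64000000000 * l - 6985462953 / 400000000000"
      by (rule power_le_chord[of "4 / 25" l "1657 / 4000" "2297 / 4000" "1657 / 25000" "4215729 / 16000000" "3806129 / 100000000" "7247606953 / 64000000000" "6985462953 / 400000000000"]; use assms 4 in simp)+
    have "399661 / 500000 + 194889 / 500000 * l \<le> cut_radius_sq l"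
      using ch 4 assms unfolding cut_radius_sq_poly by linarith
    then have "127339 / 160000 + 13173 / 40000 * l \<le> 9912 / 10000 * cut_radius_sq l" using 4 assms by linarith
    moreover have "(8782 / 10000) * (1 + 3 / 32 * (l / (25 / 100) - 1)) = 127339 / 160000 + 13173 / 40000 * l" by (simp add: field_simps)
    ultimately have "(8782 / 10000) * (1 + 3 / 32 * (l / (25 / 100) - 1)) \<le> (9912 / 10000) * cut_radius_sq l" by (simp only:)
    then show ?thesis by (intro rate_aux[of l "25 / 100" "8782 / 10000", OF assms(1) _ _ _ assms(2)]) (simp_all add: power_divide)
  qed
qed

section \<open>Subexponential losses against the prefactor\<close>

lemma exp_le_by_ln: "0 < y \<Longrightarrow> x \<le> ln y \<Longrightarrow> exp x \<le> (y :: real)"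
  using exp_le_cancel_iff[of x "ln y"] by simp

text \<open>Both losses have to fit under the prefactor without help from the exponential rate. The
  bound \<open>1 - 1 / n\<close> on \<open>S\<close>, which comes from the critical radius, saves
  \<open>n = 2\<close> and \<open>n = 3\<close>; there \<open>S \<le> 1\<close> would be too
  weak.\<close>

lemma small_dim_bound:
  assumes n: "2 \<le> n" "n \<le> 16" and S: "0 \<le> S" "S \<le> 1 - 1 / real n"
  shows "2 * exp ((148 / 1000) * sqrt (2 * S) * sqrt n + (41 / 100) * S * sqrt n) \<le> sqrt pi * real n"
proof -
  have "ln 2 + ((148 / 1000) * sqrt (2 * S) * sqrt n + (41 / 100) * S * sqrt n) \<le> ln (sqrt pi * real n)"
  proof -
    have pi: "ln (sqrt pi * real n) = ln pi / 2 + ln (real n)"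
      using n by (simp add: ln_mult ln_sqrt)
    consider "n = 2" | "n = 3" | "n \<ge> 4" using n by linarith
    then show ?thesis
    proof cases
      case 1
      have "S \<le> 1 / 2" using S 1 by simp
      moreover from this have "sqrt (2 * S) \<le> 1" by simp
      ultimately have "(148 / 1000) * sqrt (2 * S) + (41 / 100) * S \<le> (353 / 1000)" by linarith
      then have "((148 / 1000) * sqrt (2 * S) + (41 / 100) * S) * sqrt 2 \<le> (353 / 1000) * (15 / 10)"
        by (intro mult_mono real_le_lsqrt) (use S in \<open>auto simp: power2_eq_square\<close>)
      with 1 pi ln_pi_ge show ?thesis by (simp add: algebra_simps)
    next
      case 2
      have "S \<le> 2 / 3" using S 2 by simp
      moreover from this have "sqrt (2 * S) \<le> (116 / 100)" using S by (intro real_le_lsqrt) (auto simp: power2_eq_square)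
      ultimately have "(148 / 1000) * sqrt (2 * S) + (41 / 100) * S \<le> (4451 / 10000)" by linarith
      then have "((148 / 1000) * sqrt (2 * S) + (41 / 100) * S) * sqrt 3 \<le> (4451 / 10000) * (18 / 10)"
        by (intro mult_mono real_le_lsqrt) (use S in \<open>auto simp: power2_eq_square\<close>)
      moreover have "(4 / 10) \<le> ln ((15 / 10)::real)"
        by (rule ln_ge_by_power[of _ _ 100]) (simp_all add: power_divide)
      moreover have "ln ((15 / 10)::real) = ln 3 - ln 2" using ln_div[of 3 "2::real"] by simp
      ultimately show ?thesis using 2 pi ln_pi_ge by (simp add: algebra_simps)
    next
      case 3
      define x where "x = sqrt (real n)"
      have x: "2 \<le> x" "x \<le> 4" using 3 n unfolding x_def by (auto intro!: real_le_rsqrt real_le_lsqrt)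
      have xn: "real n = x\<^sup>2" by (simp add: x_def)
      have S1: "S \<le> 1" using S by (smt (verit) divide_nonneg_nonneg of_nat_0_le_iff)
      have "sqrt (2 * S) \<le> (14145 / 10000)" using S S1 by (intro real_le_lsqrt) (auto simp: power2_eq_square)
      then have "(148 / 1000) * sqrt (2 * S) + (41 / 100) * S \<le> (6194 / 10000)" using S1 by linarith
      then have le: "((148 / 1000) * sqrt (2 * S) + (41 / 100) * S) * x \<le> (6194 / 10000) * x"
        using x by (intro mult_right_mono) auto
      \<comment> \<open>The chord of the logarithm from \<open>2\<close> to \<open>4\<close>, with
        its concavity supplied by Young's inequality.\<close>
      have "x / 2 * ln 2 \<le> ln x"
      proof -
        define t where "t = (x - 2) / 2"
        have t: "0 \<le> t" "t \<le> 1" "x = 2 * (1 + t)" using x by (auto simp: t_def field_simps)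
        have "2 powr t * 1 powr (1 - t) \<le> t * 2 + (1 - t) * 1"
          by (rule Youngs_inequality_0) (use t in auto)
        then have "ln (2 powr t) \<le> ln (1 + t)" using t by (subst ln_le_cancel_iff) auto
        then have "t * ln 2 \<le> ln (1 + t)" by (simp add: ln_powr)
        moreover have "ln x = ln 2 + ln (1 + t)" unfolding t(3) using t by (subst ln_mult) auto
        ultimately show ?thesis unfolding t(3) by (simp add: algebra_simps)
      qed
      moreover have "ln (real n) = 2 * ln x" using x unfolding xn by (simp add: ln_realpow)
      moreover have "(x - 1) * (69 / 100) \<le> (x - 1) * ln 2" using x ln_two_ge by (intro mult_left_mono) auto
      moreover have "(x - 1) * ln 2 = x * ln 2 - ln 2" "x / 2 * ln 2 = x * ln 2 / 2"
        by (simp_all add: algebra_simps)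
      moreover have "148 / 1000 * sqrt (2 * S) * x + 41 / 100 * S * x \<le> 6194 / 10000 * x"
        using le by (simp only: distrib_right)
      ultimately show ?thesis using x ln_pi_ge unfolding pi x_def[symmetric] by argo
    qed
  qed
  then have "exp (ln 2 + ((148 / 1000) * sqrt (2 * S) * sqrt n + (41 / 100) * S * sqrt n)) \<le> sqrt pi * real n"
    by (intro exp_le_by_ln) (use n in auto)
  then show ?thesis by (simp add: exp_add)
qed

text \<open>Here the tilt costs only a multiple of \<open>sqrt n\<close>, and
  \<open>43 / 10000\<close> of the exponential rate pays for the factor
  \<open>exp (O (sqrt n))\<close>.\<close>

lemma large_dim_bound:
  assumes n: "16 \<le> n" and S: "0 \<le> S" "S \<le> 1"
  shows "2 * exp ((148 / 1000) * sqrt (2 * S) * sqrt n) * (exp 1 * ((41 / 100) * sqrt n)) * exp (- (43 / 10000) * n) \<le> sqrt pi * real n"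
proof -
  define x where "x = sqrt (real n)"
  have x: "4 \<le> x" using n unfolding x_def by (auto intro!: real_le_rsqrt)
  have xn: "real n = x\<^sup>2" by (simp add: x_def)
  have "sqrt (2 * S) \<le> (14145 / 10000)" using S by (intro real_le_lsqrt) (auto simp: power2_eq_square)
  then have "(148 / 1000) * sqrt (2 * S) * x \<le> (2094 / 10000) * x" using x by (intro mult_right_mono) auto
  moreover have "ln ((82 / 100)::real) \<le> (82 / 100) - 1" by (rule ln_le_minus_one) simp
  \<comment> \<open>One \<open>ln x\<close> has been cancelled:
    \<open>255 / 1000 = 1 - 18 / 100 - 113 / 200\<close>, and \<open>2094 / 10000\<close> rounds up
    \<open>148 / 1000 * sqrt 2\<close>.\<close>
  moreover have "(255 / 1000) + (2094 / 10000) * x - (43 / 10000) * x\<^sup>2 \<le> ln x"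
  proof (cases "x \<le> 12")
    case True
    have "ln (8 / x) \<le> 8 / x - 1" by (rule ln_le_minus_one) (use x in simp)
    moreover have "ln (8 / x) = 3 * ln 2 - ln x"
      using x ln_realpow[of 2 3] by (simp add: ln_div)
    ultimately have *: "(307 / 100) - 8 / x \<le> ln x" using ln_two_ge by linarith
    \<comment> \<open>After multiplication by \<open>x\<close> a cubic must be nonnegative. Lowering
      its constant term from \<open>- 8\<close> to \<open>- 8.1848\<close> makes \<open>4\<close> a
      root, and this square shows that the remaining quadratic is nonnegative for
      \<open>x \<le> 12\<close>.\<close>
    have "0 \<le> (x - 12)\<^sup>2" by simp
    then have "24 * x - 144 \<le> x\<^sup>2" by (simp add: power2_eq_square algebra_simps)
    then have "0 \<le> (43 / 10000) * x\<^sup>2 - (1922 / 10000) * x + (20462 / 10000)" using True by linarith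
    then have "0 \<le> (x - 4) * ((43 / 10000) * x\<^sup>2 - (1922 / 10000) * x + (20462 / 10000))" using x by simp
    moreover have "(x - 4) * ((43 / 10000) * x\<^sup>2 - (1922 / 10000) * x + (20462 / 10000)) = 43 / 10000 * x ^ 3 - 2094 / 10000 * x\<^sup>2 + 2815 / 1000 * x - 81848 / 10000"
      by (simp add: field_simps power2_eq_square power3_eq_cube)
    moreover have "x * ((255 / 1000) + (2094 / 10000) * x - (43 / 10000) * x\<^sup>2) = 255 / 1000 * x + 2094 / 10000 * x\<^sup>2 - 43 / 10000 * x ^ 3"
      by (simp add: field_simps power2_eq_square power3_eq_cube)
    moreover have "x * ((307 / 100) - 8 / x) = 307 / 100 * x - 8" using x by (simp add: right_diff_distrib)
    ultimately have "x * ((255 / 1000) + (2094 / 10000) * x - (43 / 10000) * x\<^sup>2) \<le> x * ((307 / 100) - 8 / x)"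
      using x by linarith
    then have "(255 / 1000) + (2094 / 10000) * x - (43 / 10000) * x\<^sup>2 \<le> (307 / 100) - 8 / x" using x by (simp only: mult_le_cancel_left_pos)
    with * show ?thesis by linarith
  next
    case False
    have "ln (16 / x) \<le> 16 / x - 1" by (rule ln_le_minus_one) (use x in simp)
    moreover have "ln (16 / x) = 4 * ln 2 - ln x"
      using x ln_realpow[of 2 4] by (simp add: ln_div)
    ultimately have *: "(376 / 100) - 16 / x \<le> ln x" using ln_two_ge by linarith
    \<comment> \<open>The same device with root \<open>12\<close> and constant term
      \<open>- 19.3368\<close> instead of \<open>- 16\<close>; \<open>18.35\<close> is near the
      vertex of the quadratic.\<close>
    have "0 \<le> (x - (1835 / 100))\<^sup>2" by simp
    then have "(367 / 10) * x - (3367225 / 10000) \<le> x\<^sup>2" by (simp add: power2_eq_square algebra_simps)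
    then have "0 \<le> (43 / 10000) * x\<^sup>2 - (1578 / 10000) * x + (16114 / 10000)" using False by linarith
    then have "0 \<le> (x - 12) * ((43 / 10000) * x\<^sup>2 - (1578 / 10000) * x + (16114 / 10000))" using False by simp
    moreover have "(x - 12) * ((43 / 10000) * x\<^sup>2 - (1578 / 10000) * x + (16114 / 10000)) = 43 / 10000 * x ^ 3 - 2094 / 10000 * x\<^sup>2 + 3505 / 1000 * x - 193368 / 10000"
      by (simp add: field_simps power2_eq_square power3_eq_cube)
    moreover have "x * ((255 / 1000) + (2094 / 10000) * x - (43 / 10000) * x\<^sup>2) = 255 / 1000 * x + 2094 / 10000 * x\<^sup>2 - 43 / 10000 * x ^ 3"
      by (simp add: field_simps power2_eq_square power3_eq_cube)
    moreover have "x * ((376 / 100) - 16 / x) = 376 / 100 * x - 16" using x by (simp add: right_diff_distrib)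
    ultimately have "x * ((255 / 1000) + (2094 / 10000) * x - (43 / 10000) * x\<^sup>2) \<le> x * ((376 / 100) - 16 / x)"
      using x by linarith
    then have "(255 / 1000) + (2094 / 10000) * x - (43 / 10000) * x\<^sup>2 \<le> (376 / 100) - 16 / x" using x by (simp only: mult_le_cancel_left_pos)
    with * show ?thesis by linarith
  qed
  ultimately have "ln (82 / 100) + (148 / 1000) * sqrt (2 * S) * x + 1 + ln x - (43 / 10000) * x\<^sup>2 \<le> ln pi / 2 + 2 * ln x"
    using ln_pi_ge by linarith
  also have "\<dots> = ln (sqrt pi * real n)"
    using x unfolding xn by (simp add: ln_mult ln_sqrt ln_realpow)
  finally have "exp (ln (82 / 100) + (148 / 1000) * sqrt (2 * S) * x + 1 + ln x - (43 / 10000) * x\<^sup>2) \<le> sqrt pi * real n"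
    by (intro exp_le_by_ln) (use n in auto)
  moreover have "exp (ln (82 / 100) + (148 / 1000) * sqrt (2 * S) * x + 1 + ln x - (43 / 10000) * x\<^sup>2)
     = (82 / 100) * exp ((148 / 1000) * sqrt (2 * S) * x) * exp 1 * x * exp (- (43 / 10000) * real n)"
  proof -
    have "exp (a + b + 1 + c - d) = exp a * exp b * exp 1 * exp c * exp (- d)" for a b c d :: real
      by (simp flip: exp_add)
    then show ?thesis using x by (simp add: xn)
  qed
  ultimately show ?thesis unfolding x_def by (simp add: mult_ac)
qed

section \<open>Exponential decay\<close>

lemma gauss_ball_mono: "0 < s \<Longrightarrow> s \<le> t \<Longrightarrow> gauss_ball n s \<le> gauss_ball n t"
proof -
  assume *: "0 < s" "s \<le> t"
  then have "0 \<le> exp (- pi * t\<^sup>2) * (unit_ball_vol n * t ^ n - unit_ball_vol n * s ^ n)"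
    by (simp add: power_mono mult_left_mono)
  with gauss_ball_diff(2)[OF *, of n] show ?thesis by linarith
qed

text \<open>\<open>J\<close> leaves open which lower bound for the tilted integral is used, the
  exponential one or the inverse one.\<close>

lemma gauss_shift_ge:
  assumes n: "0 < n" and \<xi>: "norm_dim n \<xi> = 1" and R: "R > 0" and \<rho>: "\<rho> > 0" and a: "a \<le> R"
    and b: "b > 0" "b\<^sup>2 + (R - a)\<^sup>2 = \<rho>\<^sup>2" and J: "0 \<le> J" "ennreal (J * gauss_ball n b) \<le> gauss_cut n b (2 * pi * \<bar>a\<bar>)"
  shows "exp (- pi * a\<^sup>2) / 2 * (J * gauss_ball n b) \<le> gauss_shift n \<xi> R \<rho>"
proof -
  have "ennreal (exp (- pi * a\<^sup>2) / 2 * (J * gauss_ball n b)) = ennreal (exp (- pi * a\<^sup>2) / 2) * ennreal (J * gauss_ball n b)"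
    using J by (intro ennreal_mult) auto
  also have "\<dots> \<le> ennreal (exp (- pi * a\<^sup>2) / 2) * gauss_cut n b (2 * pi * \<bar>a\<bar>)"
    by (rule mult_left_mono[OF J(2)]) simp
  also have "\<dots> \<le> ennreal (gauss_shift n \<xi> R \<rho>)"
    unfolding emeasure_gauss_shift[OF \<xi> R \<rho>, symmetric]
    by (rule emeasure_gauss_ball_shift_ge[OF n \<xi> \<rho> a b])
  finally show ?thesis by simp
qed

text \<open>The ratio of the centred balls is at most \<open>1\<close>, so lowering its exponent
  enlarges the product. With \<open>s = 3 / 64\<close> the bounds that follow are free of
  \<open>p\<close>.\<close>

lemma T_ratio_le_exponent:
  assumes \<xi>: "norm_dim n \<xi> = 1" and "0 < r" "r < R" and s: "s \<le> (p - 1) / p"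
  shows "T_ratio n (gauss_measure n) p \<xi> R r
    \<le> gauss_ball n R / gauss_shift n \<xi> R (R + r) * (gauss_ball n r / gauss_ball n R) powr s"
  unfolding T_ratio_gauss
proof (rule mult_left_mono)
  have "gauss_ball n r \<le> gauss_ball n R" using assms by (intro gauss_ball_mono) auto
  moreover have "gauss_ball n r > 0" "gauss_ball n R > 0" using assms by (auto intro: gauss_ball_pos)
  ultimately show "(gauss_ball n r / gauss_ball n R) powr ((p - 1) / p) \<le> (gauss_ball n r / gauss_ball n R) powr s"
    by (intro powr_mono' s) (auto simp: divide_le_eq)
qed simp

lemma gauss_ball_ratio_powr_le:
  assumes "0 < r" "r < R"
  shows "(gauss_ball n r / gauss_ball n R) powr (3 / 64)
    \<le> exp (3 / 64 * (real n * ln (r / R) + pi * (1 - (r / R)\<^sup>2) * R\<^sup>2))"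
proof -
  define l where "l = r / R"
  have l: "0 < l" "l \<le> 1" and R: "R > 0" "r = l * R" using assms by (auto simp: l_def)
  have pos: "gauss_ball n R > 0" "gauss_ball n r > 0" using assms by (auto intro: gauss_ball_pos)
  have "gauss_ball n r / gauss_ball n R \<le> l ^ n * exp (pi * (1 - l\<^sup>2) * R\<^sup>2)"
    using gauss_ball_scale(2)[OF l R(1), of n] pos by (simp add: R(2) divide_le_eq)
  also have "\<dots> = exp (real n * ln l + pi * (1 - l\<^sup>2) * R\<^sup>2)"
    using l by (simp add: exp_add exp_of_nat_mult)
  finally have "(gauss_ball n r / gauss_ball n R) powr (3 / 64) \<le> exp (real n * ln l + pi * (1 - l\<^sup>2) * R\<^sup>2) powr (3 / 64)"
    using pos by (intro powr_mono2) auto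
  then show ?thesis by (simp add: powr_def l_def)
qed

text \<open>In the collected exponent the terms in \<open>R^2\<close> cancel by the choice of
  \<open>shift_frac\<close>, and the terms in \<open>n\<close> form the rate. There remain the
  correction \<open>2 * sqrt pi * R * (1 - k)\<close>, with \<open>1 - k \<le> 148 / 1000\<close>,
  and the cost \<open>1 / J\<close> of the tilt.\<close>

lemma T_ratio_near_le:
  assumes n: "0 < n" and \<xi>: "norm_dim n \<xi> = 1" and r: "0 < r" "r < R" and s: "3 / 64 \<le> (p - 1) / p"
    and l: "r / R \<le> 41425 / 100000" and S: "S = 2 * pi * R\<^sup>2 / real n" "S \<le> 1"
    and k: "k = sqrt (cut_radius_sq (r / R))" and a: "a = R * (1 - shift_frac (r / R))"
    and J: "0 < J" "ennreal (J * gauss_ball n (k * R)) \<le> gauss_cut n (k * R) (2 * pi * \<bar>a\<bar>)"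
  shows "T_ratio n (gauss_measure n) p \<xi> R r \<le> 2 * exp (148 / 1000 * sqrt (2 * S) * sqrt n) * exp (- (44 / 10000) * real n) / J"
proof -
  define l where "l = r / R"
  have R: "R > 0" "r = l * R" and l: "0 < l" "l \<le> 41425 / 100000" using r l by (auto simp: l_def)
  define v where "v = shift_frac l"
  have v: "v \<ge> 0" unfolding v_def shift_frac_poly using l by simp
  note kb = cut_radius_sq_bounds[OF less_imp_le[OF l(1)] l(2)]
  have k2: "k\<^sup>2 = cut_radius_sq l" using kb by (simp add: k l_def)
  have k_ge: "852 / 1000 \<le> k" unfolding k l_def[symmetric] using kb by (intro real_le_rsqrt) (simp add: power2_eq_square)
  have k_le: "k \<le> 1" unfolding k l_def[symmetric] using kb by simp
  have k0: "k > 0" using k_ge by simp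
  define m0 m1 m2 mb where "m0 = gauss_ball n r" and "m1 = gauss_ball n R" and "m2 = gauss_shift n \<xi> R (R + r)"
    and "mb = gauss_ball n (k * R)"
  have m: "m1 > 0" "mb > 0" using R k0 by (simp_all add: m1_def mb_def gauss_ball_pos)
  have m_diff: "m1 \<le> exp (X - c) * mb" if "exp c * m1 \<le> exp X * mb" for X c
    using that by (simp add: exp_diff field_simps)
  have "S * real n = 2 * pi * R\<^sup>2" using n S by simp
  then have "2 * pi * R\<^sup>2 \<le> real n + 1" using S n mult_right_mono[of S 1 "real n"] by simp
  from gauss_ball_ratio_le[OF n R(1) this k0 k_le]
  have "exp (real n * ln k) * m1 \<le> exp (- pi * R\<^sup>2 * (1 - k\<^sup>2) + 2 * sqrt pi * R * (1 - k)) * mb"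
    using k0 by (simp add: m1_def mb_def exp_of_nat_mult)
  then have m1: "m1 \<le> exp (- pi * R\<^sup>2 * (1 - k\<^sup>2) + 2 * sqrt pi * R * (1 - k) - real n * ln k) * mb"
    using m_diff by blast
  have m2: "exp (- pi * a\<^sup>2) / 2 * (J * mb) \<le> m2"
    unfolding m2_def mb_def
  proof (rule gauss_shift_ge[OF n \<xi> R(1) _ _ _ _ _ J(2)])
    show "(k * R)\<^sup>2 + (R - a)\<^sup>2 = (R + r)\<^sup>2"
    proof -
      have "(k * R)\<^sup>2 + (R - a)\<^sup>2 = R\<^sup>2 * (k\<^sup>2 + v\<^sup>2)"
        by (simp add: a l_def[symmetric] v_def[symmetric] power2_eq_square algebra_simps)
      also have "k\<^sup>2 + v\<^sup>2 = (1 + l)\<^sup>2" by (simp add: k2 cut_radius_sq_def v_def)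
      finally show ?thesis by (simp add: R(2) power2_eq_square algebra_simps)
    qed
    show "a \<le> R" using v R by (simp add: a l_def[symmetric] v_def[symmetric])
  qed (use r R(1) k0 J(1) in auto)
  have m2_pos: "0 < exp (- pi * a\<^sup>2) / 2 * (J * mb)" using J m by simp
  have "m1 / m2 \<le> (exp (- pi * R\<^sup>2 * (1 - k\<^sup>2) + 2 * sqrt pi * R * (1 - k) - real n * ln k) * mb) / (exp (- pi * a\<^sup>2) / 2 * (J * mb))"
    using m1 m2 m2_pos m by (intro frac_le) auto
  also have "\<dots> = 2 * exp (- pi * R\<^sup>2 * (1 - k\<^sup>2) + 2 * sqrt pi * R * (1 - k) - real n * ln k + pi * a\<^sup>2) / J"
  proof -
    have "(exp X * mb) / (exp (- c) / 2 * (J * mb)) = 2 * exp (X + c) / J" for X c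
      using m J by (simp add: exp_add exp_minus field_simps)
    from this[of _ "pi * a\<^sup>2"] show ?thesis by simp
  qed
  finally have q1: "m1 / m2 \<le> 2 * exp (- pi * R\<^sup>2 * (1 - k\<^sup>2) + 2 * sqrt pi * R * (1 - k) - real n * ln k + pi * a\<^sup>2) / J" .
  have q2: "(m0 / m1) powr (3 / 64) \<le> exp (3 / 64 * (real n * ln l + pi * (1 - l\<^sup>2) * R\<^sup>2))"
    unfolding m0_def m1_def l_def by (rule gauss_ball_ratio_powr_le[OF r])
  have "T_ratio n (gauss_measure n) p \<xi> R r \<le> m1 / m2 * (m0 / m1) powr (3 / 64)"
    unfolding m0_def m1_def m2_def by (rule T_ratio_le_exponent[OF \<xi> r s])
  also have "\<dots> \<le> 2 * exp (- pi * R\<^sup>2 * (1 - k\<^sup>2) + 2 * sqrt pi * R * (1 - k) - real n * ln k + pi * a\<^sup>2) / J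
      * exp (3 / 64 * (real n * ln l + pi * (1 - l\<^sup>2) * R\<^sup>2))"
    using q1 q2 J by (intro mult_mono) auto
  also have "\<dots> = 2 * exp ((- pi * R\<^sup>2 * (1 - k\<^sup>2) + 2 * sqrt pi * R * (1 - k) - real n * ln k + pi * a\<^sup>2)
      + 3 / 64 * (real n * ln l + pi * (1 - l\<^sup>2) * R\<^sup>2)) / J"
    unfolding exp_add[of _ "3 / 64 * _"] by simp
  also have "(- pi * R\<^sup>2 * (1 - k\<^sup>2) + 2 * sqrt pi * R * (1 - k) - real n * ln k + pi * a\<^sup>2)
      + 3 / 64 * (real n * ln l + pi * (1 - l\<^sup>2) * R\<^sup>2)
    = real n * (3 / 64 * ln l - ln k) + 2 * sqrt pi * R * (1 - k) + pi * R\<^sup>2 * (k\<^sup>2 + (1 - v)\<^sup>2 - 1 + 3 / 64 * (1 - l\<^sup>2))"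
    unfolding a l_def[symmetric] v_def[symmetric] by (simp add: power2_eq_square field_simps)
  also have "k\<^sup>2 + (1 - v)\<^sup>2 - 1 + 3 / 64 * (1 - l\<^sup>2) = 0"
  proof -
    have "k\<^sup>2 + (1 - v)\<^sup>2 - 1 = (1 + l)\<^sup>2 - 2 * v" unfolding k2 cut_radius_sq_def v_def[symmetric]
      by (simp add: power2_eq_square algebra_simps)
    moreover have "2 * v = (1 + l)\<^sup>2 + 3 / 64 * (1 - l\<^sup>2)" by (simp add: v_def shift_frac_def)
    ultimately show ?thesis by linarith
  qed
  also have "2 * exp (real n * (3 / 64 * ln l - ln k) + 2 * sqrt pi * R * (1 - k) + pi * R\<^sup>2 * 0) / J
    \<le> 2 * exp (- (44 / 10000) * real n + 148 / 1000 * sqrt (2 * S) * sqrt n) / J"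
  proof -
    have "ln k = ln (cut_radius_sq l) / 2" using kb by (simp add: k l_def[symmetric] ln_sqrt)
    then have "real n * (3 / 64 * ln l - ln k) \<le> real n * (- (44 / 10000))"
      using rate_le[OF l] by (intro mult_left_mono) auto
    moreover have "2 * sqrt pi * R * (1 - k) \<le> 148 / 1000 * sqrt (2 * S) * sqrt n"
    proof -
      have "2 * sqrt pi * R = sqrt (2 * S) * sqrt n"
        using R n by (simp add: S real_sqrt_mult real_sqrt_divide)
      moreover have "(sqrt (2 * S) * sqrt n) * (1 - k) \<le> (sqrt (2 * S) * sqrt n) * (148 / 1000)"
        using k_ge S by (intro mult_left_mono mult_nonneg_nonneg) auto
      ultimately show ?thesis by (simp add: mult_ac)
    qed
    ultimately show ?thesis using J by (intro divide_right_mono mult_left_mono) auto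
  qed
  also have "\<dots> = 2 * exp (148 / 1000 * sqrt (2 * S) * sqrt n) * exp (- (44 / 10000) * real n) / J"
    unfolding exp_add by simp
  finally show ?thesis .
qed

text \<open>Up to dimension \<open>16\<close> the tilt stays in exponential form and is paid by the
  prefactor. Beyond that, \<open>gauss_cut_ge_inverse\<close> limits it to a multiple of
  \<open>sqrt n\<close>. Of the rate \<open>44 / 10000\<close> the last \<open>1 / 10000\<close> is
  kept as the final decay.\<close>

lemma T_ratio_near:
  assumes n: "2 \<le> n" and \<xi>: "norm_dim n \<xi> = 1" and r: "0 < r" "r < R" and s: "3 / 64 \<le> (p - 1) / p"
    and l: "r / R \<le> 41425 / 100000" and Rn: "2 * pi * R\<^sup>2 \<le> real n - 1"
  shows "T_ratio n (gauss_measure n) p \<xi> R r \<le> sqrt pi * real n * exp (- (1 / 10000)) ^ n"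
proof -
  define S where "S = 2 * pi * R\<^sup>2 / real n"
  have R: "R > 0" using r by simp
  have n0: "0 < n" using n by simp
  have "S \<le> (real n - 1) / real n" unfolding S_def using Rn n by (intro divide_right_mono) auto
  then have S: "0 \<le> S" "S \<le> 1 - 1 / real n" using n by (auto simp: S_def diff_divide_distrib)
  then have S1: "S \<le> 1" using n by (smt (verit) divide_nonneg_nonneg of_nat_0_le_iff)
  define lam where "lam = r / R"
  have lam: "0 < lam" "lam \<le> 41425 / 100000" using r l by (auto simp: lam_def)
  define k where "k = sqrt (cut_radius_sq lam)"
  define a where "a = R * (1 - shift_frac lam)"
  have k0: "k > 0" using cut_radius_sq_bounds[of lam] lam by (simp add: k_def)
  define y where "y = 2 * pi * \<bar>a\<bar> * (k * R) / sqrt n"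
  have y0: "y \<ge> 0" using k0 R by (simp add: y_def)
  have y: "y \<le> 41 / 100 * S * sqrt n"
  proof -
    have "2 * pi * R\<^sup>2 / sqrt n = S * sqrt n"
      using n by (simp add: S_def field_simps)
    moreover have "y = 2 * pi * R\<^sup>2 / sqrt n * (\<bar>1 - shift_frac lam\<bar> * k)"
      using R by (simp add: y_def a_def abs_mult power2_eq_square)
    ultimately have "y = S * sqrt n * (\<bar>1 - shift_frac lam\<bar> * k)" by simp
    also have "\<dots> \<le> S * sqrt n * (41 / 100)"
      using shift_frac_cut_le[of lam] lam S unfolding k_def by (intro mult_left_mono) auto
    finally show ?thesis by (simp add: mult_ac)
  qed
  note near = T_ratio_near_le[OF n0 \<xi> r s l S_def S1 k_def[unfolded lam_def] a_def[unfolded lam_def]]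
  have e1: "ennreal (exp (- y) * gauss_ball n (k * R)) \<le> gauss_cut n (k * R) (2 * pi * \<bar>a\<bar>)"
    unfolding y_def by (rule gauss_cut_ge_exp) (use n k0 R in auto)
  define A where "A = 2 * exp (148 / 1000 * sqrt (2 * S) * sqrt n)"
  have A: "A > 0" by (simp add: A_def)
  have pw: "exp (- (1 / 10000)) ^ n = exp (- (1 / 10000) * real n)" by (simp add: mult.commute flip: exp_of_nat_mult)
  show ?thesis
  proof (cases "n \<le> 16")
    case True
    have "T_ratio n (gauss_measure n) p \<xi> R r \<le> A * exp (- (44 / 10000) * real n) / exp (- y)"
      unfolding A_def by (rule near[OF _ e1]) simp
    also have "\<dots> = A * exp y * exp (- (44 / 10000) * real n)" by (simp add: exp_minus field_simps)
    also have "\<dots> \<le> A * exp (41 / 100 * S * sqrt n) * exp (- (1 / 10000) * real n)"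
      using y A by (intro mult_mono) auto
    also have "A * exp (41 / 100 * S * sqrt n) = 2 * exp (148 / 1000 * sqrt (2 * S) * sqrt n + 41 / 100 * S * sqrt n)"
      by (simp add: A_def exp_add)
    also have "\<dots> * exp (- (1 / 10000) * real n) \<le> sqrt pi * real n * exp (- (1 / 10000) * real n)"
      by (rule mult_right_mono[OF small_dim_bound[OF n True S]]) simp
    finally show ?thesis by (simp only: pw)
  next
    case False
    then have n16: "16 \<le> n" by simp
    have sq: "4 \<le> sqrt n" using n16 by (intro real_le_rsqrt) auto
    obtain J where J: "0 < J" "ennreal (J * gauss_ball n (k * R)) \<le> gauss_cut n (k * R) (2 * pi * \<bar>a\<bar>)"
      "1 / J \<le> exp 1 * (41 / 100 * sqrt n)"
    proof (cases "y \<ge> 1")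
      case True
      have "ennreal (exp (- 1) / y * gauss_ball n (k * R)) \<le> gauss_cut n (k * R) (2 * pi * \<bar>a\<bar>)"
        unfolding y_def by (rule gauss_cut_ge_inverse) (use n k0 R True in \<open>auto simp: y_def\<close>)
      moreover have "y \<le> 41 / 100 * sqrt n"
      proof -
        have "S * sqrt n \<le> 1 * sqrt n" using S1 by (intro mult_right_mono) auto
        then show ?thesis using y by simp
      qed
      then have "1 / (exp (- 1) / y) \<le> exp 1 * (41 / 100 * sqrt n)"
        using True by (simp add: exp_minus field_simps)
      moreover have "0 < exp (- 1) / y" using True by simp
      ultimately show ?thesis using that by blast
    next
      case False
      have "1 / exp (- y) = exp y * 1" by (simp add: exp_minus field_simps)
      \<comment> \<open>Here \<open>y < 1\<close>, and \<open>41 / 100 * sqrt n \<ge> 1\<close>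
        because \<open>n \<ge> 16\<close>.\<close>
      also have "\<dots> \<le> exp 1 * (41 / 100 * sqrt n)" using False sq by (intro mult_mono) auto
      finally show ?thesis using that[of "exp (- y)"] e1 by simp
    qed
    have "T_ratio n (gauss_measure n) p \<xi> R r \<le> A * exp (- (44 / 10000) * real n) / J"
      unfolding A_def by (rule near[OF J(1,2)])
    also have "\<dots> = A * exp (- (44 / 10000) * real n) * (1 / J)" by simp
    also have "\<dots> \<le> A * exp (- (44 / 10000) * real n) * (exp 1 * (41 / 100 * sqrt n))"
      using J(3) A by (intro mult_left_mono) auto
    also have "- (44 / 10000) * real n = - (43 / 10000) * real n + - (1 / 10000) * real n" by simp
    also have "A * exp (- (43 / 10000) * real n + - (1 / 10000) * real n) * (exp 1 * (41 / 100 * sqrt n))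
      = A * (exp 1 * (41 / 100 * sqrt n)) * exp (- (43 / 10000) * real n) * exp (- (1 / 10000) * real n)"
      unfolding exp_add by simp
    also have "\<dots> \<le> sqrt pi * real n * exp (- (1 / 10000) * real n)"
      unfolding A_def by (rule mult_right_mono[OF large_dim_bound[OF n16 S(1) S1]]) simp
    finally show ?thesis by (simp only: pw)
  qed
qed

text \<open>The half ball is centred at the origin, so there is no tilt. If
  \<open>r \<le> e * R\<close>, the power of the ratio of centred balls decays. If
  \<open>r > e * R\<close>, the bound on \<open>r\<close> keeps \<open>R\<close> itself away from
  the critical scale and the first factor decays. Both cases lead to the base
  \<open>e * exp ((1 - e^2) / 2)\<close>.\<close>

lemma T_ratio_far:
  assumes n: "0 < n" and \<xi>: "norm_dim n \<xi> = 1" and r: "0 < r" "r < R" and s: "3 / 64 \<le> (p - 1) / p"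
    and l: "sqrt 2 - 1 \<le> r / R" and Rn: "2 * pi * R\<^sup>2 \<le> real n" and e: "4 / 5 \<le> e" "e < 1"
    and re: "2 * pi * r\<^sup>2 \<le> e ^ 4 * real n"
  shows "T_ratio n (gauss_measure n) p \<xi> R r \<le> 2 * ((e * exp ((1 - e\<^sup>2) / 2)) powr (3 / 64)) ^ n"
proof -
  have R: "R > 0" using r by simp
  define g where "g = ln e + (1 - e\<^sup>2) / 2"
  have eg: "e * exp ((1 - e\<^sup>2) / 2) = exp g" using e by (simp add: g_def exp_add)
  have "g \<le> 0"
  proof -
    have "ln e \<le> e - 1" using e by (intro ln_le_minus_one) auto
    moreover have "0 \<le> (1 - e)\<^sup>2" by simp
    then have "2 * e - 1 \<le> e\<^sup>2" by (simp add: power2_eq_square algebra_simps)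
    ultimately show ?thesis unfolding g_def by (simp add: field_simps)
  qed
  have rhs: "(exp g powr (3 / 64)) ^ n = exp (3 / 64 * (real n * g))"
    by (simp add: powr_def mult_ac flip: exp_of_nat_mult)
  define b where "b = sqrt (2 * R * r + r\<^sup>2)"
  have b2: "b\<^sup>2 = 2 * R * r + r\<^sup>2" using R r by (simp add: b_def)
  have b0: "b > 0" using R r by (simp add: b_def add_pos_pos)
  define m0 m1 m2 where "m0 = gauss_ball n r" and "m1 = gauss_ball n R" and "m2 = gauss_shift n \<xi> R (R + r)"
  have m: "m0 > 0" "m1 > 0" "m0 \<le> m1" using R r by (simp_all add: m0_def m1_def gauss_ball_pos gauss_ball_mono)
  have mb: "gauss_ball n b > 0" using b0 by (rule gauss_ball_pos)
  have "exp (- pi * 0\<^sup>2) / 2 * (1 * gauss_ball n b) \<le> m2"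
    unfolding m2_def
  proof (rule gauss_shift_ge[OF n \<xi> R])
    show "b\<^sup>2 + (R - 0)\<^sup>2 = (R + r)\<^sup>2" unfolding b2 by (simp add: power2_eq_square algebra_simps)
    show "ennreal (1 * gauss_ball n b) \<le> gauss_cut n b (2 * pi * \<bar>0\<bar>)"
      using gauss_cut_ge_exp[OF n b0, of 0] by simp
  qed (use R r b0 in auto)
  then have m2: "gauss_ball n b / 2 \<le> m2" by simp
  then have "m1 / m2 \<le> m1 / (gauss_ball n b / 2)" using m mb by (intro divide_left_mono mult_pos_pos) auto
  then have q: "m1 / m2 \<le> 2 * (m1 / gauss_ball n b)" by (simp add: mult.commute)
  have T: "T_ratio n (gauss_measure n) p \<xi> R r \<le> m1 / m2 * (m0 / m1) powr (3 / 64)"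
    unfolding m0_def m1_def m2_def by (rule T_ratio_le_exponent[OF \<xi> r s])
  show ?thesis unfolding eg rhs
  proof (cases "r \<le> e * R")
    case True
    define l where "l = r / R"
    have l': "0 < l" "l \<le> e" using True R r by (auto simp: l_def field_simps)
    \<comment> \<open>\<open>b \<ge> R\<close> is equivalent to \<open>(1 + l)^2 \<ge> 2\<close>,
      the origin of the threshold \<open>sqrt 2 - 1\<close>.\<close>
    have "R \<le> b"
    proof (rule power2_le_imp_le)
      have "(sqrt 2)\<^sup>2 \<le> (1 + l)\<^sup>2" using l by (intro power_mono) (auto simp: l_def)
      then have "1 \<le> 2 * l + l\<^sup>2" by (simp add: power2_eq_square algebra_simps)
      then have "R\<^sup>2 * 1 \<le> R\<^sup>2 * (2 * l + l\<^sup>2)" by (intro mult_left_mono) auto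
      also have "\<dots> = b\<^sup>2" unfolding b2 l_def using R by (simp add: power2_eq_square field_simps)
      finally show "R\<^sup>2 \<le> b\<^sup>2" by simp
    qed (use b0 in simp)
    then have "m1 \<le> gauss_ball n b" unfolding m1_def using R by (intro gauss_ball_mono)
    then have "m1 / gauss_ball n b \<le> 1" using mb by simp
    then have q': "m1 / m2 \<le> 2" using q by linarith
    have "real n * ln l + pi * (1 - l\<^sup>2) * R\<^sup>2 \<le> real n * g"
    proof -
      have "pi * R\<^sup>2 \<le> real n / 2" using Rn by simp
      then have "(pi * R\<^sup>2) * (1 - l\<^sup>2) \<le> (real n / 2) * (1 - l\<^sup>2)"
        using l' e by (intro mult_right_mono) (auto simp: power_le_one)
      \<comment> \<open>Monotonicity of \<open>ln t + (1 - t^2) / 2\<close> on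
        \<open>(0, 1]\<close>, between \<open>l\<close> and \<open>e\<close>.\<close>
      moreover have "ln l + (1 - l\<^sup>2) / 2 \<le> g"
      proof -
        have "ln (l / e) \<le> l / e - 1" using l' e by (intro ln_le_minus_one) auto
        then have "ln l - ln e \<le> (l - e) / e" using l' e by (simp add: ln_div diff_divide_distrib)
        also have "(l - e) / e \<le> l - e"
        proof -
          have "(l - e) * (1 - e) \<le> 0" using l' e by (simp add: mult_nonpos_nonneg)
          then have "l - e \<le> (l - e) * e" by (simp add: algebra_simps)
          then show ?thesis using e by (subst pos_divide_le_eq) auto
        qed
        also have "l - e \<le> (l\<^sup>2 - e\<^sup>2) / 2"
        proof -
          have "(l - e) * (2 - (l + e)) \<le> 0" using l' e by (intro mult_nonpos_nonneg) auto
          then show ?thesis by (simp add: power2_eq_square algebra_simps)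
        qed
        finally show ?thesis by (simp add: g_def field_simps)
      qed
      then have "real n * (ln l + (1 - l\<^sup>2) / 2) \<le> real n * g" by (intro mult_left_mono) auto
      ultimately show ?thesis by (simp add: field_simps)
    qed
    then have "exp (3 / 64 * (real n * ln l + pi * (1 - l\<^sup>2) * R\<^sup>2)) \<le> exp (3 / 64 * (real n * g))" by simp
    then have "(m0 / m1) powr (3 / 64) \<le> exp (3 / 64 * (real n * g))"
      using gauss_ball_ratio_powr_le[OF r, of n] unfolding m0_def m1_def l_def by linarith
    then have "m1 / m2 * (m0 / m1) powr (3 / 64) \<le> 2 * exp (3 / 64 * (real n * g))"
      using q' by (intro mult_mono) auto
    with T show "T_ratio n (gauss_measure n) p \<xi> R r \<le> 2 * exp (3 / 64 * (real n * g))" by linarith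
  next
    case False
    \<comment> \<open>\<open>Q\<close> exceeds \<open>R\<close> but is still at most
      \<open>b\<close>. Moreover \<open>r > e * R = e^2 * Q\<close>, so the fourth power in the
      bound on \<open>r\<close> gives \<open>2 * pi * Q^2 \<le> n\<close>.\<close>
    define Q where "Q = R / e"
    have Q: "Q > 0" "R = e * Q" using R e by (auto simp: Q_def)
    have "Q \<le> b"
    proof (rule power2_le_imp_le)
      have "1 \<le> 2 * e ^ 3 + e ^ 4"
      proof -
        have "(4 / 5) ^ 3 \<le> e ^ 3" "(4 / 5) ^ 4 \<le> e ^ 4" using e by (auto intro!: power_mono)
        then show ?thesis by (simp add: power_divide)
      qed
      then have "Q\<^sup>2 * 1 \<le> Q\<^sup>2 * (2 * e ^ 3 + e ^ 4)" by (intro mult_left_mono) auto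
      also have "\<dots> = 2 * R * (e * R) + (e * R)\<^sup>2" by (simp add: Q(2) power2_eq_square power3_eq_cube power4_eq_xxxx algebra_simps)
      also have "\<dots> \<le> b\<^sup>2" unfolding b2 using False R e by (intro add_mono mult_left_mono power_mono) auto
      finally show "Q\<^sup>2 \<le> b\<^sup>2" by simp
    qed (use b0 in simp)
    then have "gauss_ball n Q \<le> gauss_ball n b" using Q by (intro gauss_ball_mono)
    moreover have "gauss_ball n Q > 0" using Q by (intro gauss_ball_pos)
    moreover have "m1 \<le> e ^ n * exp (pi * (1 - e\<^sup>2) * Q\<^sup>2) * gauss_ball n Q"
      using gauss_ball_scale(2)[of e Q n] e Q unfolding m1_def by simp
    ultimately have "m1 / gauss_ball n b \<le> (e ^ n * exp (pi * (1 - e\<^sup>2) * Q\<^sup>2) * gauss_ball n Q) / gauss_ball n Q"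
      using m by (intro frac_le) auto
    also have "\<dots> = exp (real n * ln e + pi * (1 - e\<^sup>2) * Q\<^sup>2)"
      using e \<open>gauss_ball n Q > 0\<close> by (simp add: exp_add exp_of_nat_mult)
    also have "\<dots> \<le> exp (real n * g)"
    proof -
      have "2 * pi * Q\<^sup>2 \<le> real n"
      proof -
        have "(e * R)\<^sup>2 \<le> r\<^sup>2" using False R e by (intro power_mono) auto
        then have "2 * pi * (e * R)\<^sup>2 \<le> 2 * pi * r\<^sup>2" by (intro mult_left_mono) auto
        moreover have "2 * pi * (e * R)\<^sup>2 = e ^ 4 * (2 * pi * Q\<^sup>2)"
          by (simp add: Q(2) power2_eq_square power4_eq_xxxx)
        ultimately have "e ^ 4 * (2 * pi * Q\<^sup>2) \<le> e ^ 4 * real n" using re by linarith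
        then show ?thesis using e by (simp add: mult_le_cancel_left)
      qed
      then have "(pi * Q\<^sup>2) * (1 - e\<^sup>2) \<le> (real n / 2) * (1 - e\<^sup>2)"
        using e by (intro mult_right_mono) (auto simp: power_le_one)
      then show ?thesis by (simp add: g_def field_simps)
    qed
    also have "\<dots> \<le> exp (3 / 64 * (real n * g))"
    proof -
      have "real n * g \<le> 0" using \<open>g \<le> 0\<close> by (simp add: mult_nonneg_nonpos)
      then have "real n * g \<le> 3 / 64 * (real n * g)" by linarith
      then show ?thesis by (subst exp_le_cancel_iff)
    qed
    finally have "m1 / m2 \<le> 2 * exp (3 / 64 * (real n * g))" using q by linarith
    moreover have "(m0 / m1) powr (3 / 64) \<le> 1" using m by (intro powr_le1) auto
    ultimately have "m1 / m2 * (m0 / m1) powr (3 / 64) \<le> 2 * exp (3 / 64 * (real n * g)) * 1"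
      by (intro mult_mono) auto
    with T show "T_ratio n (gauss_measure n) p \<xi> R r \<le> 2 * exp (3 / 64 * (real n * g))" by linarith
  qed
qed

section \<open>Bounds uniform in the dimension\<close>

lemma crit_radius_sq: "0 \<le> R \<Longrightarrow> 1 \<le> n \<Longrightarrow> R \<le> crit_radius n \<Longrightarrow> 2 * pi * R\<^sup>2 \<le> real n - 1"
proof -
  assume *: "0 \<le> R" "1 \<le> n" "R \<le> crit_radius n"
  then have "R\<^sup>2 \<le> (crit_radius n)\<^sup>2" by (intro power_mono) auto
  also have "\<dots> = (real n - 1) / (2 * pi)" using *(2) by (simp add: crit_radius_def)
  finally show ?thesis by (simp add: field_simps)
qed

lemma exponential_growth:
  assumes "1 \<le> p" "p < 1.011871"
  shows "\<exists>\<alpha> :: real. \<alpha> > 1 \<and> (\<forall>n :: nat. n \<ge> 2 \<longrightarrow>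
    (\<exists>r R :: real. 0 < r \<and> r < R \<and> R < crit_radius n \<and> r / R < sqrt 2 - 1 \<and>
       (\<forall>\<xi> \<in> unit_vectors n.
          best_const n (gauss_measure n) p \<ge> ennreal (T_ratio n (gauss_measure n) p \<xi> R r) \<and>
          T_ratio n (gauss_measure n) p \<xi> R r \<ge> \<alpha> ^ n)))"
proof (intro exI conjI allI impI ballI)
  show "1 < exp (0.124848) / 1.02 * (1 / 50) powr (0.012 :: real)" by (rule growth_rate_gt_one)
  fix n :: nat assume n: "2 \<le> n"
  define R where "R = sqrt (real n / (5 * pi))"
  have R: "R > 0" using n by (simp add: R_def)
  show "0 < R / 50" "R / 50 < R" using R by simp_all
  \<comment> \<open>\<open>n / (5 * pi) < (n - 1) / (2 * pi)\<close> amounts to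
    \<open>n > 5 / 3\<close>.\<close>
  show "R < crit_radius n"
    unfolding R_def crit_radius_def using n by (intro real_sqrt_less_mono) (simp add: field_simps)
  have "1.1 < sqrt (2 :: real)" by (intro real_less_rsqrt) (simp add: power2_eq_square)
  then show "R / 50 / R < sqrt 2 - 1" using R by simp
  fix \<xi> assume "\<xi> \<in> unit_vectors n"
  then have \<xi>: "norm_dim n \<xi> = 1" by (rule unit_vectors_norm)
  show "ennreal (T_ratio n (gauss_measure n) p \<xi> R (R / 50)) \<le> best_const n (gauss_measure n) p"
    by (rule best_const_ge_T_ratio) (use n assms R \<xi> in auto)
  show "(exp (0.124848) / 1.02 * (1 / 50) powr 0.012) ^ n \<le> T_ratio n (gauss_measure n) p \<xi> R (R / 50)"
  proof (rule T_ratio_lower)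
    show "(p - 1) / p \<le> 0.012" using assms by (simp add: divide_le_eq)
  qed (use n assms \<xi> R_def in auto)
qed

lemma exponential_decay:
  assumes p: "1.049427 < p" and \<delta>: "0 < \<delta>" "\<delta> < 1"
  shows "\<exists>\<alpha> :: real. 0 < \<alpha> \<and> \<alpha> < 1 \<and> (\<forall>n :: nat. n \<ge> 1 \<longrightarrow>
    (\<forall>r R :: real. 0 < r \<and> r < R \<and> R \<le> crit_radius n \<and> r \<le> \<delta> * crit_radius n \<longrightarrow>
       (\<forall>\<xi> \<in> unit_vectors n. T_ratio n (gauss_measure n) p \<xi> R r \<le> sqrt pi * real n * \<alpha> ^ n)))"
proof -
  \<comment> \<open>The maximum secures both \<open>\<delta> \<le> e^2\<close>, which bounds
    \<open>r\<close>, and \<open>4 / 5 \<le> e\<close>.\<close>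
  define e where "e = sqrt (max \<delta> (16 / 25))"
  have e2: "e\<^sup>2 = max \<delta> (16 / 25)" using \<delta> by (simp add: e_def)
  have "e < 1" unfolding e_def using \<delta> by simp
  have "4 / 5 \<le> e" unfolding e_def by (intro real_le_rsqrt) (simp add: power2_eq_square)
  note e = this \<open>e < 1\<close>
  define \<gamma> where "\<gamma> = (e * exp ((1 - e\<^sup>2) / 2)) powr (3 / 64)"
  have "e * exp ((1 - e\<^sup>2) / 2) < 1"
  proof -
    have "0 < (1 - e) * (1 - e)" using e by simp
    then have "(1 - e\<^sup>2) / 2 < 1 - e" by (simp add: power2_eq_square field_simps)
    moreover have "ln e \<le> e - 1" using e by (intro ln_le_minus_one) auto
    moreover have "ln e + h < 0" if "ln e \<le> e - 1" "h < 1 - e" for h using that by linarith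
    ultimately have "ln e + (1 - e\<^sup>2) / 2 < 0" by blast
    then have "exp (ln e + (1 - e\<^sup>2) / 2) < 1" by (subst exp_less_one_iff)
    then show ?thesis using e by (simp add: exp_add)
  qed
  then have \<gamma>: "0 < \<gamma>" "\<gamma> < 1" 
    using e powr_less_mono2[of "3 / 64" "e * exp ((1 - e\<^sup>2) / 2)" 1] unfolding \<gamma>_def by auto
  define \<alpha> where "\<alpha> = max (exp (- (1 / 10000))) \<gamma>"
  have \<alpha>: "0 < \<alpha>" "\<alpha> < 1" using \<gamma> by (auto simp: \<alpha>_def)
  \<comment> \<open>\<open>3 / 64 = 0.046875\<close>, while \<open>(p - 1) / p > 0.047\<close> under
    the assumption on \<open>p\<close>.\<close>
  have s: "3 / 64 \<le> (p - 1) / p" using p by (simp add: le_divide_eq)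
  have "T_ratio n (gauss_measure n) p \<xi> R r \<le> sqrt pi * real n * \<alpha> ^ n"
    if n: "1 \<le> n" and r: "0 < r" "r < R" and Rn: "R \<le> crit_radius n" "r \<le> \<delta> * crit_radius n" and \<xi>: "\<xi> \<in> unit_vectors n" for n r R \<xi>
  proof -
    have R: "R > 0" using r by simp
    have norm: "norm_dim n \<xi> = 1" using \<xi> by (rule unit_vectors_norm)
    have R2: "2 * pi * R\<^sup>2 \<le> real n - 1" using R n Rn by (intro crit_radius_sq) auto
    moreover have "0 < 2 * pi * R\<^sup>2" using R by simp
    \<comment> \<open>In dimension \<open>1\<close> the critical radius is \<open>0\<close>, so
      there are no admissible radii.\<close>
    ultimately have n2: "2 \<le> n" by linarith
    show ?thesis
    proof (cases "r / R < sqrt 2 - 1")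
      case True
      have "sqrt 2 \<le> (141425 / 100000 :: real)" by (intro real_le_lsqrt) (auto simp: power2_eq_square)
      with True have "r / R \<le> 41425 / 100000" by linarith
      from T_ratio_near[OF n2 norm r s this R2]
      have "T_ratio n (gauss_measure n) p \<xi> R r \<le> sqrt pi * real n * exp (- (1 / 10000)) ^ n" .
      also have "\<dots> \<le> sqrt pi * real n * \<alpha> ^ n"
        by (intro mult_left_mono power_mono) (auto simp: \<alpha>_def)
      finally show ?thesis .
    next
      case False
      have "T_ratio n (gauss_measure n) p \<xi> R r \<le> 2 * \<gamma> ^ n"
        unfolding \<gamma>_def
      proof (rule T_ratio_far[OF _ norm r s _ _ e])
        have "r \<le> e\<^sup>2 * crit_radius n"
        proof -
          have "\<delta> * crit_radius n \<le> e\<^sup>2 * crit_radius n"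
            unfolding e2 using n by (intro mult_right_mono) (auto simp: crit_radius_def)
          with Rn show ?thesis by simp
        qed
        then have "r / e\<^sup>2 \<le> crit_radius n" using e by (simp add: divide_le_eq mult.commute)
        then have "2 * pi * (r / e\<^sup>2)\<^sup>2 \<le> real n - 1" using r n by (intro crit_radius_sq) auto
        then have "2 * pi * (r / e\<^sup>2)\<^sup>2 \<le> real n" by linarith
        then have "e ^ 4 * (2 * pi * (r / e\<^sup>2)\<^sup>2) \<le> e ^ 4 * real n" by (intro mult_left_mono) auto
        then show "2 * pi * r\<^sup>2 \<le> e ^ 4 * real n"
          using e by (simp add: power_divide power2_eq_square power4_eq_xxxx)
      qed (use n2 False R2 in auto)
      also have "\<dots> \<le> sqrt pi * real n * \<alpha> ^ n"
      proof (rule mult_mono)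
        have "1 \<le> sqrt pi" using pi_ge_two by simp
        then have "1 * 2 \<le> sqrt pi * real n" using n2 by (intro mult_mono) auto
        then show "2 \<le> sqrt pi * real n" by simp
        show "\<gamma> ^ n \<le> \<alpha> ^ n" using \<gamma> by (intro power_mono) (auto simp: \<alpha>_def)
      qed (use \<gamma> in auto)
      finally show ?thesis .
    qed
  qed
  with \<alpha> show ?thesis by blast
qed

theorem proposition3p1:
  shows "\<exists>p0 p1 :: real. 1 < p0 \<and> p0 < p1 \<and>
     \<bar>p0 - 1.011871\<bar> \<le> 0.0000005 \<and> \<bar>p1 - 1.049427\<bar> \<le> 0.0000005 \<and>
     (\<forall>p :: real. 1 \<le> p \<and> p < p0 \<longrightarrow>
        (\<exists>\<alpha> :: real. \<alpha> > 1 \<and>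
           (\<forall>n :: nat. n \<ge> 2 \<longrightarrow>
              (\<exists>r R :: real. 0 < r \<and> r < R \<and> R < crit_radius n \<and> r / R < sqrt 2 - 1 \<and>
                 (\<forall>\<xi> \<in> unit_vectors n.
                    best_const n (gauss_measure n) p \<ge> ennreal (T_ratio n (gauss_measure n) p \<xi> R r) \<and>
                    T_ratio n (gauss_measure n) p \<xi> R r \<ge> \<alpha> ^ n))))) \<and>
     (\<forall>p :: real. p > p1 \<longrightarrow>
        (\<forall>\<delta> :: real. 0 < \<delta> \<and> \<delta> < 1 \<longrightarrow>
           (\<exists>\<alpha> :: real. 0 < \<alpha> \<and> \<alpha> < 1 \<and>
              (\<forall>n :: nat. n \<ge> 1 \<longrightarrow>
                 (\<forall>r R :: real. 0 < r \<and> r < R \<and> R \<le> crit_radius n \<and> r \<le> \<delta> * crit_radius n \<longrightarrow>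
                    (\<forall>\<xi> \<in> unit_vectors n.
                       T_ratio n (gauss_measure n) p \<xi> R r \<le> sqrt pi * real n * \<alpha> ^ n))))))"
proof (rule exI[of _ "1.011871"], rule exI[of _ "1.049427"], intro conjI allI impI)
  fix p :: real
  show "\<exists>\<alpha> :: real. \<alpha> > 1 \<and>
           (\<forall>n :: nat. n \<ge> 2 \<longrightarrow>
              (\<exists>r R :: real. 0 < r \<and> r < R \<and> R < crit_radius n \<and> r / R < sqrt 2 - 1 \<and>
                 (\<forall>\<xi> \<in> unit_vectors n.
                    best_const n (gauss_measure n) p \<ge> ennreal (T_ratio n (gauss_measure n) p \<xi> R r) \<and>
                    T_ratio n (gauss_measure n) p \<xi> R r \<ge> \<alpha> ^ n)))"
    if "1 \<le> p \<and> p < 1.011871"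
    using that by (intro exponential_growth) auto
next
  fix p \<delta> :: real
  show "\<exists>\<alpha> :: real. 0 < \<alpha> \<and> \<alpha> < 1 \<and>
              (\<forall>n :: nat. n \<ge> 1 \<longrightarrow>
                 (\<forall>r R :: real. 0 < r \<and> r < R \<and> R \<le> crit_radius n \<and> r \<le> \<delta> * crit_radius n \<longrightarrow>
                    (\<forall>\<xi> \<in> unit_vectors n.
                       T_ratio n (gauss_measure n) p \<xi> R r \<le> sqrt pi * real n * \<alpha> ^ n)))"
    if "p > 1.049427" "0 < \<delta> \<and> \<delta> < 1"
    using that by (intro exponential_decay) auto
qed simp_all

end
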